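(* Let $G,(\gamma),\mathbf P,f,\Phi,\Phi_1,\Phi_0$ be as in the context, let $u$ be an admissible control with state $x$, and let $\psi$ be the associated co-state $$\psi_j(s,t)=\iint_{E(s,t)}F_i(\sigma,\tau)R^i_j(\sigma,\tau,s,t)\,dA(\sigma,\tau)+\int_{\gamma(s,t)}F_{1,i}(\sigma,\tau)R^i_j(\sigma,\tau,s,t)\,d\mu(\sigma,\tau)+\sum_{r=1}^N F_{0,i}(P_r)R^i_j(P_r,s,t)\,\chi\big((s,t)\in W(P_r)\big).$$ (1) At every point $(s,t)\notin\mathbf P$ in the relative interior (in the relative topology of $(\gamma)$) of a flat part of $(\gamma)$, for $j=1,\dots,n$, $$\big[n_1(s,t)^2-n_2(s,t)^2\big]\frac{\partial\psi_j(s,t)}{\partial\mu}+n_1(s,t)\frac{\partial H}{\partial p^j}+n_2(s,t)\frac{\partial H}{\partial q^j}+\frac{\partial\Phi_1}{\partial x^j}-\frac{D}{D\mu}\frac{\partial\Phi_1}{\partial\eta^j}=0,$$ where $H(s,t,x,p,q,\psi,u)=\Phi(s,t,x,p,q,u)+\psi_kf^k(s,t,x,p,q,u)$, its derivatives are evaluated at $(s,t,x(s,t),x_s(s,t),x_t(s,t),\psi(s,t),u(s,t))$, and those of $\Phi_1$ at $(s,t,x(s,t),x_\mu(s,t))$. (2) If $P\notin\mathbf P$ is a point in the relative interior of the oblique part of $(\gamma)$, then, for $(s,t)\to P$ with $(s,t)\in\operatorname{int}(G_R)$ and $j=1,\dots,n$, $$\lim_{(s,t)\to P}\psi_j(s,t)=0,\qquad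 \lim_{(s,t)\to P}\Big[n_2(P)\frac{\partial\psi_j(s,t)}{\partial s}\Big]=\lim_{(s,t)\to P}\Big[n_1(P)\frac{\partial\psi_j(s,t)}{\partial t}\Big]=-F_{1,j}(P).$$
   Context: Geometry. $G$ is a domain in the first quadrant ($s\ge0,t\ge0$) of the $st$-plane bounded by the segment $[0,a]$ of the $s$-axis, the segment $[0,b]$ of the $t$-axis and a continuous, piecewise $C^2$ curve $(\gamma)$ from $(a,0)$ to $(0,b)$ (the points of $(\gamma)$ belong to $G$) which is a non-increasing graph (possibly with vertical or horizontal segments), with at most finitely many points at which the normal field has jump discontinuities; every smooth segment of $(\gamma)$ can be represented as $s=\vartheta_1(t)$ or as $t=\vartheta_2(s)$. $\mu$ is arc length on $(\gamma)$ measured from $(a,0)$. $\mathbf P=\{P_0=(a,0),P_1,\dots,P_N,P_{N+1}=(0,b)\}$ is a finite set of points of $(\gamma)$, numbered in order of increasing $\mu$, called vertices, containing all jump points of the normal (and possibly further points). $s(P),t(P)$ are the coordinates of $P$. The regular part of $G$ is $G_R=\{(s,t)\in G: s\ne s(P_r),\ t\ne t(P_r)\ \forall r=0,\dots,N+1\}$. $(n_1,n_2)$ is the outward unit normal on the smooth part of $(\gamma)$; the tangential derivative is $\varphi_\mu=\frac{\partial\varphi}{\partial\mu}=-n_2\varphi_s+n_1\varphi_t$. A connected part of $(\gamma)$ is called flat if it is a straight line segment parallel to the $s$-axis or to the $t$-axis, and oblique if it contains no straight line segment parallel to either axis. $W(s,t)=\{(\sigma,\tau):0\le\sigma\le s,0\le\tau\le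 t\}$, $E(s,t)=\{(\sigma,\tau)\in G:(s,t)\in W(\sigma,\tau)\}$, $\gamma(s,t)=(\gamma)\cap E(s,t)$; $\chi(\cdot)$ is $1$ if the statement is true and $0$ otherwise. Control problem. The state $x(s,t)\in\mathbb R^n$ solves $x_{st}=f(s,t,x,x_s,x_t,u)$ in $G$, $x(s,0)=x_1(s)$ for $0\le s\le a$, $x(0,t)=x_2(t)$ for $0\le t\le b$, with $x_1,x_2$ continuous, $x_1(0)=x_2(0)$; $f=f(s,t,x,p,q,u)$ is Lipschitz in $(x,p,q)$ and continuous in $u$ ($p,q$ are the slots of $x_s,x_t$). The control $u(s,t)\in\mathbb R^m$ takes values in the box $\mathbf U=\{\underline u^j\le u^j\le\overline u^j\}$. The cost is $$J=\iint_G\Phi(s,t,x,x_s,x_t,u)\,dA+\int_{(\gamma)}\Phi_1(s,t,x,x_\mu)\,d\mu+\sum_{P\in\mathbf P}\Phi_0(P,x(P)),$$ with $\Phi=\Phi(s,t,x,p,q,u)$, $\Phi_1=\Phi_1(s,t,x,\eta)$ ($\eta$ is the slot of $x_\mu$). All functions involved are assumed continuously differentiable sufficiently many times. Conventions. Coordinates are superscripts; repeated sub/superscripts are summed. $\frac{D}{Ds},\frac{D}{Dt},\frac{D}{D\mu}$ are total derivatives, i.e. derivatives with respect to $s$, $t$, $\mu$ of the composite function obtained after inserting $x(s,t),x_s,x_t,u(s,t)$ (respectively $x,x_\mu$ on $(\gamma)$). Derivatives of $f,\Phi,\Phi_1$ below are evaluated along $(x,u)$. Auxiliary functions. $F_i=\Phi_{x^i}-\frac{D}{Ds}\Phi_{p^i}-\frac{D}{Dt}\Phi_{q^i}$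 on $G$; $F_{1,i}=n_1\Phi_{p^i}+n_2\Phi_{q^i}+\Phi_{1,x^i}-\frac{D}{D\mu}\Phi_{1,\eta^i}$ on $(\gamma)\setminus\mathbf P$; $F_{0,i}(P_r)=\Phi_{0,x^i}(P_r,x(P_r))-V_r(\Phi_{1,\eta^i})$, where $V_r(\varphi)$ is the jump of $\varphi$ at $P_r$ along $(\gamma)$, i.e. the limit as $\mu$ decreases to its value at $P_r$ minus the limit as $\mu$ increases to it. Riemann function. $R^i_j(s,t,\sigma,\tau)$, defined for $(\sigma,\tau)\in W(s,t)$ (and taken to be $0$ otherwise), is the matrix-valued Riemann function of the linearized equation: $\partial_s\partial_tR^i_j=f^i_{x^k}(s,t)R^k_j+f^i_{p^k}(s,t)\partial_sR^k_j+f^i_{q^k}(s,t)\partial_tR^k_j$ for $s>\sigma,t>\tau$; $\partial_sR^i_j(s,\tau,\sigma,\tau)=f^i_{q^k}(s,\tau)R^k_j(s,\tau,\sigma,\tau)$; $\partial_tR^i_j(\sigma,t,\sigma,\tau)=f^i_{p^k}(\sigma,t)R^k_j(\sigma,t,\sigma,\tau)$; $R^i_j(\sigma,\tau,\sigma,\tau)=\delta^i_j$. It equivalently solves the adjoint problem in its last two arguments: $\partial_s\partial_tR^i_j(\sigma,\tau,s,t)=f^k_{x^j}(s,t)R^i_k-\frac{D}{Ds}[f^k_{p^j}(s,t)R^i_k]-\frac{D}{Dt}[f^k_{q^j}(s,t)R^i_k]$ for $s<\sigma,t<\tau$; $\partial_tR^i_j(\sigma,\tau,\sigma,t)=-f^k_{p^j}(\sigma,t)R^i_k(\sigma,\tau,\sigma,t)$;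 $\partial_sR^i_j(\sigma,\tau,s,\tau)=-f^k_{q^j}(s,\tau)R^i_k(\sigma,\tau,s,\tau)$; $R^i_j(\sigma,\tau,\sigma,\tau)=\delta^i_j$.
   Formalization: In (2) the limit of n_2(P)∂ψ_j/∂s is claimed only if n_2(P)≠0, and that of n_1(P)∂ψ_j/∂t only if n_1(P)≠0: an oblique part may have isolated points with axis-parallel tangent, where the product is identically 0 while F_{1,j}(P) need not vanish. *)

theory Defs
  imports "HOL-Analysis.Analysis"
begin

type_synonym point = "real \<times> real"

definition partial :: "'n::finite \<Rightarrow> (real^'n \<Rightarrow> real) \<Rightarrow> real^'n \<Rightarrow> real" where
  "partial i \<phi> v = frechet_derivative \<phi> (at v) (axis i 1)"

definition C1_on :: "'a::real_normed_vector set \<Rightarrow> ('a \<Rightarrow> 'b::real_normed_vector) \<Rightarrow> bool" where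
  "C1_on \<Omega> h \<longleftrightarrow> (\<exists>h' :: 'a \<Rightarrow> 'a \<Rightarrow>\<^sub>L 'b. continuous_on \<Omega> h' \<and>
     (\<forall>v\<in>\<Omega>. (h has_derivative blinfun_apply (h' v)) (at v)))"

definition C2_on :: "'a::real_normed_vector set \<Rightarrow> ('a \<Rightarrow> 'b::real_normed_vector) \<Rightarrow> bool" where
  "C2_on \<Omega> h \<longleftrightarrow> (\<exists>h' :: 'a \<Rightarrow> 'a \<Rightarrow>\<^sub>L 'b. C1_on \<Omega> h' \<and>
     (\<forall>v\<in>\<Omega>. (h has_derivative blinfun_apply (h' v)) (at v)))"

definition C2_near :: "'a::real_normed_vector set \<Rightarrow> ('a \<Rightarrow> 'b::real_normed_vector) \<Rightarrow> bool" where
  "C2_near S h \<longleftrightarrow> (\<exists>\<Omega>. open \<Omega> \<and> S \<subseteq> \<Omega> \<and> C2_on \<Omega> h)"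

text \<open>
  Functions of \<open>(s,t)\<close> are only given on the closed region \<open>G\<close>, so they are differentiated
  within \<open>G\<close>: \<open>has_partials G \<phi> \<phi>s \<phi>t\<close> says that \<open>\<phi>\<close> is continuously differentiable on \<open>G\<close>, up
  to the boundary, with partial derivatives \<open>\<phi>s\<close> and \<open>\<phi>t\<close>. The partial derivatives are arguments
  because at the two tips of \<open>G\<close> on the axes the derivative within \<open>G\<close> need not be unique; there
  it is their continuity that determines them.
\<close>

definition has_partials ::
    "point set \<Rightarrow> (point \<Rightarrow> 'v::real_normed_vector) \<Rightarrow> (point \<Rightarrow> 'v) \<Rightarrow> (point \<Rightarrow> 'v) \<Rightarrow> bool" where
  "has_partials G \<phi> \<phi>s \<phi>t \<longleftrightarrow> continuous_on G \<phi>s \<and> continuous_on G \<phi>t \<and>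
     (\<forall>z\<in>G. (\<phi> has_derivative (\<lambda>(h, k). h *\<^sub>R \<phi>s z + k *\<^sub>R \<phi>t z)) (at z within G))"

text \<open>The total derivatives \<open>D/Ds\<close> and \<open>D/Dt\<close> of a composite function on \<open>G\<close> (one-sided on the
  boundary of \<open>G\<close>).\<close>

definition D_s :: "point set \<Rightarrow> (point \<Rightarrow> real) \<Rightarrow> point \<Rightarrow> real" where
  "D_s G \<phi> z = vector_derivative (\<lambda>s. \<phi> (s, snd z)) (at (fst z) within {s. (s, snd z) \<in> G})"

definition D_t :: "point set \<Rightarrow> (point \<Rightarrow> real) \<Rightarrow> point \<Rightarrow> real" where
  "D_t G \<phi> z = vector_derivative (\<lambda>t. \<phi> (fst z, t)) (at (snd z) within {t. (fst z, t) \<in> G})"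

text \<open>
  The curve is given by its arc-length parametrization \<open>g\<close> on \<open>{0..L}\<close>, starting at \<open>(a,0)\<close>.
  The vertices are \<open>P\<^sub>r = g (\<nu> r)\<close> for \<open>r \<le> N + 1\<close>. The smooth segments are the arcs between
  consecutive vertices; they are of class \<open>C\<^sup>2\<close> up to their endpoints, so that the normal and
  the curvature are continuous away from the vertices.
\<close>

definition boundary_curve ::
    "real \<Rightarrow> real \<Rightarrow> real \<Rightarrow> (real \<Rightarrow> point) \<Rightarrow> nat \<Rightarrow> (nat \<Rightarrow> real) \<Rightarrow> bool" where
  "boundary_curve a b L g N \<nu> \<longleftrightarrow>
     0 < a \<and> 0 < b \<and> 0 < L \<and> continuous_on {0..L} g \<and> g 0 = (a, 0) \<and> g L = (0, b) \<and>
     (\<forall>\<mu>\<in>{0<..<L}. 0 < fst (g \<mu>) \<and> 0 < snd (g \<mu>)) \<and>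
     antimono_on {0..L} (fst \<circ> g) \<and> mono_on {0..L} (snd \<circ> g) \<and>
     \<nu> 0 = 0 \<and> \<nu> (Suc N) = L \<and> strict_mono_on {0..Suc N} \<nu> \<and>
     (\<forall>r\<le>N. let I = {\<nu> r..\<nu> (Suc r)} in
        (\<exists>g' g''. continuous_on I g'' \<and>
           (\<forall>\<mu>\<in>I. (g has_vector_derivative g' \<mu>) (at \<mu> within I) \<and>
                  (g' has_vector_derivative g'' \<mu>) (at \<mu> within I) \<and> norm (g' \<mu>) = 1)) \<and>
        ((\<exists>\<theta>1. \<forall>\<mu>\<in>I. fst (g \<mu>) = \<theta>1 (snd (g \<mu>))) \<or>
         (\<exists>\<theta>2. \<forall>\<mu>\<in>I. snd (g \<mu>) = \<theta>2 (fst (g \<mu>)))))"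

definition rect :: "point \<Rightarrow> point set" where
  "rect z = {0..fst z} \<times> {0..snd z}"

text \<open>Since the curve is non-increasing, the closed region that it bounds together with the axes
  consists of the points of the first quadrant lying below and to the left of some point of it.\<close>

definition region :: "real \<Rightarrow> (real \<Rightarrow> point) \<Rightarrow> point set" where
  "region L g = (\<Union>\<mu>\<in>{0..L}. rect (g \<mu>))"

definition upper_part :: "point set \<Rightarrow> point \<Rightarrow> point set" where
  "upper_part G w = {z \<in> G. w \<in> rect z}"

definition regular_part ::
    "point set \<Rightarrow> (real \<Rightarrow> point) \<Rightarrow> nat \<Rightarrow> (nat \<Rightarrow> real) \<Rightarrow> point set" where
  "regular_part G g N \<nu> =
     {z \<in> G. \<forall>r\<le>Suc N. fst z \<noteq> fst (g (\<nu> r)) \<and> snd z \<noteq> snd (g (\<nu> r))}"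

text \<open>The unit tangent in the direction of increasing \<open>\<mu>\<close> is \<open>(- n\<^sub>2, n\<^sub>1)\<close>.\<close>

definition n1 :: "(real \<Rightarrow> point) \<Rightarrow> real \<Rightarrow> real" where
  "n1 g \<mu> = snd (vector_derivative g (at \<mu>))"

definition n2 :: "(real \<Rightarrow> point) \<Rightarrow> real \<Rightarrow> real" where
  "n2 g \<mu> = - fst (vector_derivative g (at \<mu>))"

text \<open>Connected parts of the curve are images of parameter intervals.\<close>

definition flat_arc :: "(real \<Rightarrow> point) \<Rightarrow> real \<Rightarrow> real \<Rightarrow> bool" where
  "flat_arc g \<alpha> \<beta> \<longleftrightarrow> \<alpha> < \<beta> \<and>
     ((\<forall>\<mu>\<in>{\<alpha>..\<beta>}. fst (g \<mu>) = fst (g \<alpha>)) \<or> (\<forall>\<mu>\<in>{\<alpha>..\<beta>}. snd (g \<mu>) = snd (g \<alpha>)))"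

definition oblique_arc :: "(real \<Rightarrow> point) \<Rightarrow> real \<Rightarrow> real \<Rightarrow> bool" where
  "oblique_arc g \<alpha> \<beta> \<longleftrightarrow> \<alpha> < \<beta> \<and> (\<forall>\<alpha>' \<beta>'. \<alpha> \<le> \<alpha>' \<and> \<beta>' \<le> \<beta> \<longrightarrow> \<not> flat_arc g \<alpha>' \<beta>')"

definition flat_interior :: "real \<Rightarrow> (real \<Rightarrow> point) \<Rightarrow> real \<Rightarrow> bool" where
  "flat_interior L g \<mu> \<longleftrightarrow> (\<exists>\<alpha> \<beta>. 0 \<le> \<alpha> \<and> \<alpha> < \<mu> \<and> \<mu> < \<beta> \<and> \<beta> \<le> L \<and> flat_arc g \<alpha> \<beta>)"

definition oblique_interior :: "real \<Rightarrow> (real \<Rightarrow> point) \<Rightarrow> real \<Rightarrow> bool" where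
  "oblique_interior L g \<mu> \<longleftrightarrow> (\<exists>\<alpha> \<beta>. 0 \<le> \<alpha> \<and> \<alpha> < \<mu> \<and> \<mu> < \<beta> \<and> \<beta> \<le> L \<and> oblique_arc g \<alpha> \<beta>)"

definition smooth_data ::
    "point set \<Rightarrow> real \<Rightarrow> (real \<Rightarrow> point) \<Rightarrow> nat \<Rightarrow> (nat \<Rightarrow> real) \<Rightarrow> real^'m::finite \<Rightarrow> real^'m \<Rightarrow>
     (point \<Rightarrow> real^'n::finite \<Rightarrow> real^'n \<Rightarrow> real^'n \<Rightarrow> real^'m \<Rightarrow> real^'n) \<Rightarrow>
     (point \<Rightarrow> real^'n \<Rightarrow> real^'n \<Rightarrow> real^'n \<Rightarrow> real^'m \<Rightarrow> real) \<Rightarrow>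
     (point \<Rightarrow> real^'n \<Rightarrow> real^'n \<Rightarrow> real) \<Rightarrow> (point \<Rightarrow> real^'n \<Rightarrow> real) \<Rightarrow> bool" where
  "smooth_data G L g N \<nu> ulo uhi f \<Phi> \<Phi>1 \<Phi>0 \<longleftrightarrow>
     C2_near (G \<times> UNIV \<times> UNIV \<times> UNIV \<times> cbox ulo uhi) (\<lambda>(z, y, p, q, v). f z y p q v) \<and>
     (\<exists>K. \<forall>z\<in>G. \<forall>v\<in>cbox ulo uhi. \<forall>y p q y' p' q'.
        norm (f z y p q v - f z y' p' q' v) \<le> K * (norm (y - y') + norm (p - p') + norm (q - q'))) \<and>
     C2_near (G \<times> UNIV \<times> UNIV \<times> UNIV \<times> cbox ulo uhi) (\<lambda>(z, y, p, q, v). \<Phi> z y p q v) \<and>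
     C2_near ((g ` {0..L}) \<times> UNIV \<times> UNIV) (\<lambda>(z, y, \<eta>). \<Phi>1 z y \<eta>) \<and>
     (\<forall>r\<le>Suc N. C1_on UNIV (\<Phi>0 (g (\<nu> r))))"

text \<open>The control has to be continuously differentiable because the total derivatives of
  \<open>\<Phi>\<^sub>p\<close>, \<open>\<Phi>\<^sub>q\<close>, \<open>f\<^sub>p\<close>, \<open>f\<^sub>q\<close> along \<open>u\<close> enter the co-state and the Riemann function.\<close>

definition admissible_control ::
    "point set \<Rightarrow> real^'m::finite \<Rightarrow> real^'m \<Rightarrow> (point \<Rightarrow> real^'m) \<Rightarrow> bool" where
  "admissible_control G ulo uhi u \<longleftrightarrow>
     (\<forall>z\<in>G. u z \<in> cbox ulo uhi) \<and> (\<exists>us ut. has_partials G u us ut)"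

text \<open>\<open>xs\<close> and \<open>xt\<close> are the partial derivatives of the state \<open>x\<close>.\<close>

definition is_state ::
    "real \<Rightarrow> real \<Rightarrow> point set \<Rightarrow>
     (point \<Rightarrow> real^'n::finite \<Rightarrow> real^'n \<Rightarrow> real^'n \<Rightarrow> real^'m::finite \<Rightarrow> real^'n) \<Rightarrow>
     (real \<Rightarrow> real^'n) \<Rightarrow> (real \<Rightarrow> real^'n) \<Rightarrow> (point \<Rightarrow> real^'m) \<Rightarrow>
     (point \<Rightarrow> real^'n) \<Rightarrow> (point \<Rightarrow> real^'n) \<Rightarrow> (point \<Rightarrow> real^'n) \<Rightarrow> bool" where
  "is_state a b G f x1 x2 u x xs xt \<longleftrightarrow>
     continuous_on {0..a} x1 \<and> continuous_on {0..b} x2 \<and> x1 0 = x2 0 \<and>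
     (\<forall>s\<in>{0..a}. x (s, 0) = x1 s) \<and> (\<forall>t\<in>{0..b}. x (0, t) = x2 t) \<and>
     has_partials G x xs xt \<and>
     (\<exists>xss xst xtt. has_partials G xs xss xst \<and> has_partials G xt xst xtt \<and>
        (\<forall>z\<in>G. xst z = f z (x z) (xs z) (xt z) (u z)))"

definition x_mu :: "(real \<Rightarrow> point) \<Rightarrow> (point \<Rightarrow> real^'n::finite) \<Rightarrow> (point \<Rightarrow> real^'n) \<Rightarrow> real \<Rightarrow> real^'n" where
  "x_mu g xs xt \<mu> = - n2 g \<mu> *\<^sub>R xs (g \<mu>) + n1 g \<mu> *\<^sub>R xt (g \<mu>)"

text \<open>
  \<open>R z w $ i $ j\<close> is \<open>R\<^sup>i\<^sub>j(z, w)\<close>, and \<open>A\<close>, \<open>B\<close>, \<open>C\<close> are the coefficient matrices \<open>f\<^sub>x\<close>, \<open>f\<^sub>p\<close>, \<open>f\<^sub>q\<close>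
  along the given control and state. \<open>R1\<close>, ..., \<open>R4\<close> are the partial derivatives of \<open>R\<close> in its four
  scalar arguments. With the summation convention, \<open>f\<^sup>i\<^sub>k R\<^sup>k\<^sub>j\<close> is \<open>f ** R\<close> in the direct problem,
  while \<open>f\<^sup>k\<^sub>j R\<^sup>i\<^sub>k\<close> is \<open>R ** f\<close> in the adjoint one. For smooth coefficients the direct problem
  (in the first pair of arguments) and the adjoint problem (in the second pair) have the same
  solution, the Riemann function; the predicate records both.
\<close>

definition riemann_function ::
    "point set \<Rightarrow> (point \<Rightarrow> real^'n::finite^'n) \<Rightarrow> (point \<Rightarrow> real^'n^'n) \<Rightarrow> (point \<Rightarrow> real^'n^'n) \<Rightarrow>
     (point \<Rightarrow> point \<Rightarrow> real^'n^'n) \<Rightarrow> bool" where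
  "riemann_function G A B C R \<longleftrightarrow>
     (\<forall>z w. \<not> (z \<in> G \<and> w \<in> rect z) \<longrightarrow> R z w = 0) \<and>
     (\<forall>z\<in>G. R z z = mat 1) \<and>
     (\<exists>R1 R2 R3 R4.
        (\<forall>Q\<in>{R, R1, R2, R3, R4}. continuous_on {(z, w). z \<in> G \<and> w \<in> rect z} (\<lambda>(z, w). Q z w)) \<and>
        (\<forall>s t \<sigma> \<tau>. (s, t) \<in> G \<and> (\<sigma>, \<tau>) \<in> rect (s, t) \<longrightarrow>
           ((\<lambda>s'. R (s', t) (\<sigma>, \<tau>)) has_vector_derivative R1 (s, t) (\<sigma>, \<tau>))
              (at s within {s'. \<sigma> \<le> s' \<and> (s', t) \<in> G}) \<and>
           ((\<lambda>t'. R (s, t') (\<sigma>, \<tau>)) has_vector_derivative R2 (s, t) (\<sigma>, \<tau>))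
              (at t within {t'. \<tau> \<le> t' \<and> (s, t') \<in> G}) \<and>
           ((\<lambda>\<sigma>'. R (s, t) (\<sigma>', \<tau>)) has_vector_derivative R3 (s, t) (\<sigma>, \<tau>)) (at \<sigma> within {0..s}) \<and>
           ((\<lambda>\<tau>'. R (s, t) (\<sigma>, \<tau>')) has_vector_derivative R4 (s, t) (\<sigma>, \<tau>)) (at \<tau> within {0..t}) \<and>
           (\<sigma> < s \<and> \<tau> < t \<longrightarrow>
              ((\<lambda>s'. R2 (s', t) (\<sigma>, \<tau>)) has_vector_derivative
                 A (s, t) ** R (s, t) (\<sigma>, \<tau>) + B (s, t) ** R1 (s, t) (\<sigma>, \<tau>)
                   + C (s, t) ** R2 (s, t) (\<sigma>, \<tau>))
                (at s within {s'. \<sigma> \<le> s' \<and> (s', t) \<in> G})) \<and>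
           R1 (s, \<tau>) (\<sigma>, \<tau>) = C (s, \<tau>) ** R (s, \<tau>) (\<sigma>, \<tau>) \<and>
           R2 (\<sigma>, t) (\<sigma>, \<tau>) = B (\<sigma>, t) ** R (\<sigma>, t) (\<sigma>, \<tau>) \<and>
           (\<sigma> < s \<and> \<tau> < t \<longrightarrow>
              ((\<lambda>\<sigma>'. R4 (s, t) (\<sigma>', \<tau>)) has_vector_derivative
                 R (s, t) (\<sigma>, \<tau>) ** A (\<sigma>, \<tau>)
                   - vector_derivative (\<lambda>\<sigma>'. R (s, t) (\<sigma>', \<tau>) ** B (\<sigma>', \<tau>)) (at \<sigma> within {0..s})
                   - vector_derivative (\<lambda>\<tau>'. R (s, t) (\<sigma>, \<tau>') ** C (\<sigma>, \<tau>')) (at \<tau> within {0..t}))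
                (at \<sigma> within {0..s})) \<and>
           R4 (s, t) (s, \<tau>) = - (R (s, t) (s, \<tau>) ** B (s, \<tau>)) \<and>
           R3 (s, t) (\<sigma>, t) = - (R (s, t) (\<sigma>, t) ** C (\<sigma>, t))))"

definition linearized_riemann ::
    "point set \<Rightarrow> (point \<Rightarrow> real^'n::finite \<Rightarrow> real^'n \<Rightarrow> real^'n \<Rightarrow> real^'m::finite \<Rightarrow> real^'n) \<Rightarrow>
     (point \<Rightarrow> real^'m) \<Rightarrow> (point \<Rightarrow> real^'n) \<Rightarrow> (point \<Rightarrow> real^'n) \<Rightarrow> (point \<Rightarrow> real^'n) \<Rightarrow>
     (point \<Rightarrow> point \<Rightarrow> real^'n^'n) \<Rightarrow> bool" where
  "linearized_riemann G f u x xs xt R \<longleftrightarrow> riemann_function G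
     (\<lambda>z. jacobian (\<lambda>y. f z y (xs z) (xt z) (u z)) (at (x z)))
     (\<lambda>z. jacobian (\<lambda>p. f z (x z) p (xt z) (u z)) (at (xs z)))
     (\<lambda>z. jacobian (\<lambda>q. f z (x z) (xs z) q (u z)) (at (xt z))) R"

definition F_area ::
    "point set \<Rightarrow> (point \<Rightarrow> real^'n::finite \<Rightarrow> real^'n \<Rightarrow> real^'n \<Rightarrow> real^'m::finite \<Rightarrow> real) \<Rightarrow>
     (point \<Rightarrow> real^'m) \<Rightarrow> (point \<Rightarrow> real^'n) \<Rightarrow> (point \<Rightarrow> real^'n) \<Rightarrow> (point \<Rightarrow> real^'n) \<Rightarrow>
     'n \<Rightarrow> point \<Rightarrow> real" where
  "F_area G \<Phi> u x xs xt i z =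
     partial i (\<lambda>y. \<Phi> z y (xs z) (xt z) (u z)) (x z)
     - D_s G (\<lambda>w. partial i (\<lambda>p. \<Phi> w (x w) p (xt w) (u w)) (xs w)) z
     - D_t G (\<lambda>w. partial i (\<lambda>q. \<Phi> w (x w) (xs w) q (u w)) (xt w)) z"

text \<open>Functions on the curve are functions of the arc length \<open>\<mu>\<close>.\<close>

definition Phi1_x ::
    "(real \<Rightarrow> point) \<Rightarrow> (point \<Rightarrow> real^'n::finite \<Rightarrow> real^'n \<Rightarrow> real) \<Rightarrow>
     (point \<Rightarrow> real^'n) \<Rightarrow> (point \<Rightarrow> real^'n) \<Rightarrow> (point \<Rightarrow> real^'n) \<Rightarrow> 'n \<Rightarrow> real \<Rightarrow> real" where
  "Phi1_x g \<Phi>1 x xs xt i \<mu> = partial i (\<lambda>y. \<Phi>1 (g \<mu>) y (x_mu g xs xt \<mu>)) (x (g \<mu>))"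

definition Phi1_eta ::
    "(real \<Rightarrow> point) \<Rightarrow> (point \<Rightarrow> real^'n::finite \<Rightarrow> real^'n \<Rightarrow> real) \<Rightarrow>
     (point \<Rightarrow> real^'n) \<Rightarrow> (point \<Rightarrow> real^'n) \<Rightarrow> (point \<Rightarrow> real^'n) \<Rightarrow> 'n \<Rightarrow> real \<Rightarrow> real" where
  "Phi1_eta g \<Phi>1 x xs xt i \<mu> = partial i (\<lambda>\<eta>. \<Phi>1 (g \<mu>) (x (g \<mu>)) \<eta>) (x_mu g xs xt \<mu>)"

definition F_curve ::
    "(real \<Rightarrow> point) \<Rightarrow> (point \<Rightarrow> real^'n::finite \<Rightarrow> real^'n \<Rightarrow> real^'n \<Rightarrow> real^'m::finite \<Rightarrow> real) \<Rightarrow>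
     (point \<Rightarrow> real^'n \<Rightarrow> real^'n \<Rightarrow> real) \<Rightarrow>
     (point \<Rightarrow> real^'m) \<Rightarrow> (point \<Rightarrow> real^'n) \<Rightarrow> (point \<Rightarrow> real^'n) \<Rightarrow> (point \<Rightarrow> real^'n) \<Rightarrow>
     'n \<Rightarrow> real \<Rightarrow> real" where
  "F_curve g \<Phi> \<Phi>1 u x xs xt i \<mu> = (let z = g \<mu> in
     n1 g \<mu> * partial i (\<lambda>p. \<Phi> z (x z) p (xt z) (u z)) (xs z)
     + n2 g \<mu> * partial i (\<lambda>q. \<Phi> z (x z) (xs z) q (u z)) (xt z)
     + Phi1_x g \<Phi>1 x xs xt i \<mu> - deriv (Phi1_eta g \<Phi>1 x xs xt i) \<mu>)"

definition jump :: "(real \<Rightarrow> real) \<Rightarrow> real \<Rightarrow> real" where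
  "jump \<phi> \<mu> = Lim (at_right \<mu>) \<phi> - Lim (at_left \<mu>) \<phi>"

definition F_vertex ::
    "(real \<Rightarrow> point) \<Rightarrow> (nat \<Rightarrow> real) \<Rightarrow> (point \<Rightarrow> real^'n::finite \<Rightarrow> real^'n \<Rightarrow> real) \<Rightarrow>
     (point \<Rightarrow> real^'n \<Rightarrow> real) \<Rightarrow>
     (point \<Rightarrow> real^'n) \<Rightarrow> (point \<Rightarrow> real^'n) \<Rightarrow> (point \<Rightarrow> real^'n) \<Rightarrow> 'n \<Rightarrow> nat \<Rightarrow> real" where
  "F_vertex g \<nu> \<Phi>1 \<Phi>0 x xs xt i r =
     partial i (\<Phi>0 (g (\<nu> r))) (x (g (\<nu> r))) - jump (Phi1_eta g \<Phi>1 x xs xt i) (\<nu> r)"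

definition costate ::
    "point set \<Rightarrow> real \<Rightarrow> (real \<Rightarrow> point) \<Rightarrow> nat \<Rightarrow> (nat \<Rightarrow> real) \<Rightarrow>
     (point \<Rightarrow> real^'n::finite \<Rightarrow> real^'n \<Rightarrow> real^'n \<Rightarrow> real^'m::finite \<Rightarrow> real) \<Rightarrow>
     (point \<Rightarrow> real^'n \<Rightarrow> real^'n \<Rightarrow> real) \<Rightarrow> (point \<Rightarrow> real^'n \<Rightarrow> real) \<Rightarrow>
     (point \<Rightarrow> real^'m) \<Rightarrow> (point \<Rightarrow> real^'n) \<Rightarrow> (point \<Rightarrow> real^'n) \<Rightarrow> (point \<Rightarrow> real^'n) \<Rightarrow>
     (point \<Rightarrow> point \<Rightarrow> real^'n^'n) \<Rightarrow> point \<Rightarrow> real^'n" where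
  "costate G L g N \<nu> \<Phi> \<Phi>1 \<Phi>0 u x xs xt R w = (\<chi> j.
     integral (upper_part G w) (\<lambda>z. \<Sum>i\<in>UNIV. F_area G \<Phi> u x xs xt i z * R z w $ i $ j)
     + integral {\<mu> \<in> {0..L}. g \<mu> \<in> upper_part G w}
         (\<lambda>\<mu>. \<Sum>i\<in>UNIV. F_curve g \<Phi> \<Phi>1 u x xs xt i \<mu> * R (g \<mu>) w $ i $ j)
     + (\<Sum>r=1..N. (\<Sum>i\<in>UNIV. F_vertex g \<nu> \<Phi>1 \<Phi>0 x xs xt i r * R (g (\<nu> r)) w $ i $ j)
         * of_bool (w \<in> rect (g (\<nu> r)))))"

definition hamiltonian ::
    "(point \<Rightarrow> real^'n::finite \<Rightarrow> real^'n \<Rightarrow> real^'n \<Rightarrow> real^'m::finite \<Rightarrow> real^'n) \<Rightarrow>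
     (point \<Rightarrow> real^'n \<Rightarrow> real^'n \<Rightarrow> real^'n \<Rightarrow> real^'m \<Rightarrow> real) \<Rightarrow>
     point \<Rightarrow> real^'n \<Rightarrow> real^'n \<Rightarrow> real^'n \<Rightarrow> real^'n \<Rightarrow> real^'m \<Rightarrow> real" where
  "hamiltonian f \<Phi> z y p q \<psi> v = \<Phi> z y p q v + (\<Sum>k\<in>UNIV. \<psi> $ k * f z y p q v $ k)"

end

theory Submission
  imports Defs
begin

text \<open>
  Only the part of \<open>G\<close> above and to the right of \<open>w\<close> contributes to \<open>\<psi>(w)\<close>. If \<open>w\<close> lies inside a
  flat part of the curve, this part is a segment of the curve, the area integral vanishes, and
  differentiating the remaining one-dimensional integral in its lower limit gives \<open>- F\<^sub>1\<close> (as \<open>R\<close> is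
  the identity on the diagonal) plus the integral of \<open>\<partial>R\<close>, which by the characteristic condition
  \<open>R\<^sub>t = - R f\<^sub>p\<close> (or \<open>R\<^sub>s = - R f\<^sub>q\<close>) equals \<open>- \<psi> f\<^sub>p\<close> (or \<open>- \<psi> f\<^sub>q\<close>).
  If \<open>w\<close> tends to a point of the oblique part, this part shrinks to that point, so all terms of \<open>\<psi>\<close>
  and of its derivative tend to \<open>0\<close>, except for the boundary term that comes from the moving end
  of the arc: its speed is \<open>1 / n\<^sub>1\<close> (or \<open>1 / n\<^sub>2\<close>), and its integrand tends to \<open>F\<^sub>1\<close>.
\<close>

section \<open>Differentiation of integrals with a moving limit\<close>

text \<open>The obstacle is that all data are one-sided or only piecewise regular. The kernel
  \<open>R z w\<close> is smooth for \<open>w \<in> rect z\<close> and continued by 0 outside, and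
  \<open>F_curve\<close> may jump at the vertices or have no meaningful value there. On a flat arc
  this cannot be avoided by localizing: the points that dominate \<open>w\<close> reach to the end
  of the straight line through \<open>w\<close>, possibly across vertices. Hence the Leibniz rule is
  needed with a kernel known only up to a moving bound and with a weight that is merely integrable,
  but continuous at the moving end. The vertex terms are harmless, since their indicators are
  constant along the flat arc near a point that is not a vertex. Only the derivative in t is
  computed. The one in s follows by exchanging the coordinates and reversing the parameter: the
  curve m \<mapsto> swap (g (-m)) again has a non-increasing first and a non-decreasing second
  coordinate. At oblique points the derivative in t needs n1 > 0, but only strict monotonicity of
  the first coordinate, because the far end of the arc stays in place while t moves. So a point
  where n2 = 0 is not exceptional for this derivative.\<close>

lemma absolutely_integrable_mult_continuous:
  fixes F h :: "real \<Rightarrow> real"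
  assumes "F absolutely_integrable_on {d..c}" "continuous_on {d..c} h"
  shows "(\<lambda>m. F m * h m) absolutely_integrable_on {d..c}"
proof -
  have "(\<lambda>m. h m * F m) absolutely_integrable_on {d..c}"
    using assms
    by (intro absolutely_integrable_bounded_measurable_product_real
        continuous_imp_measurable_on_sets_lebesgue compact_imp_bounded compact_continuous_image) auto
  then show ?thesis by (simp add: mult.commute)
qed

text \<open>The kernels below are jointly continuous only on sets such as the pairs (z, w) with
  \<open>w \<in> rect z\<close>. In this form, continuity of a slice or of a reparametrized kernel
  reduces to checking that the arguments stay in that set.\<close>

lemma continuous_on_compose_case_prod:
  assumes "continuous_on D (\<lambda>(x, y). h x y)" "continuous_on S f" "continuous_on S g"
    and "\<And>x. x \<in> S \<Longrightarrow> (f x, g x) \<in> D"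
  shows "continuous_on S (\<lambda>x. h (f x) (g x))"
proof -
  have "continuous_on S (\<lambda>x. case (f x, g x) of (x, y) \<Rightarrow> h x y)"
    by (rule continuous_on_compose2[OF assms(1)]) (use assms in \<open>auto intro!: continuous_on_Pair\<close>)
  then show ?thesis by simp
qed

lemmas continuous_on_slice = continuous_on_compose_case_prod[OF _ continuous_on_const continuous_on_id]
lemmas continuous_on_slice2 = continuous_on_compose_case_prod[OF _ continuous_on_id continuous_on_const]

text \<open>\<open>h'\<close> is uniformly continuous on the compact rectangle, so the error of the
  linear approximation of \<open>h m\<close> at \<open>t\<close> is at most \<epsilon> |y - t|,
  uniformly in \<open>m\<close>. Such a bound survives integration against any absolutely integrable
  \<open>F\<close>; no continuity of the weight enters.\<close>

lemma leibniz_rule_weighted: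
  fixes F :: "real \<Rightarrow> real" and h h' :: "real \<Rightarrow> real \<Rightarrow> real"
  assumes F: "F absolutely_integrable_on {d..c}"
    and h: "\<And>t. t \<in> {l..u} \<Longrightarrow> continuous_on {d..c} (\<lambda>m. h m t)"
    and h': "continuous_on ({d..c} \<times> {l..u}) (\<lambda>(m, t). h' m t)"
    and der: "\<And>m t. m \<in> {d..c} \<Longrightarrow> t \<in> {l..u} \<Longrightarrow>
      (h m has_real_derivative h' m t) (at t within {l..u})"
    and t: "t \<in> {l..u}"
  shows "((\<lambda>t. integral {d..c} (\<lambda>m. F m * h m t)) has_real_derivative
    integral {d..c} (\<lambda>m. F m * h' m t)) (at t within {l..u})"
  unfolding has_field_derivative_def has_derivative_within_alt
proof (intro conjI allI impI bounded_linear_mult_right)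
  fix e :: real assume "0 < e"
  define B where "B = integral {d..c} (\<lambda>m. norm (F m))"
  have "0 \<le> B" unfolding B_def by (intro integral_nonneg) (use F in \<open>auto simp: absolutely_integrable_on_def\<close>)
  \<comment> \<open>The summand 1 keeps the denominator positive when the weight has norm 0; what
    counts is \<open>B * \<epsilon> \<le> e\<close>.\<close>
  define \<epsilon> where "\<epsilon> = e / (B + 1)"
  have \<epsilon>: "0 < \<epsilon>" "B * \<epsilon> \<le> e" using \<open>0 < e\<close> \<open>0 \<le> B\<close> by (auto simp: \<epsilon>_def field_simps)
  have "uniformly_continuous_on ({d..c} \<times> {l..u}) (\<lambda>(m, t). h' m t)"
    by (intro compact_uniformly_continuous h' compact_Times) auto
  then obtain \<delta> where \<delta>: "0 < \<delta>" "\<And>p q. p \<in> {d..c} \<times> {l..u} \<Longrightarrow> q \<in> {d..c} \<times> {l..u} \<Longrightarrow> dist q p < \<delta> \<Longrightarrow>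
      dist (case q of (m, t) \<Rightarrow> h' m t) (case p of (m, t) \<Rightarrow> h' m t) < \<epsilon>"
    using \<epsilon>(1) unfolding uniformly_continuous_on_def by metis
  show "\<exists>\<delta>>0. \<forall>y\<in>{l..u}. norm (y - t) < \<delta> \<longrightarrow>
      norm (integral {d..c} (\<lambda>m. F m * h m y) - integral {d..c} (\<lambda>m. F m * h m t) -
        integral {d..c} (\<lambda>m. F m * h' m t) * (y - t)) \<le> e * norm (y - t)"
  proof (intro exI[of _ \<delta>] conjI \<delta>(1) ballI impI)
    fix y assume y: "y \<in> {l..u}" "norm (y - t) < \<delta>"
    have est: "norm (h m y - h m t - h' m t * (y - t)) \<le> \<epsilon> * norm (y - t)" if m: "m \<in> {d..c}" for m
    proof -
      have sub: "closed_segment t y \<subseteq> {l..u}"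
        using t y(1) by (auto simp: closed_segment_eq_real_ivl split: if_splits)
      \<comment> \<open>Mean value inequality for \<open>h m r - h' m t * r\<close>, whose
        derivative \<open>h' m r - h' m t\<close> is small on the whole segment.\<close>
      have "norm ((h m y - h' m t * y) - (h m t - h' m t * t)) \<le> \<epsilon> * norm (y - t)"
      proof (rule field_differentiable_bound[where S = "closed_segment t y" and f' = "\<lambda>r. h' m r - h' m t"])
        fix r assume r: "r \<in> closed_segment t y"
        show "((\<lambda>r. h m r - h' m t * r) has_field_derivative h' m r - h' m t) (at r within closed_segment t y)"
          using DERIV_subset[OF der[OF m] sub] r sub by (auto intro!: derivative_eq_intros)
        have "dist r t < \<delta>" using y(2) r
          by (auto simp: closed_segment_eq_real_ivl dist_real_def split: if_splits)
        then have "dist (m, r) (m, t) < \<delta>" by (simp add: dist_Pair_Pair)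
        from \<delta>(2)[OF _ _ this] m r sub t show "norm (h' m r - h' m t) \<le> \<epsilon>"
          by (auto simp: dist_norm)
      qed auto
      then show ?thesis by (simp add: algebra_simps)
    qed
    note int = absolutely_integrable_mult_continuous[OF F, THEN set_lebesgue_integral_eq_integral(1)]
    have i: "(\<lambda>m. F m * h m y) integrable_on {d..c}" "(\<lambda>m. F m * h m t) integrable_on {d..c}"
      "(\<lambda>m. F m * h' m t) integrable_on {d..c}"
      using int h y(1) t by (auto intro!: int continuous_on_slice2[OF h'])
    have "integral {d..c} (\<lambda>m. F m * h m y) - integral {d..c} (\<lambda>m. F m * h m t) -
        integral {d..c} (\<lambda>m. F m * h' m t) * (y - t)
      = integral {d..c} (\<lambda>m. F m * (h m y - h m t - h' m t * (y - t)))"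
    proof -
      have "(\<lambda>m. F m * h' m t * (y - t)) integrable_on {d..c}"
        using i(3) by (rule integrable_on_mult_left)
      then have "integral {d..c} (\<lambda>m. F m * h m y - F m * h m t - F m * h' m t * (y - t))
        = integral {d..c} (\<lambda>m. F m * h m y) - integral {d..c} (\<lambda>m. F m * h m t)
          - integral {d..c} (\<lambda>m. F m * h' m t * (y - t))"
        using i by (simp add: integral_diff integrable_diff)
      moreover have "(\<lambda>m. F m * (h m y - h m t - h' m t * (y - t)))
        = (\<lambda>m. F m * h m y - F m * h m t - F m * h' m t * (y - t))"
        by (auto simp: algebra_simps)
      ultimately show ?thesis by simp
    qed
    also have "norm \<dots> \<le> integral {d..c} (\<lambda>m. norm (F m) * (\<epsilon> * norm (y - t)))"
    proof (rule integral_norm_bound_integral)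
      show "(\<lambda>m. F m * (h m y - h m t - h' m t * (y - t))) integrable_on {d..c}"
        using h y(1) t by (intro int continuous_intros continuous_on_slice2[OF h']) auto
      show "(\<lambda>m. norm (F m) * (\<epsilon> * norm (y - t))) integrable_on {d..c}"
        using F by (auto simp: absolutely_integrable_on_def intro: integrable_on_mult_left)
    qed (use est in \<open>auto simp: abs_mult intro: mult_left_mono\<close>)
    also have "\<dots> = B * \<epsilon> * norm (y - t)" by (simp add: B_def)
    also have "\<dots> \<le> e * norm (y - t)" by (intro mult_right_mono \<epsilon>) auto
    finally show "norm (integral {d..c} (\<lambda>m. F m * h m y) - integral {d..c} (\<lambda>m. F m * h m t) -
        integral {d..c} (\<lambda>m. F m * h' m t) * (y - t)) \<le> e * norm (y - t)" .
  qed
qed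

text \<open>The kernel \<open>k m\<close> is only given up to \<open>\<phi> m\<close>. Continuing it beyond \<open>\<phi> m\<close> by its tangent makes it
  differentiable for all times, so that the integral over the fixed interval can be differentiated
  under the integral sign, while the part to be subtracted becomes explicit in \<open>r\<close>.\<close>

lemma leibniz_rule_moving_limit:
  fixes F \<phi> e :: "real \<Rightarrow> real" and k k' :: "real \<Rightarrow> real \<Rightarrow> real"
  assumes F: "F absolutely_integrable_on {d..c}" "isCont F (e t)"
    and \<phi>: "continuous_on {d..c} \<phi>" "\<phi> ` {d..c} \<subseteq> {l..u}"
    and e: "\<And>r. r \<in> {l..u} \<Longrightarrow> e r \<in> {d..c}"
      "\<And>r m. r \<in> {l..u} \<Longrightarrow> m \<in> {d..c} \<Longrightarrow> r \<le> \<phi> m \<longleftrightarrow> e r \<le> m"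
    and t: "t \<in> {l<..<u}" "e t \<in> {d<..<c}" "\<phi> (e t) = t" "(e has_real_derivative e') (at t)"
    and k: "continuous_on {(m, r). m \<in> {d..c} \<and> r \<in> {l..\<phi> m}} (\<lambda>(m, r). k m r)"
    and k': "continuous_on {(m, r). m \<in> {d..c} \<and> r \<in> {l..\<phi> m}} (\<lambda>(m, r). k' m r)"
    and der: "\<And>m r. m \<in> {d..c} \<Longrightarrow> r \<in> {l..\<phi> m} \<Longrightarrow>
      (k m has_real_derivative k' m r) (at r within {l..\<phi> m})"
  shows "((\<lambda>r. integral {e r..c} (\<lambda>m. F m * k m r)) has_real_derivative
    integral {e t..c} (\<lambda>m. F m * k' m t) - e' * (F (e t) * k (e t) t)) (at t)"
proof -
  \<comment> \<open>The derivative is frozen once \<open>r\<close> passes \<open>\<phi> m\<close>.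
    Since the minimum is continuous, \<open>h'\<close> is jointly continuous on the full rectangle,
    and integrating it back from \<open>l\<close> gives \<open>k\<close> up to
    \<open>\<phi> m\<close> and its tangent line beyond.\<close>
  define h' where "h' m r = k' m (min r (\<phi> m))" for m r
  define h where "h m r = k m l + integral {l..r} (h' m)" for m r
  have \<phi>': "l \<le> \<phi> m" "\<phi> m \<le> u" if "m \<in> {d..c}" for m
    using imageI[OF that, of \<phi>] \<phi>(2) by (meson atLeastAtMost_iff subsetD)+
  have fstc: "continuous_on ({d..c} \<times> {l..u}) (\<lambda>p. \<phi> (fst p))"
    by (rule continuous_on_compose2[OF \<phi>(1)]) (auto intro!: continuous_intros)
  have ch': "continuous_on ({d..c} \<times> {l..u}) (\<lambda>(m, r). h' m r)"
    unfolding h'_def case_prod_beta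
    by (rule continuous_on_compose2[OF k'[unfolded case_prod_beta], where f = "\<lambda>p. (fst p, min (snd p) (\<phi> (fst p)))", simplified])
      (use \<phi>' in \<open>auto intro!: continuous_intros fstc continuous_on_min\<close>)
  have ch'1: "continuous_on {l..u} (h' m)" if "m \<in> {d..c}" for m
    by (rule continuous_on_slice[OF ch']) (use that in auto)
  have dh: "(h m has_real_derivative h' m r) (at r within {l..u})" if "m \<in> {d..c}" "r \<in> {l..u}" for m r
    unfolding h_def using integral_has_real_derivative[OF ch'1[OF that(1)] that(2)]
    by (auto intro!: derivative_eq_intros)
  have h1: "h m r = k m r" if "m \<in> {d..c}" "r \<in> {l..\<phi> m}" for m r
  proof -
    have "(k' m has_integral k m r - k m l) {l..r}"
      using that
      by (intro fundamental_theorem_of_calculus)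
        (auto simp flip: has_real_derivative_iff_has_vector_derivative intro!: DERIV_subset[OF der[OF that(1)]])
    then have "(h' m has_integral k m r - k m l) {l..r}"
      by (rule has_integral_eq[rotated]) (use that in \<open>auto simp: h'_def\<close>)
    then show ?thesis by (simp add: h_def integral_unique)
  qed
  have h2: "h m r = k m (\<phi> m) + (r - \<phi> m) * k' m (\<phi> m)" if "m \<in> {d..c}" "\<phi> m \<le> r" "r \<le> u" for m r
  proof -
    have "integral {l..\<phi> m} (h' m) + integral {\<phi> m..r} (h' m) = integral {l..r} (h' m)"
      using that \<phi>'[of m] by (intro Henstock_Kurzweil_Integration.integral_combine integrable_continuous_real)
        (auto intro: continuous_on_subset[OF ch'1])
    moreover have "integral {\<phi> m..r} (h' m) = integral {\<phi> m..r} (\<lambda>_. k' m (\<phi> m))"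
      by (intro integral_cong) (auto simp: h'_def)
    ultimately show ?thesis using h1[of m "\<phi> m"] that \<phi>'[of m] by (simp add: h_def)
  qed
  have ch: "continuous_on {d..c} (\<lambda>m. h m r)" if "r \<in> {l..u}" for r
  proof -
    have "continuous_on {d..c} (\<lambda>m. integral (cbox l r) (h' m))"
      by (rule integral_continuous_on_param) (use that in \<open>auto intro: continuous_on_subset[OF ch']\<close>)
    moreover have "continuous_on {d..c} (\<lambda>m. k m l)"
      by (rule continuous_on_slice2[OF k]) (use \<phi>' in auto)
    ultimately show ?thesis unfolding h_def by (auto intro!: continuous_intros)
  qed
  have ckd: "continuous_on {d..c} (\<lambda>m. k m (\<phi> m))" "continuous_on {d..c} (\<lambda>m. k' m (\<phi> m))"
  proof -
    have D: "(m, \<phi> m) \<in> {(m, r). m \<in> {d..c} \<and> r \<in> {l..\<phi> m}}" if "m \<in> {d..c}" for m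
      using that \<phi>'[OF that] by simp
    show "continuous_on {d..c} (\<lambda>m. k m (\<phi> m))"
      by (rule continuous_on_compose_case_prod[where f = "\<lambda>m. m" and g = \<phi>, OF k continuous_on_id \<phi>(1) D])
    show "continuous_on {d..c} (\<lambda>m. k' m (\<phi> m))"
      by (rule continuous_on_compose_case_prod[where f = "\<lambda>m. m" and g = \<phi>, OF k' continuous_on_id \<phi>(1) D])
  qed
  \<comment> \<open>For \<open>m\<close> below \<open>e r\<close>, the continued kernel is affine in
    \<open>r\<close>, with coefficients that depend on \<open>m\<close> alone. So the part to be
    subtracted is A1 + r A2 - A3, where \<open>r\<close> enters only as a factor and through the
    limit \<open>e r\<close>.\<close>
  define A1 where "A1 p = integral {d..p} (\<lambda>m. F m * k m (\<phi> m))" for p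
  define A2 where "A2 p = integral {d..p} (\<lambda>m. F m * k' m (\<phi> m))" for p
  define A3 where "A3 p = integral {d..p} (\<lambda>m. F m * (k' m (\<phi> m) * \<phi> m))" for p
  have ck3: "continuous_on {d..c} (\<lambda>m. k' m (\<phi> m) * \<phi> m)"
    by (intro continuous_intros ckd \<phi>)
  note int = absolutely_integrable_mult_continuous[OF F(1), THEN set_lebesgue_integral_eq_integral(1)]
  \<comment> \<open>The weight may be discontinuous elsewhere, so the fundamental theorem is applied
    only at the point \<open>e t\<close>.\<close>
  have ftc: "((\<lambda>p. integral {d..p} (\<lambda>m. F m * q m)) has_real_derivative F (e t) * q (e t)) (at (e t))"
    if "continuous_on {d..c} q" for q
  proof -
    have et: "e t \<in> interior {d..c}" using t(2) by auto
    have "isCont q (e t)" using continuous_on_interior[OF that et] .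
    then have "isCont (\<lambda>m. F m * q m) (e t)" using F(2) by (rule isCont_mult[rotated])
    then have "continuous (at (e t) within {d..c} - {}) (\<lambda>m. F m * q m)"
      by (rule continuous_at_imp_continuous_at_within)
    from integral_has_vector_derivative_continuous_at[OF int[OF that] _ _ this]
    have "((\<lambda>p. integral {d..p} (\<lambda>m. F m * q m)) has_vector_derivative F (e t) * q (e t)) (at (e t) within {d..c} - {})"
      using t(2) by simp
    then show ?thesis using at_within_interior[OF et]
      by (simp add: has_real_derivative_iff_has_vector_derivative)
  qed
  \<comment> \<open>Because \<open>\<phi> (e t) = t\<close>, the two terms containing
    \<open>k'\<close> that come from differentiating the limits of \<open>A2\<close> and
    \<open>A3\<close> cancel.\<close>
  have dA: "((\<lambda>r. A1 (e r) + r * A2 (e r) - A3 (e r)) has_real_derivative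
      e' * (F (e t) * k (e t) t) + A2 (e t)) (at t)"
  proof -
    have d1: "((\<lambda>r. A1 (e r)) has_real_derivative F (e t) * k (e t) t * e') (at t)"
      using DERIV_chain2[OF ftc[OF ckd(1)] t(4)] by (simp only: A1_def t(3))
    have d2: "((\<lambda>r. A2 (e r)) has_real_derivative F (e t) * k' (e t) t * e') (at t)"
      using DERIV_chain2[OF ftc[OF ckd(2)] t(4)] by (simp only: A2_def t(3))
    have d3: "((\<lambda>r. A3 (e r)) has_real_derivative F (e t) * (k' (e t) t * t) * e') (at t)"
      using DERIV_chain2[OF ftc[OF ck3] t(4)] by (simp only: A3_def t(3))
    show ?thesis
      by (rule DERIV_cong[OF DERIV_diff[OF DERIV_add[OF d1 DERIV_mult[OF DERIV_ident d2]] d3]])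
        (simp add: algebra_simps)
  qed
  have dI: "((\<lambda>r. integral {d..c} (\<lambda>m. F m * h m r)) has_real_derivative
      integral {d..c} (\<lambda>m. F m * h' m t)) (at t)"
  proof -
    have "at t within {l..u} = at t" using t(1) by (intro at_within_interior) auto
    with leibniz_rule_weighted[OF F(1) ch ch' dh, of t] t(1) show ?thesis by simp
  qed
  have split: "integral {d..c} (\<lambda>m. F m * q m) = integral {d..e r} (\<lambda>m. F m * q m) + integral {e r..c} (\<lambda>m. F m * q m)"
    if "continuous_on {d..c} q" "r \<in> {l..u}" for q r
    using int[OF that(1)] e(1)[OF that(2)] by (intro Henstock_Kurzweil_Integration.integral_combine[symmetric]) auto
  have main: "integral {e r..c} (\<lambda>m. F m * k m r)
     = integral {d..c} (\<lambda>m. F m * h m r) - (A1 (e r) + r * A2 (e r) - A3 (e r))"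
    if r: "r \<in> {l..u}" for r
  proof -
    have "integral {e r..c} (\<lambda>m. F m * h m r) = integral {e r..c} (\<lambda>m. F m * k m r)"
    proof (rule integral_cong)
      fix m assume "m \<in> {e r..c}"
      then have "m \<in> {d..c}" "r \<in> {l..\<phi> m}" using e(1)[OF r] e(2)[OF r, of m] r by auto
      then show "F m * h m r = F m * k m r" using h1 by simp
    qed
    moreover have "integral {d..e r} (\<lambda>m. F m * h m r) = A1 (e r) + r * A2 (e r) - A3 (e r)"
    proof -
      have i: "(\<lambda>m. F m * q m) integrable_on {d..e r}" if "continuous_on {d..c} q" for q
        by (rule integrable_on_subinterval[OF int[OF that]]) (use e(1)[OF r] in auto)
      have "integral {d..e r} (\<lambda>m. F m * h m r)
        = integral {d..e r} (\<lambda>m. (F m * k m (\<phi> m) + r * (F m * k' m (\<phi> m))) - F m * (k' m (\<phi> m) * \<phi> m))"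
      proof (rule integral_spike[of "{e r}"])
        \<comment> \<open>Away from the end point, \<open>m < e r\<close> gives
          \<open>\<phi> m < r\<close> by contraposition. At \<open>m = e r\<close> the equivalence
          gives the opposite inequality, so this one point is discarded as a null set.\<close>
        fix m assume m: "m \<in> {d..e r} - {e r}"
        then have "m \<in> {d..c}" "\<phi> m \<le> r" using e(1)[OF r] e(2)[OF r, of m] by auto
        then show "F m * k m (\<phi> m) + r * (F m * k' m (\<phi> m)) - F m * (k' m (\<phi> m) * \<phi> m) = F m * h m r"
          using h2[of m r] r by (auto simp: ring_distribs)
      qed auto
      also have "\<dots> = A1 (e r) + r * A2 (e r) - A3 (e r)"
        unfolding A1_def A2_def A3_def
        using i[OF ckd(1)] i[OF ckd(2)] i[OF ck3]
        by (simp add: integral_diff integral_add integrable_add integrable_on_mult_right)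
      finally show ?thesis .
    qed
    ultimately show ?thesis using split[OF ch[OF r] r] by simp
  qed
  have "((\<lambda>r. integral {d..c} (\<lambda>m. F m * h m r) - (A1 (e r) + r * A2 (e r) - A3 (e r))) has_real_derivative
    integral {d..c} (\<lambda>m. F m * h' m t) - (e' * (F (e t) * k (e t) t) + A2 (e t))) (at t)"
    by (intro DERIV_diff dI dA)
  \<comment> \<open>Below \<open>e t\<close> the derivative is frozen at its value at
    \<open>\<phi> m\<close>, so this part of the integral is exactly the remaining
    \<open>A2 (e t)\<close>, and the tangent continuation disappears from the result.\<close>
  moreover have "integral {d..c} (\<lambda>m. F m * h' m t) - A2 (e t) = integral {e t..c} (\<lambda>m. F m * k' m t)"
  proof -
    have tt: "t \<in> {l..u}" using t by auto
    have "integral {e t..c} (\<lambda>m. F m * h' m t) = integral {e t..c} (\<lambda>m. F m * k' m t)"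
    proof (rule integral_cong)
      fix m assume "m \<in> {e t..c}"
      then have "m \<in> {d..c}" "t \<in> {l..\<phi> m}" using e(1)[OF tt] e(2)[OF tt, of m] tt by auto
      then show "F m * h' m t = F m * k' m t" by (simp add: h'_def min_def)
    qed
    moreover have "integral {d..e t} (\<lambda>m. F m * h' m t) = A2 (e t)"
      unfolding A2_def
    proof (rule integral_spike[of "{e t}"])
      fix m assume m: "m \<in> {d..e t} - {e t}"
      then have "m \<in> {d..c}" "\<phi> m \<le> t" using e(1)[OF tt] e(2)[OF tt, of m] by auto
      then show "F m * k' m (\<phi> m) = F m * h' m t" by (simp add: h'_def min_def)
    qed auto
    ultimately show ?thesis using split[OF continuous_on_slice2[OF ch', of "{d..c}" t] tt] tt by auto
  qed
  ultimately have "((\<lambda>r. integral {d..c} (\<lambda>m. F m * h m r) - (A1 (e r) + r * A2 (e r) - A3 (e r))) has_real_derivative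
    integral {e t..c} (\<lambda>m. F m * k' m t) - e' * (F (e t) * k (e t) t)) (at t)"
    by (simp add: algebra_simps)
  then show ?thesis
    by (rule has_field_derivative_transform_within_open[of _ _ _ "{l<..<u}"]) (use main t in auto)
qed

section \<open>Iterated integrals over regions under a graph\<close>

lemma set_integrable_lborel_compact:
  fixes f :: "'a::euclidean_space \<Rightarrow> real"
  assumes "compact S" "continuous_on S f"
  shows "set_integrable lborel S f"
  using borel_integrable_compact[OF assms] by (simp add: set_integrable_def)

text \<open>For a continuous function on a compact set the integral is a Lebesgue integral over the
  product measure, which is invariant under exchanging the factors.\<close>

lemma integral_prod_swap:
  fixes f :: "real \<times> real \<Rightarrow> real"
  assumes S: "compact S" and f: "continuous_on S f"
  shows "integral (prod.swap ` S) (\<lambda>z. f (prod.swap z)) = integral S f"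
proof -
  let ?h = "\<lambda>z. indicator S z *\<^sub>R f z"
  have S': "compact (prod.swap ` S)" by (intro compact_continuous_image S continuous_intros)
  have f': "continuous_on (prod.swap ` S) (\<lambda>z. f (prod.swap z))"
    by (rule continuous_on_compose2[OF f]) (auto intro!: continuous_intros)
  have "integral (prod.swap ` S) (\<lambda>z. f (prod.swap z))
      = (LINT z|lborel. indicator (prod.swap ` S) z *\<^sub>R f (prod.swap z))"
    using set_borel_integral_eq_integral(2)[OF set_integrable_lborel_compact[OF S' f']]
    by (simp add: set_lebesgue_integral_def)
  also have "\<dots> = (LINT z|lborel. ?h (prod.swap z))"
  proof -
    have "indicator (prod.swap ` S) z = (indicator S (prod.swap z) :: real)" for z
      by (cases z) (force simp: indicator_def image_iff)
    then show ?thesis by simp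
  qed
  also have "\<dots> = (LINT z|(lborel \<Otimes>\<^sub>M lborel). (case z of (x, y) \<Rightarrow> ?h (y, x)))"
    by (simp add: lborel_prod case_prod_beta prod.swap_def)
  also have "\<dots> = (LINT z|(lborel \<Otimes>\<^sub>M lborel). ?h z)"
    by (rule lborel_pair.integral_product_swap)
      (use borel_integrable_compact[OF S f] in \<open>simp add: lborel_prod\<close>)
  also have "\<dots> = integral S f"
    using set_borel_integral_eq_integral(2)[OF set_integrable_lborel_compact[OF S f]]
    by (simp add: set_lebesgue_integral_def lborel_prod)
  finally show ?thesis .
qed

lemma compact_under_graph:
  fixes \<theta> :: "real \<Rightarrow> real"
  assumes "continuous_on {t..T} \<theta>"
  shows "compact {(\<sigma>, \<tau>). \<tau> \<in> {t..T} \<and> \<sigma> \<in> {s..\<theta> \<tau>}}"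
proof -
  have "bounded (\<theta> ` {t..T})" by (intro compact_imp_bounded compact_continuous_image assms) auto
  then obtain M where "\<forall>y\<in>\<theta> ` {t..T}. norm y \<le> M" unfolding bounded_iff by blast
  then have M: "\<And>\<tau>. \<tau> \<in> {t..T} \<Longrightarrow> \<bar>\<theta> \<tau>\<bar> \<le> M" by simp
  have "{(\<sigma>, \<tau>). \<tau> \<in> {t..T} \<and> \<sigma> \<in> {s..\<theta> \<tau>}} = {p \<in> {s..M} \<times> {t..T}. fst p \<le> \<theta> (snd p)}"
    using M by (force simp: abs_le_iff)
  moreover have "closed {p \<in> {s..M} \<times> {t..T}. fst p \<le> \<theta> (snd p)}"
    by (intro continuous_on_closed_Collect_le closed_Times continuous_intros
        continuous_on_compose2[OF assms]) auto
  moreover have "bounded {p \<in> {s..M} \<times> {t..T}. fst p \<le> \<theta> (snd p)}"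
    by (rule bounded_subset[of "{s..M} \<times> {t..T}"]) (auto intro: bounded_Times)
  ultimately show ?thesis by (simp add: compact_eq_bounded_closed)
qed

text \<open>Fubini, with the first coordinate integrated inside. In this order \<open>t\<close>
  occurs in the domain only as the lower limit of the outer integral, so differentiating an area
  integral in \<open>t\<close> becomes a one-dimensional problem with a moving limit.\<close>

lemma integral_under_graph:
  fixes \<theta> :: "real \<Rightarrow> real" and f :: "real \<times> real \<Rightarrow> real"
  defines "E \<equiv> \<lambda>s t T \<theta>. {(\<sigma>, \<tau>). \<tau> \<in> {t..T} \<and> \<sigma> \<in> {s..\<theta> \<tau>}}"
  assumes \<theta>: "continuous_on {t..T} \<theta>" and f: "continuous_on (E s t T \<theta>) f"
  shows "integral (E s t T \<theta>) f = integral {t..T} (\<lambda>\<tau>. integral {s..\<theta> \<tau>} (\<lambda>\<sigma>. f (\<sigma>, \<tau>)))"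
proof -
  let ?E = "E s t T \<theta>" and ?K = "\<lambda>\<tau>. integral {s..\<theta> \<tau>} (\<lambda>\<sigma>. f (\<sigma>, \<tau>))"
  have cE: "compact ?E" unfolding E_def by (rule compact_under_graph[OF \<theta>])
  have int: "integrable (lborel \<Otimes>\<^sub>M lborel) (\<lambda>(\<sigma>, \<tau>). indicator ?E (\<sigma>, \<tau>) *\<^sub>R f (\<sigma>, \<tau>))"
    using borel_integrable_compact[OF cE f] by (simp add: lborel_prod case_prod_unfold)
  have inner: "(LINT \<sigma>|lborel. indicator ?E (\<sigma>, \<tau>) *\<^sub>R f (\<sigma>, \<tau>)) = indicator {t..T} \<tau> *\<^sub>R ?K \<tau>" for \<tau>
  proof (cases "\<tau> \<in> {t..T}")
    case True
    have "continuous_on {s..\<theta> \<tau>} (\<lambda>\<sigma>. f (\<sigma>, \<tau>))"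
      by (rule continuous_on_compose2[OF f]) (use True in \<open>auto simp: E_def intro!: continuous_intros\<close>)
    from set_borel_integral_eq_integral(2)[OF set_integrable_lborel_compact[OF _ this]]
    have "(LINT \<sigma>|lborel. indicator {s..\<theta> \<tau>} \<sigma> *\<^sub>R f (\<sigma>, \<tau>)) = ?K \<tau>"
      by (simp add: set_lebesgue_integral_def)
    moreover have "(LINT \<sigma>|lborel. indicator ?E (\<sigma>, \<tau>) *\<^sub>R f (\<sigma>, \<tau>)) = (LINT \<sigma>|lborel. indicator {s..\<theta> \<tau>} \<sigma> *\<^sub>R f (\<sigma>, \<tau>))"
      using True by (intro Bochner_Integration.integral_cong) (auto simp: E_def indicator_def)
    ultimately show ?thesis using True by simp
  qed (auto simp: E_def)
  have "integral ?E f = (LINT z|(lborel \<Otimes>\<^sub>M lborel). (case z of (\<sigma>, \<tau>) \<Rightarrow> indicator ?E (\<sigma>, \<tau>) *\<^sub>R f (\<sigma>, \<tau>)))"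
    using set_borel_integral_eq_integral(2)[OF set_integrable_lborel_compact[OF cE f]]
    by (simp add: set_lebesgue_integral_def lborel_prod case_prod_unfold)
  also have "\<dots> = (LINT \<tau>|lborel. indicator {t..T} \<tau> *\<^sub>R ?K \<tau>)"
    by (subst lborel_pair.integral_snd[OF int, symmetric]) (simp only: inner)
  also have "\<dots> = integral {t..T} ?K"
  proof -
    have "set_integrable lborel {t..T} ?K"
      using lborel_pair.integrable_snd[OF int] by (simp only: inner set_integrable_def)
    from set_borel_integral_eq_integral(2)[OF this] show ?thesis by (simp add: set_lebesgue_integral_def)
  qed
  finally show ?thesis .
qed

text \<open>Moves a variable upper limit into the integrand, so that results on parameter integrals
  over the fixed interval [0, 1] apply.\<close>

lemma integral_rescale:
  fixes h :: "real \<Rightarrow> real"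
  assumes "s \<le> v" "continuous_on {s..v} h"
  shows "integral {s..v} h = (v - s) * integral {0..1} (\<lambda>\<kappa>. h (s + \<kappa> * (v - s)))"
proof (cases "s = v")
  case False
  then have "0 < v - s" using assms(1) by simp
  have "(h has_integral integral {s..v} h) (cbox s v)"
    using assms by (auto intro: integrable_integral integrable_continuous_real)
  from has_integral_affinity'[OF this \<open>0 < v - s\<close>, of s]
  have "((\<lambda>\<kappa>. h (s + \<kappa> * (v - s))) has_integral integral {s..v} h / (v - s)) {0..1}"
    using \<open>0 < v - s\<close> by (simp add: divide_inverse_commute mult.commute add.commute)
  then show ?thesis using \<open>0 < v - s\<close> by (simp add: integral_unique)
qed simp

text \<open>Integrability need not be checked at each use: the integral of a non-integrable function
  is 0 by convention, and the right-hand side is nonnegative.\<close>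

lemma abs_integral_le_content:
  fixes f :: "'a::euclidean_space \<Rightarrow> real"
  assumes "\<And>x. x \<in> S \<Longrightarrow> \<bar>f x\<bar> \<le> M" "S \<subseteq> cbox a b" "0 \<le> M"
  shows "\<bar>integral S f\<bar> \<le> M * measure lborel (cbox a b)"
proof (cases "f integrable_on S")
  case True
  then have "((\<lambda>x. if x \<in> S then f x else 0) has_integral integral S f) (cbox a b)"
    using assms(2) by (simp add: has_integral_restrict integrable_integral)
  from has_integral_bound[OF assms(3) this] assms(1,3) show ?thesis by auto
qed (use assms in \<open>auto simp: not_integrable_integral\<close>)

section \<open>Integrals over the part of the region above a point\<close>

text \<open>Provides the parameter of the curve as a function of one coordinate. The equivalence
  \<open>t \<le> h m \<longleftrightarrow> e t \<le> m\<close> is the link between the two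
  descriptions of a dominating arc, by heights and by parameters, that the moving-limit rule asks
  for.\<close>

lemma strict_mono_inverse:
  fixes h :: "real \<Rightarrow> real"
  assumes "p < q" and cont: "continuous_on {p..q} h"
    and mono: "\<And>m n. p \<le> m \<Longrightarrow> m < n \<Longrightarrow> n \<le> q \<Longrightarrow> h m < h n"
  obtains e where "\<And>t. t \<in> {h p..h q} \<Longrightarrow> e t \<in> {p..q} \<and> h (e t) = t"
    "continuous_on {h p..h q} e"
    "\<And>t m. t \<in> {h p..h q} \<Longrightarrow> m \<in> {p..q} \<Longrightarrow> t \<le> h m \<longleftrightarrow> e t \<le> m"
    "\<And>m. m \<in> {p..q} \<Longrightarrow> e (h m) = m"
    "\<And>t d. t \<in> {h p<..<h q} \<Longrightarrow> (h has_real_derivative d) (at (e t)) \<Longrightarrow> d \<noteq> 0 \<Longrightarrow>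
      (e has_real_derivative inverse d) (at t)"
proof -
  have inj: "inj_on h {p..q}"
  proof (rule inj_onI)
    fix x y assume "x \<in> {p..q}" "y \<in> {p..q}" "h x = h y"
    then show "x = y" using mono[of x y] mono[of y x] by (cases x y rule: linorder_cases) auto
  qed
  define e where "e = the_inv_into {p..q} h"
  have img: "h ` {p..q} = {h p..h q}"
  proof
    show "h ` {p..q} \<subseteq> {h p..h q}"
    proof
      fix y assume "y \<in> h ` {p..q}"
      then obtain m where m: "m \<in> {p..q}" "y = h m" by auto
      have "h p \<le> h m" using mono[of p m] m assms(1) by (cases "p = m") auto
      moreover have "h m \<le> h q" using mono[of m q] m assms(1) by (cases "q = m") auto
      ultimately show "y \<in> {h p..h q}" using m by auto
    qed
    show "{h p..h q} \<subseteq> h ` {p..q}"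
    proof
      fix y assume "y \<in> {h p..h q}"
      then obtain x where "p \<le> x" "x \<le> q" "h x = y"
        using IVT'[of h p y q] cont assms(1) by auto
      then show "y \<in> h ` {p..q}" by auto
    qed
  qed
  have 1: "e t \<in> {p..q} \<and> h (e t) = t" if "t \<in> {h p..h q}" for t
    using that img inj unfolding e_def by (metis f_the_inv_into_f the_inv_into_into subset_refl)
  have 4: "e (h m) = m" if "m \<in> {p..q}" for m
    using that inj unfolding e_def by (simp add: the_inv_into_f_f)
  have 2: "continuous_on {h p..h q} e"
    using continuous_on_inv[OF cont _ ballI, of e] 4 img by auto
  have 3: "t \<le> h m \<longleftrightarrow> e t \<le> m" if t: "t \<in> {h p..h q}" and m: "m \<in> {p..q}" for t m
    using 1[OF t] mono[of "e t" m] mono[of m "e t"] m by (cases "e t" m rule: linorder_cases) auto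
  have 5: "(e has_real_derivative inverse d) (at t)"
    if "t \<in> {h p<..<h q}" "(h has_real_derivative d) (at (e t))" "d \<noteq> 0" for t d
  proof (rule DERIV_inverse_function[where a = "h p" and b = "h q" and f = h])
    show "isCont e t" using that by (intro continuous_on_interior[OF 2]) auto
    show "h (e y) = y" if "h p < y" "y < h q" for y using 1[of y] that by auto
  qed (use that in auto)
  show ?thesis using that 1 2 3 4 5 by blast
qed

lemma mem_rect: "w \<in> rect z \<longleftrightarrow> 0 \<le> fst w \<and> fst w \<le> fst z \<and> 0 \<le> snd w \<and> snd w \<le> snd z"
  by (cases w) (auto simp: rect_def)

text \<open>Compactness of the domain of the kernels; it supplies the uniform bounds that make
  integrals over shrinking sets tend to 0.\<close>

lemma compact_rect_pairs:
  fixes h :: "'a::metric_space \<Rightarrow> point"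
  assumes S: "compact S" and h: "continuous_on S h"
  shows "compact {(x, w). x \<in> S \<and> w \<in> rect (h x)}"
proof -
  have "bounded (h ` S)" by (intro compact_imp_bounded compact_continuous_image S h)
  then obtain B where "\<forall>y\<in>h ` S. norm y \<le> B" unfolding bounded_iff by blast
  then have B: "fst (h x) \<le> B" "snd (h x) \<le> B" if "x \<in> S" for x
    using that norm_fst_le[of "fst (h x)" "snd (h x)"] norm_snd_le[of "snd (h x)" "fst (h x)"] by force+
  let ?K = "S \<times> ({0..B} \<times> {0..B})"
  have K: "compact ?K" by (intro compact_Times S compact_Icc)
  have h': "continuous_on ?K (\<lambda>p. h (fst p))"
    by (rule continuous_on_compose2[OF h]) (auto intro!: continuous_intros)
  have "{(x, w). x \<in> S \<and> w \<in> rect (h x)}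
    = ?K \<inter> ({p \<in> ?K. fst (snd p) \<le> fst (h (fst p))} \<inter> {p \<in> ?K. snd (snd p) \<le> snd (h (fst p))})"
    using B by (fastforce simp: mem_rect)
  moreover have "closed {p \<in> ?K. fst (snd p) \<le> fst (h (fst p))}" "closed {p \<in> ?K. snd (snd p) \<le> snd (h (fst p))}"
    by (rule continuous_on_closed_Collect_le; (intro compact_imp_closed K continuous_intros h'))+
  ultimately show ?thesis using K by (simp add: compact_Int_closed closed_Int)
qed

lemma compact_rect_Union:
  fixes h :: "'a::metric_space \<Rightarrow> point"
  assumes "compact S" "continuous_on S h"
  shows "compact (\<Union>x\<in>S. rect (h x))"
proof -
  have "(\<Union>x\<in>S. rect (h x)) = snd ` {(x, w). x \<in> S \<and> w \<in> rect (h x)}" by force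
  then show ?thesis using compact_rect_pairs[OF assms]
    by (simp add: compact_continuous_image continuous_on_snd)
qed

lemma compact_bounded_abs:
  fixes q :: "'a::topological_space \<Rightarrow> 'b::topological_space \<Rightarrow> real"
  assumes "compact D" "continuous_on D (\<lambda>(x, y). q x y)"
  obtains M where "0 \<le> M" "\<And>x y. (x, y) \<in> D \<Longrightarrow> \<bar>q x y\<bar> \<le> M"
proof -
  have "bounded ((\<lambda>(x, y). q x y) ` D)" by (intro compact_imp_bounded compact_continuous_image assms)
  then obtain M where "\<forall>y\<in>(\<lambda>(x, y). q x y) ` D. norm y \<le> M" unfolding bounded_iff by blast
  then have "\<bar>q x y\<bar> \<le> max 0 M" if "(x, y) \<in> D" for x y using that by fastforce
  then show ?thesis by (rule that[rotated]) auto
qed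

text \<open>The upper limit \<open>\<theta> \<tau>\<close> varies with the parameter. After
  rescaling every slice to [0, 1] the integrand is jointly continuous over a fixed range, and only
  the continuous factor \<open>\<theta> \<tau> - s\<close> is added.\<close>

lemma continuous_on_slice_integral:
  fixes K :: "point \<Rightarrow> point \<Rightarrow> real" and \<theta> :: "real \<Rightarrow> real"
  assumes \<theta>: "continuous_on {d..T} \<theta>" "\<And>\<tau>. \<tau> \<in> {d..T} \<Longrightarrow> s \<le> \<theta> \<tau>"
    and K: "continuous_on {(z, w). z \<in> Z \<and> w \<in> rect z} (\<lambda>(z, w). K z w)"
    and Z: "\<And>\<sigma> \<tau>. \<tau> \<in> {d..T} \<Longrightarrow> \<sigma> \<in> {s..\<theta> \<tau>} \<Longrightarrow> (\<sigma>, \<tau>) \<in> Z"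
    and "0 \<le> s" "0 \<le> d"
  shows "continuous_on {(\<tau>, t'). \<tau> \<in> {d..T} \<and> t' \<in> {d..\<tau>}}
    (\<lambda>(\<tau>, t'). integral {s..\<theta> \<tau>} (\<lambda>\<sigma>. K (\<sigma>, \<tau>) (s, t')))"
proof -
  let ?U = "{(\<tau>, t'). \<tau> \<in> {d..T} \<and> t' \<in> {d..\<tau>}}"
  have c\<theta>: "continuous_on S (\<lambda>p. \<theta> (f p))" if "continuous_on S f" "\<And>p. p \<in> S \<Longrightarrow> f p \<in> {d..T}" for S and f :: "'z::topological_space \<Rightarrow> real"
    by (rule continuous_on_compose2[OF \<theta>(1) that(1)]) (use that(2) in blast)
  have convex: "0 \<le> \<kappa> * v" "\<kappa> * v \<le> v" if "0 \<le> \<kappa>" "\<kappa> \<le> 1" "0 \<le> v" for \<kappa> v :: real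
    using that mult_left_le_one_le by auto
  have "continuous_on (?U \<times> cbox 0 1) (\<lambda>(p, \<kappa>). K (s + \<kappa> * (\<theta> (fst p) - s), fst p) (s, snd p))"
    unfolding case_prod_beta
    by (rule continuous_on_compose_case_prod[OF K])
      (use \<theta>(2) \<open>0 \<le> s\<close> \<open>0 \<le> d\<close> convex in
        \<open>auto intro!: continuous_intros c\<theta> Z add_nonneg_nonneg simp: mem_rect\<close>,
        smt (verit, best) convex \<theta>(2) atLeastAtMost_iff)
  from integral_continuous_on_param[OF this]
  have "continuous_on ?U (\<lambda>p. (\<theta> (fst p) - s) * integral {0..1} (\<lambda>\<kappa>. K (s + \<kappa> * (\<theta> (fst p) - s), fst p) (s, snd p)))"
    by (auto intro!: continuous_intros c\<theta>)
  moreover have "integral {s..\<theta> \<tau>} (\<lambda>\<sigma>. K (\<sigma>, \<tau>) (s, t'))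
      = (\<theta> \<tau> - s) * integral {0..1} (\<lambda>\<kappa>. K (s + \<kappa> * (\<theta> \<tau> - s), \<tau>) (s, t'))"
    if "\<tau> \<in> {d..T}" "t' \<in> {d..\<tau>}" for \<tau> t'
    by (rule integral_rescale[OF \<theta>(2)[OF that(1)]], rule continuous_on_compose_case_prod[OF K])
      (use that Z \<open>0 \<le> s\<close> \<open>0 \<le> d\<close> in \<open>auto intro!: continuous_intros simp: mem_rect\<close>)
  ultimately show ?thesis by (auto simp: case_prod_beta cong: continuous_on_cong_simp)
qed

text \<open>By Fubini the area integral is an integral over \<tau> from the moving height
  \<open>t'\<close> to \<open>T\<close> of slice integrals \<open>k \<tau> t'\<close>. These may be
  differentiated under the integral sign, and the moving lower limit contributes the slice
  \<open>k t t\<close>, the integral over the bottom edge of the set.\<close>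

lemma area_integral_derivative:
  fixes K K' :: "point \<Rightarrow> point \<Rightarrow> real" and \<theta> :: "real \<Rightarrow> real"
    and s T :: real
  defines "E \<equiv> \<lambda>t. {(\<sigma>, \<tau>). \<tau> \<in> {t..T} \<and> \<sigma> \<in> {s..\<theta> \<tau>}}"
  assumes \<theta>: "continuous_on {d..T} \<theta>" "\<And>\<tau>. \<tau> \<in> {d..T} \<Longrightarrow> s \<le> \<theta> \<tau>"
    and K: "continuous_on {(z, w). z \<in> Z \<and> w \<in> rect z} (\<lambda>(z, w). K z w)"
    and K': "continuous_on {(z, w). z \<in> Z \<and> w \<in> rect z} (\<lambda>(z, w). K' z w)"
    and der: "\<And>z s t. z \<in> Z \<Longrightarrow> (s, t) \<in> rect z \<Longrightarrow>
      ((\<lambda>t'. K z (s, t')) has_real_derivative K' z (s, t)) (at t within {0..snd z})"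
    and Z: "\<And>\<sigma> \<tau>. \<tau> \<in> {d..T} \<Longrightarrow> \<sigma> \<in> {s..\<theta> \<tau>} \<Longrightarrow> (\<sigma>, \<tau>) \<in> Z"
    and "0 \<le> s" "0 \<le> d" and t: "t \<in> {d<..<T}"
  shows "((\<lambda>t'. integral (E t') (\<lambda>z. K z (s, t'))) has_real_derivative
    integral (E t) (\<lambda>z. K' z (s, t)) - integral {s..\<theta> t} (\<lambda>\<sigma>. K (\<sigma>, t) (s, t))) (at t)"
proof -
  define k where "k \<tau> t' = integral {s..\<theta> \<tau>} (\<lambda>\<sigma>. K (\<sigma>, \<tau>) (s, t'))" for \<tau> t'
  define k' where "k' \<tau> t' = integral {s..\<theta> \<tau>} (\<lambda>\<sigma>. K' (\<sigma>, \<tau>) (s, t'))" for \<tau> t'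
  note slice = continuous_on_slice_integral[OF \<theta>(1) _ _ Z \<open>0 \<le> s\<close> \<open>0 \<le> d\<close>]
  have ck: "continuous_on {(\<tau>, t'). \<tau> \<in> {d..T} \<and> t' \<in> {d..\<tau>}} (\<lambda>(\<tau>, t'). k \<tau> t')"
    unfolding k_def by (rule slice) (use \<theta>(2) K in auto)
  have ck': "continuous_on {(\<tau>, t'). \<tau> \<in> {d..T} \<and> t' \<in> {d..\<tau>}} (\<lambda>(\<tau>, t'). k' \<tau> t')"
    unfolding k'_def by (rule slice) (use \<theta>(2) K' in auto)
  have dk: "(k \<tau> has_real_derivative k' \<tau> t') (at t' within {d..\<tau>})"
    if "\<tau> \<in> {d..T}" "t' \<in> {d..\<tau>}" for \<tau> t'
    unfolding k_def k'_def box_real(2)[of s, symmetric]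
  proof (rule leibniz_rule_field_derivative)
    fix t1 \<sigma> assume t1: "t1 \<in> {d..\<tau>}" and \<sigma>: "\<sigma> \<in> cbox s (\<theta> \<tau>)"
    show "((\<lambda>t1. K (\<sigma>, \<tau>) (s, t1)) has_field_derivative K' (\<sigma>, \<tau>) (s, t1)) (at t1 within {d..\<tau>})"
      by (rule DERIV_subset[OF der]) (use that t1 \<sigma> Z \<open>0 \<le> s\<close> \<open>0 \<le> d\<close> in \<open>auto simp: mem_rect\<close>)
  next
    fix t1 assume t1: "t1 \<in> {d..\<tau>}"
    show "(\<lambda>\<sigma>. K (\<sigma>, \<tau>) (s, t1)) integrable_on cbox s (\<theta> \<tau>)"
      by (rule integrable_continuous, rule continuous_on_compose_case_prod[OF K])
        (use that t1 Z \<open>0 \<le> s\<close> \<open>0 \<le> d\<close> in \<open>auto simp: mem_rect intro!: continuous_intros\<close>)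
  next
    show "continuous_on ({d..\<tau>} \<times> cbox s (\<theta> \<tau>)) (\<lambda>(t1, \<sigma>). K' (\<sigma>, \<tau>) (s, t1))"
      unfolding case_prod_beta by (rule continuous_on_compose_case_prod[OF K'])
        (use that Z \<open>0 \<le> s\<close> \<open>0 \<le> d\<close> in \<open>auto simp: mem_rect intro!: continuous_intros\<close>)
  qed (use that in auto)
  have fub: "integral (E t') (\<lambda>z. q z (s, t')) = integral {t'..T} (\<lambda>\<tau>. integral {s..\<theta> \<tau>} (\<lambda>\<sigma>. q (\<sigma>, \<tau>) (s, t')))"
    if "t' \<in> {d<..<T}" "continuous_on {(z, w). z \<in> Z \<and> w \<in> rect z} (\<lambda>(z, w). q z w)"
    for t' and q :: "point \<Rightarrow> point \<Rightarrow> real"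
    unfolding E_def
  proof (rule integral_under_graph)
    show "continuous_on {t'..T} \<theta>" by (rule continuous_on_subset[OF \<theta>(1)]) (use that in auto)
    show "continuous_on {(\<sigma>, \<tau>). \<tau> \<in> {t'..T} \<and> \<sigma> \<in> {s..\<theta> \<tau>}} (\<lambda>z. q z (s, t'))"
      by (rule continuous_on_compose_case_prod[OF that(2)])
        (use that Z \<open>0 \<le> s\<close> \<open>0 \<le> d\<close> in \<open>auto simp: mem_rect intro!: continuous_intros\<close>)
  qed
  \<comment> \<open>The moving limit is the variable itself, so both \<open>e\<close> and
    \<open>\<phi>\<close> are the identity, the speed is 1, and the weight is the constant
    1.\<close>
  have "((\<lambda>t'. integral {t'..T} (\<lambda>\<tau>. 1 * k \<tau> t')) has_real_derivative
    integral {t..T} (\<lambda>\<tau>. 1 * k' \<tau> t) - 1 * (1 * k t t)) (at t)"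
    by (rule leibniz_rule_moving_limit[where \<phi> = "\<lambda>x. x" and l = d and u = T and d = d])
      (use t ck ck' dk in \<open>auto intro!: continuous_intros\<close>)
  then have "((\<lambda>t'. integral {t'..T} (\<lambda>\<tau>. k \<tau> t')) has_real_derivative
    integral (E t) (\<lambda>z. K' z (s, t)) - k t t) (at t)"
    using fub[OF t K'] by (simp add: k'_def)
  then have "((\<lambda>t'. integral {t'..T} (\<lambda>\<tau>. k \<tau> t')) has_real_derivative
    integral (E t) (\<lambda>z. K' z (s, t)) - integral {s..\<theta> t} (\<lambda>\<sigma>. K (\<sigma>, t) (s, t))) (at t)"
    by (simp add: k_def)
  then show ?thesis
    by (rule has_field_derivative_transform_within_open[of _ _ _ "{d<..<T}"])
      (use t fub[OF _ K] in \<open>auto simp: k_def\<close>)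
qed

section \<open>Limits at oblique boundary points\<close>

text \<open>For (s, t) in \<open>V\<close>, the points of \<Omega> above and to the right form a
  curvilinear triangle with corner (s, t), whose third side is the arc from the parameter of height
  \<open>t\<close> to the parameter of abscissa \<open>s\<close>. When \<open>t\<close> moves, only
  the bottom edge and the lower end of the arc move. Positivity of \<open>snd (g' m)\<close> makes
  the parameter of height \<open>t\<close> differentiable in \<open>t\<close>, with derivative 1 /
  snd g'; the other end of the arc is fixed, so strict decrease of \<open>fst (g m)\<close> suffices
  there. Multiplication by \<open>snd (g' \<mu>)\<close> clears the speed from the limit.\<close>

lemma oblique_local_derivative:
  fixes g g' :: "real \<Rightarrow> point" and KA KA' :: "point \<Rightarrow> point \<Rightarrow> real" and KC KC' :: "real \<Rightarrow> point \<Rightarrow> real"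
    and p q \<mu> :: real and \<psi> :: "point \<Rightarrow> real"
  defines "\<Omega> \<equiv> (\<Union>m\<in>{p..q}. rect (g m))"
    and "V \<equiv> {w. fst (g q) < fst w \<and> snd (g p) < snd w \<and>
      (\<exists>m\<in>{p..q}. fst w < fst (g m) \<and> snd w < snd (g m))}"
  assumes \<mu>: "p < \<mu>" "\<mu> < q"
    and g: "\<And>m. m \<in> {p..q} \<Longrightarrow> (g has_vector_derivative g' m) (at m)" "continuous_on {p..q} g'"
    and pos: "\<And>m. m \<in> {p..q} \<Longrightarrow> 0 < snd (g' m)"
    and dec: "\<And>m n. p \<le> m \<Longrightarrow> m < n \<Longrightarrow> n \<le> q \<Longrightarrow> fst (g n) < fst (g m)"
    and nonneg: "0 \<le> fst (g q)" "0 \<le> snd (g p)"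
    and KA: "continuous_on {(z, w). z \<in> \<Omega> \<and> w \<in> rect z} (\<lambda>(z, w). KA z w)"
    and KA': "continuous_on {(z, w). z \<in> \<Omega> \<and> w \<in> rect z} (\<lambda>(z, w). KA' z w)"
    and derA: "\<And>z s t. z \<in> \<Omega> \<Longrightarrow> (s, t) \<in> rect z \<Longrightarrow>
      ((\<lambda>t'. KA z (s, t')) has_real_derivative KA' z (s, t)) (at t within {0..snd z})"
    and KC: "continuous_on {(m, w). m \<in> {p..q} \<and> w \<in> rect (g m)} (\<lambda>(m, w). KC m w)"
    and KC': "continuous_on {(m, w). m \<in> {p..q} \<and> w \<in> rect (g m)} (\<lambda>(m, w). KC' m w)"
    and derC: "\<And>m s t. m \<in> {p..q} \<Longrightarrow> (s, t) \<in> rect (g m) \<Longrightarrow>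
      ((\<lambda>t'. KC m (s, t')) has_real_derivative KC' m (s, t)) (at t within {0..snd (g m)})"
    and \<psi>: "\<And>w. w \<in> V \<Longrightarrow> \<psi> w = integral {z \<in> \<Omega>. w \<in> rect z} (\<lambda>z. KA z w)
      + integral {m \<in> {p..q}. w \<in> rect (g m)} (\<lambda>m. KC m w)"
  obtains \<psi>t where
    "\<And>s t. (s, t) \<in> V \<Longrightarrow> ((\<lambda>t'. \<psi> (s, t')) has_real_derivative \<psi>t (s, t)) (at t)"
    "((\<lambda>w. snd (g' \<mu>) * \<psi>t w) \<longlongrightarrow> - KC \<mu> (g \<mu>)) (at (g \<mu>) within V)"
proof -
  have ab: "p < q" using \<mu> by simp
  have dg: "((\<lambda>m. fst (g m)) has_real_derivative fst (g' m)) (at m)"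
    "((\<lambda>m. snd (g m)) has_real_derivative snd (g' m)) (at m)" if "m \<in> {p..q}" for m
    using g(1)[OF that] unfolding has_real_derivative_iff_has_vector_derivative
    by (auto intro: bounded_linear.has_vector_derivative bounded_linear_fst bounded_linear_snd)
  have cg: "continuous_on {p..q} g"
    using g(1) by (meson continuous_at_imp_continuous_on has_vector_derivative_continuous)
  have inc: "snd (g m) < snd (g n)" if "p \<le> m" "m < n" "n \<le> q" for m n
  proof (rule DERIV_pos_imp_increasing[OF that(2)])
    fix x assume "m \<le> x" "x \<le> n"
    then have "x \<in> {p..q}" using that by auto
    then show "\<exists>y. ((\<lambda>m. snd (g m)) has_real_derivative y) (at x) \<and> 0 < y" using dg pos by blast
  qed
  have inc': "snd (g m) \<le> snd (g n)" if "p \<le> m" "m \<le> n" "n \<le> q" for m n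
    using inc[of m n] that by (cases "m = n") auto
  have dec': "fst (g n) \<le> fst (g m)" if "p \<le> m" "m \<le> n" "n \<le> q" for m n
    using dec[of m n] that by (cases "m = n") auto
  obtain e where e: "\<And>t. t \<in> {snd (g p)..snd (g q)} \<Longrightarrow> e t \<in> {p..q} \<and> snd (g (e t)) = t"
    "continuous_on {snd (g p)..snd (g q)} e"
    "\<And>t m. t \<in> {snd (g p)..snd (g q)} \<Longrightarrow> m \<in> {p..q} \<Longrightarrow> t \<le> snd (g m) \<longleftrightarrow> e t \<le> m"
    "\<And>m. m \<in> {p..q} \<Longrightarrow> e (snd (g m)) = m"
    "\<And>t d. t \<in> {snd (g p)<..<snd (g q)} \<Longrightarrow> ((\<lambda>m. snd (g m)) has_real_derivative d) (at (e t)) \<Longrightarrow> d \<noteq> 0 \<Longrightarrow>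
      (e has_real_derivative inverse d) (at t)"
    by (rule strict_mono_inverse[OF ab continuous_on_snd[OF cg]]) (rule inc, assumption+, blast)
  \<comment> \<open>The abscissa decreases along the curve, so its negative is inverted;
    \<open>e2 s\<close> is then the parameter at which the abscissa equals \<open>s\<close>.\<close>
  have "continuous_on {p..q} (\<lambda>m. - fst (g m))" by (intro continuous_intros cg)
  then obtain e2' where e2': "\<And>t. t \<in> {- fst (g p)..- fst (g q)} \<Longrightarrow> e2' t \<in> {p..q} \<and> - fst (g (e2' t)) = t"
    "continuous_on {- fst (g p)..- fst (g q)} e2'"
    "\<And>m. m \<in> {p..q} \<Longrightarrow> e2' (- fst (g m)) = m"
    by (rule strict_mono_inverse[OF ab]) (use dec in force, blast)
  define e2 where "e2 s = e2' (- s)" for s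
  have e2: "e2 s \<in> {p..q}" "fst (g (e2 s)) = s" if "s \<in> {fst (g q)..fst (g p)}" for s
    using e2'(1)[of "- s"] that unfolding e2_def by auto
  have e2_iff: "s \<le> fst (g m) \<longleftrightarrow> m \<le> e2 s" if "s \<in> {fst (g q)..fst (g p)}" "m \<in> {p..q}" for s m
    using e2[OF that(1)] dec[of m "e2 s"] dec[of "e2 s" m] that(2)
    by (cases m "e2 s" rule: linorder_cases) auto
  have ce2: "continuous_on {fst (g q)..fst (g p)} e2"
    unfolding e2_def by (rule continuous_on_compose2[OF e2'(2)]) (auto intro!: continuous_intros)
  \<comment> \<open>\<open>\<theta> \<tau>\<close> is the abscissa of the curve at height \<tau>,
    and \<open>T s\<close> the height of the curve at abscissa \<open>s\<close>: the triangle is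
    described as a region under the graph of \<theta>.\<close>
  define \<theta> where "\<theta> \<tau> = fst (g (e \<tau>))" for \<tau>
  have c\<theta>: "continuous_on {snd (g p)..snd (g q)} \<theta>"
    unfolding \<theta>_def by (rule continuous_on_fst, rule continuous_on_compose2[OF cg e(2)]) (use e(1) in auto)
  define T where "T s = snd (g (e2 s))" for s
  define E where "E s t = {(\<sigma>, \<tau>). \<tau> \<in> {t..T s} \<and> \<sigma> \<in> {s..\<theta> \<tau>}}" for s t
  \<comment> \<open>Four contributions: the interior of the triangle, its bottom edge, the interior
    of the arc, and the lower end of the arc. In the limit only the last one survives.\<close>
  define \<psi>t where "\<psi>t w = integral (E (fst w) (snd w)) (\<lambda>z. KA' z w)
      - integral {fst w..\<theta> (snd w)} (\<lambda>\<sigma>. KA (\<sigma>, snd w) w)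
      + (integral {e (snd w)..e2 (fst w)} (\<lambda>m. KC' m w)
      - inverse (snd (g' (e (snd w)))) * KC (e (snd w)) w)" for w
  have Vb: "s \<in> {fst (g q)<..<fst (g p)}" "t \<in> {snd (g p)<..<snd (g q)}" "e t < e2 s" "t < T s" "s < \<theta> t"
    "T s \<le> snd (g q)" "snd (g p) \<le> T s"
    if V: "(s, t) \<in> V" for s t
  proof -
    obtain m where m: "m \<in> {p..q}" "s < fst (g m)" "t < snd (g m)"
      and st: "fst (g q) < s" "snd (g p) < t" using V by (auto simp: V_def)
    show s: "s \<in> {fst (g q)<..<fst (g p)}" using m st dec'[of p m] by auto
    show t: "t \<in> {snd (g p)<..<snd (g q)}" using m st inc'[of m q] by auto
    have "m \<le> e2 s" "m \<noteq> e2 s" using e2_iff[of s m] e2[of s] s m by auto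
    moreover have "e t \<le> m" using e(3)[of t m] t m by auto
    ultimately show lt: "e t < e2 s" by simp
    have et: "e t \<in> {p..q}" "snd (g (e t)) = t" using e(1)[of t] t by auto
    have e2s: "e2 s \<in> {p..q}" "fst (g (e2 s)) = s" using e2[of s] s by auto
    show "t < T s" "s < \<theta> t" "T s \<le> snd (g q)" "snd (g p) \<le> T s"
      using inc[of "e t" "e2 s"] dec[of "e t" "e2 s"] inc'[of "e2 s" q] inc'[of p "e2 s"] lt et e2s
      by (auto simp: T_def \<theta>_def)
  qed
  have \<theta>s: "s \<le> \<theta> \<tau>" if V: "(s, t) \<in> V" and \<tau>: "\<tau> \<in> {snd (g p)..T s}" for s t \<tau>
  proof -
    have "e2 s \<in> {p..q}" "fst (g (e2 s)) = s" using e2[of s] Vb[OF V] by auto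
    moreover have "e \<tau> \<in> {p..q}" "e \<tau> \<le> e2 s"
      using e(1)[of \<tau>] e(3)[of \<tau> "e2 s"] \<tau> Vb[OF V] calculation by (auto simp: T_def)
    ultimately show ?thesis using dec'[of "e \<tau>" "e2 s"] by (auto simp: \<theta>_def)
  qed
  have \<Omega>: "(\<sigma>, \<tau>) \<in> \<Omega>" if "\<tau> \<in> {snd (g p)..snd (g q)}" "0 \<le> \<sigma>" "\<sigma> \<le> \<theta> \<tau>" for \<sigma> \<tau>
    using e(1)[OF that(1)] that nonneg unfolding \<Omega>_def by (auto simp: mem_rect \<theta>_def intro!: bexI[of _ "e \<tau>"])
  have E: "{z \<in> \<Omega>. (s, t) \<in> rect z} = E s t" if V: "(s, t) \<in> V" for s t
  proof (intro set_eqI iffI)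
    fix z assume "z \<in> {z \<in> \<Omega>. (s, t) \<in> rect z}"
    then obtain m \<sigma> \<tau> where z: "z = (\<sigma>, \<tau>)" "m \<in> {p..q}" "0 \<le> \<sigma>" "\<sigma> \<le> fst (g m)" "\<tau> \<le> snd (g m)" "s \<le> \<sigma>" "t \<le> \<tau>"
      by (cases z) (auto simp: \<Omega>_def mem_rect)
    have \<tau>: "\<tau> \<in> {snd (g p)..snd (g q)}" using z Vb[OF V] inc'[of m q] by auto
    have "m \<le> e2 s" using e2_iff[of s m] Vb[OF V] z by auto
    then have "\<tau> \<le> T s" using inc'[of m "e2 s"] z e2[of s] Vb[OF V] by (auto simp: T_def)
    moreover have "\<sigma> \<le> \<theta> \<tau>" using e(1)[OF \<tau>] e(3)[OF \<tau> z(2)] dec'[of "e \<tau>" m] z by (auto simp: \<theta>_def)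
    ultimately show "z \<in> E s t" using z by (auto simp: E_def)
  next
    fix z assume "z \<in> E s t"
    then show "z \<in> {z \<in> \<Omega>. (s, t) \<in> rect z}"
      using Vb[OF V] nonneg by (auto simp: E_def mem_rect intro!: \<Omega>)
  qed
  have arc: "{m \<in> {p..q}. (s, t) \<in> rect (g m)} = {e t..e2 s}" if V: "(s, t) \<in> V" for s t
    using Vb[OF V] e(1)[of t] e(3)[of t] e2[of s] e2_iff[of s] nonneg by (auto simp: mem_rect)
  show ?thesis
  proof (rule that[of \<psi>t])
    fix s t assume V: "(s, t) \<in> V"
    then obtain m where m: "m \<in> {p..q}" "s < fst (g m)" "t < snd (g m)" by (auto simp: V_def)
    note V' = Vb[OF V]
    have s0: "0 \<le> s" using V' nonneg by auto
    have dA: "((\<lambda>t'. integral (E s t') (\<lambda>z. KA z (s, t'))) has_real_derivative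
      integral (E s t) (\<lambda>z. KA' z (s, t)) - integral {s..\<theta> t} (\<lambda>\<sigma>. KA (\<sigma>, t) (s, t))) (at t)"
      unfolding E_def
    proof (rule area_integral_derivative[OF _ _ KA KA' derA])
      show "continuous_on {snd (g p)..T s} \<theta>" by (rule continuous_on_subset[OF c\<theta>]) (use V' in auto)
      show "s \<le> \<theta> \<tau>" if "\<tau> \<in> {snd (g p)..T s}" for \<tau> using \<theta>s[OF V that] .
      show "(\<sigma>, \<tau>) \<in> \<Omega>" if "\<tau> \<in> {snd (g p)..T s}" "\<sigma> \<in> {s..\<theta> \<tau>}" for \<sigma> \<tau>
        using that V' nonneg by (auto intro!: \<Omega>)
    qed (use V' s0 nonneg in auto)
    have e2s: "e2 s \<in> {p..q}" "fst (g (e2 s)) = s" using e2[of s] V' by auto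
    have sub: "s \<le> fst (g m)" if "m \<in> {p..e2 s}" for m using e2_iff[of s m] that e2s V' by auto
    have et: "e t \<in> {p..q}" "snd (g (e t)) = t" using e(1)[of t] V' by auto
    \<comment> \<open>The weight is 1 because \<open>KC\<close> already contains the density along
      the curve; it is assumed jointly continuous on this arc, unlike the general weight of the
      moving-limit rule.\<close>
    have dC: "((\<lambda>t'. integral {e t'..e2 s} (\<lambda>m. 1 * KC m (s, t'))) has_real_derivative
      integral {e t..e2 s} (\<lambda>m. 1 * KC' m (s, t)) - inverse (snd (g' (e t))) * (1 * KC (e t) (s, t))) (at t)"
    proof (rule leibniz_rule_moving_limit[where \<phi> = "\<lambda>m. snd (g m)" and d = p and l = "snd (g p)" and u = "T s"])
      show "(\<lambda>m. snd (g m)) ` {p..e2 s} \<subseteq> {snd (g p)..T s}"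
        using inc'[of p] inc'[of _ "e2 s"] e2s by (auto simp: T_def)
      show "continuous_on {p..e2 s} (\<lambda>m. snd (g m))"
        by (rule continuous_on_subset[OF continuous_on_snd[OF cg]]) (use e2s in auto)
      fix \<tau> assume \<tau>: "\<tau> \<in> {snd (g p)..T s}"
      then have \<tau>': "\<tau> \<in> {snd (g p)..snd (g q)}" using V' by auto
      show "e \<tau> \<in> {p..e2 s}" using e(1)[OF \<tau>'] e(3)[OF \<tau>', of "e2 s"] \<tau> e2s by (auto simp: T_def)
      show "\<tau> \<le> snd (g m) \<longleftrightarrow> e \<tau> \<le> m" if "m \<in> {p..e2 s}" for m
        using e(3)[OF \<tau>', of m] that e2s by auto
    next
      show "(e has_real_derivative inverse (snd (g' (e t)))) (at t)"
        using e(5)[of t] V' dg(2)[OF et(1)] pos[OF et(1)] by auto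
      show "e t \<in> {p<..<e2 s}"
      proof -
        have "e t \<noteq> p" using et(2) V'(2) by auto
        then show ?thesis using V' et by auto
      qed
    next
      fix m t' assume *: "m \<in> {p..e2 s}" "t' \<in> {snd (g p)..snd (g m)}"
      show "((\<lambda>t'. KC m (s, t')) has_real_derivative KC' m (s, t')) (at t' within {snd (g p)..snd (g m)})"
        by (rule DERIV_subset[OF derC]) (use * sub e2s nonneg s0 in \<open>auto simp: mem_rect\<close>)
    next
      show "continuous_on {(m, \<tau>). m \<in> {p..e2 s} \<and> \<tau> \<in> {snd (g p)..snd (g m)}} (\<lambda>(m, \<tau>). KC m (s, \<tau>))"
        unfolding case_prod_beta by (rule continuous_on_compose_case_prod[OF KC])
          (use sub e2s nonneg s0 in \<open>auto intro!: continuous_intros simp: mem_rect\<close>)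
      show "continuous_on {(m, \<tau>). m \<in> {p..e2 s} \<and> \<tau> \<in> {snd (g p)..snd (g m)}} (\<lambda>(m, \<tau>). KC' m (s, \<tau>))"
        unfolding case_prod_beta by (rule continuous_on_compose_case_prod[OF KC'])
          (use sub e2s nonneg s0 in \<open>auto intro!: continuous_intros simp: mem_rect\<close>)
      show "(\<lambda>m. 1 :: real) absolutely_integrable_on {p..e2 s}"
        by (intro absolutely_integrable_continuous_real continuous_on_const)
      show "isCont (\<lambda>m. 1 :: real) (e t)" by (rule continuous_const)
      show "t \<in> {snd (g p)<..<T s}" "snd (g (e t)) = t" using V' et by auto
    qed
    have "((\<lambda>t'. integral (E s t') (\<lambda>z. KA z (s, t')) + integral {e t'..e2 s} (\<lambda>m. KC m (s, t')))
        has_real_derivative \<psi>t (s, t)) (at t)"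
      using DERIV_add[OF dA dC] by (simp add: \<psi>t_def)
    then show "((\<lambda>t'. \<psi> (s, t')) has_real_derivative \<psi>t (s, t)) (at t)"
    proof (rule has_field_derivative_transform_within_open[of _ _ _ "{snd (g p)<..<snd (g m)}"])
      \<comment> \<open>The point \<open>g m\<close> that witnesses \<open>(s, t) \<in> V\<close>
        serves every height \<open>t'\<close> in this interval, so the integral representation of
        \<psi> holds in a whole neighbourhood of \<open>t\<close>.\<close>
      fix t' assume "t' \<in> {snd (g p)<..<snd (g m)}"
      then have V2: "(s, t') \<in> V" using m V by (auto simp: V_def)
      show "integral (E s t') (\<lambda>z. KA z (s, t')) + integral {e t'..e2 s} (\<lambda>m. KC m (s, t')) = \<psi> (s, t')"
        using \<psi>[OF V2] E[OF V2] arc[OF V2] by simp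
    qed (use V' m in auto)
  next
    let ?F = "at (g \<mu>) within V"
    have \<mu>': "\<mu> \<in> {p..q}" using \<mu> by auto
    have evV: "eventually (\<lambda>w. w \<in> V) ?F" by (simp add: eventually_at_filter)
    have idlim: "((\<lambda>w. w) \<longlongrightarrow> g \<mu>) ?F" by (rule tendsto_ident_at)
    note lims = tendsto_fst[OF idlim] tendsto_snd[OF idlim]
    have e\<mu>: "e (snd (g \<mu>)) = \<mu>" "e2 (fst (g \<mu>)) = \<mu>"
      using e(4)[OF \<mu>'] e2'(3)[OF \<mu>'] by (auto simp: e2_def)
    have "isCont e (snd (g \<mu>))"
      by (rule continuous_on_interior[OF e(2)]) (use inc \<mu> in auto)
    then have le: "((\<lambda>w. e (snd w)) \<longlongrightarrow> \<mu>) ?F" using isCont_tendsto_compose lims(2) e\<mu> by metis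
    have "isCont e2 (fst (g \<mu>))"
      by (rule continuous_on_interior[OF ce2]) (use dec \<mu> in auto)
    then have le2: "((\<lambda>w. e2 (fst w)) \<longlongrightarrow> \<mu>) ?F" using isCont_tendsto_compose lims(1) e\<mu> by metis
    have cg\<mu>: "isCont g \<mu>" using g(1)[OF \<mu>'] by (rule has_vector_derivative_continuous)
    have l\<theta>: "((\<lambda>w. \<theta> (snd w)) \<longlongrightarrow> fst (g \<mu>)) ?F"
      unfolding \<theta>_def by (intro tendsto_fst isCont_tendsto_compose[OF cg\<mu> le])
    have lT: "((\<lambda>w. T (fst w)) \<longlongrightarrow> snd (g \<mu>)) ?F"
      unfolding T_def by (intro tendsto_snd isCont_tendsto_compose[OF cg\<mu> le2])
    have cD: "compact {(z, w). z \<in> \<Omega> \<and> w \<in> rect z}" "compact {(m, w). m \<in> {p..q} \<and> w \<in> rect (g m)}"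
      using compact_rect_pairs[of \<Omega> "\<lambda>z. z"] compact_rect_Union[OF _ cg] compact_rect_pairs[OF _ cg]
      by (auto simp: \<Omega>_def)
    obtain M where M: "0 \<le> M" "\<And>z w. (z, w) \<in> {(z, w). z \<in> \<Omega> \<and> w \<in> rect z} \<Longrightarrow> \<bar>KA z w\<bar> \<le> M"
      by (rule compact_bounded_abs[OF cD(1) KA]) blast
    obtain M' where M': "0 \<le> M'" "\<And>z w. (z, w) \<in> {(z, w). z \<in> \<Omega> \<and> w \<in> rect z} \<Longrightarrow> \<bar>KA' z w\<bar> \<le> M'"
      by (rule compact_bounded_abs[OF cD(1) KA']) blast
    obtain N where N: "0 \<le> N" "\<And>m w. (m, w) \<in> {(m, w). m \<in> {p..q} \<and> w \<in> rect (g m)} \<Longrightarrow> \<bar>KC' m w\<bar> \<le> N"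
      by (rule compact_bounded_abs[OF cD(2) KC']) blast
    have t1: "((\<lambda>w. integral (E (fst w) (snd w)) (\<lambda>z. KA' z w)) \<longlongrightarrow> 0) ?F"
    proof (rule Lim_null_comparison)
      show "\<forall>\<^sub>F w in ?F. norm (integral (E (fst w) (snd w)) (\<lambda>z. KA' z w))
          \<le> M' * ((\<theta> (snd w) - fst w) * (T (fst w) - snd w))"
        using evV
      proof eventually_elim
        case (elim w)
        obtain s t where w: "w = (s, t)" by (cases w)
        note V = elim[unfolded w]
        note V' = Vb[OF V]
        \<comment> \<open>The triangle lies in the box spanned by its corner and the point with
          coordinates \<open>\<theta> t\<close> and \<open>T s\<close>. Both side lengths tend to 0,
          since \<open>e t\<close> and \<open>e2 s\<close> tend to \<mu>.\<close>
        have "\<bar>integral (E s t) (\<lambda>z. KA' z w)\<bar> \<le> M' * measure lborel (cbox (s, t) (\<theta> t, T s))"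
        proof (rule abs_integral_le_content)
          show "\<bar>KA' z w\<bar> \<le> M'" if "z \<in> E s t" for z using M'(2)[of z w] that E[OF V] w by auto
          show "E s t \<subseteq> cbox (s, t) (\<theta> t, T s)"
          proof (clarsimp simp: E_def cbox_Pair_eq)
            fix \<sigma> \<tau> assume *: "t \<le> \<tau>" "\<tau> \<le> T s" "\<sigma> \<le> \<theta> \<tau>"
            then have tt: "t \<in> {snd (g p)..snd (g q)}" "\<tau> \<in> {snd (g p)..snd (g q)}" using V' by auto
            then have "e t \<le> e \<tau>" using e(3)[OF tt(1), of "e \<tau>"] e(1)[OF tt(2)] * by auto
            then show "\<sigma> \<le> \<theta> t" using dec'[of "e t" "e \<tau>"] e(1)[OF tt(1)] e(1)[OF tt(2)] *
              by (auto simp: \<theta>_def)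
          qed
        qed (rule M')
        also have "measure lborel (cbox (s, t) (\<theta> t, T s)) = (\<theta> t - s) * (T s - t)"
          using V' by (simp add: content_Pair)
        finally show ?case using w by simp
      qed
      show "((\<lambda>w. M' * ((\<theta> (snd w) - fst w) * (T (fst w) - snd w))) \<longlongrightarrow> 0) ?F"
      proof -
        have "((\<lambda>w. M' * ((\<theta> (snd w) - fst w) * (T (fst w) - snd w))) \<longlongrightarrow>
          M' * ((fst (g \<mu>) - fst (g \<mu>)) * (snd (g \<mu>) - snd (g \<mu>)))) ?F"
          by (intro tendsto_intros l\<theta> lT)
        then show ?thesis by simp
      qed
    qed
    have t2: "((\<lambda>w. integral {fst w..\<theta> (snd w)} (\<lambda>\<sigma>. KA (\<sigma>, snd w) w)) \<longlongrightarrow> 0) ?F"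
    proof (rule Lim_null_comparison)
      show "\<forall>\<^sub>F w in ?F. norm (integral {fst w..\<theta> (snd w)} (\<lambda>\<sigma>. KA (\<sigma>, snd w) w)) \<le> M * (\<theta> (snd w) - fst w)"
        using evV
      proof eventually_elim
        case (elim w)
        obtain s t where w: "w = (s, t)" by (cases w)
        note V = elim[unfolded w]
        note V' = Vb[OF V]
        have "\<bar>integral {s..\<theta> t} (\<lambda>\<sigma>. KA (\<sigma>, t) w)\<bar> \<le> M * measure lborel (cbox s (\<theta> t))"
          using V' nonneg w by (intro abs_integral_le_content M) (auto intro!: \<Omega> simp: mem_rect)
        then show ?case using w V' by simp
      qed
      show "((\<lambda>w. M * (\<theta> (snd w) - fst w)) \<longlongrightarrow> 0) ?F"
        using tendsto_mult_left[OF tendsto_diff[OF l\<theta> lims(1)], of M] by simp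
    qed
    have t3: "((\<lambda>w. integral {e (snd w)..e2 (fst w)} (\<lambda>m. KC' m w)) \<longlongrightarrow> 0) ?F"
    proof (rule Lim_null_comparison)
      show "\<forall>\<^sub>F w in ?F. norm (integral {e (snd w)..e2 (fst w)} (\<lambda>m. KC' m w)) \<le> N * (e2 (fst w) - e (snd w))"
        using evV
      proof eventually_elim
        case (elim w)
        obtain s t where w: "w = (s, t)" by (cases w)
        note V = elim[unfolded w]
        note V' = Vb[OF V]
        have "\<bar>integral {e t..e2 s} (\<lambda>m. KC' m w)\<bar> \<le> N * measure lborel (cbox (e t) (e2 s))"
        proof (rule abs_integral_le_content)
          fix m assume "m \<in> {e t..e2 s}"
          then have "m \<in> {m \<in> {p..q}. (s, t) \<in> rect (g m)}" unfolding arc[OF V] .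
          then show "\<bar>KC' m w\<bar> \<le> N" using N(2)[of m w] w by simp
        qed (use N in auto)
        then show ?case using w V' by simp
      qed
      show "((\<lambda>w. N * (e2 (fst w) - e (snd w))) \<longlongrightarrow> 0) ?F"
        using tendsto_mult_left[OF tendsto_diff[OF le2 le], of N] by simp
    qed
    \<comment> \<open>The moving end \<open>e (snd w)\<close> and the point \<open>w\<close>
      converge simultaneously, so joint continuity of \<open>KC\<close> is used, on a domain that
      contains all these pairs as well as the limit pair.\<close>
    have t4: "((\<lambda>w. KC (e (snd w)) w) \<longlongrightarrow> KC \<mu> (g \<mu>)) ?F"
    proof -
      have "((\<lambda>w. case (e (snd w), w) of (m, w) \<Rightarrow> KC m w) \<longlongrightarrow> (case (\<mu>, g \<mu>) of (m, w) \<Rightarrow> KC m w)) ?F"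
      proof (rule continuous_on_tendsto_compose[OF KC])
        show "((\<lambda>w. (e (snd w), w)) \<longlongrightarrow> (\<mu>, g \<mu>)) ?F" by (intro tendsto_Pair le idlim)
        show "(\<mu>, g \<mu>) \<in> {(m, w). m \<in> {p..q} \<and> w \<in> rect (g m)}"
          using \<mu> nonneg dec'[of \<mu> q] inc'[of p \<mu>] by (auto simp: mem_rect)
        show "\<forall>\<^sub>F w in ?F. (e (snd w), w) \<in> {(m, w). m \<in> {p..q} \<and> w \<in> rect (g m)}"
          using evV
        proof eventually_elim
          case (elim w)
          obtain s t where w: "w = (s, t)" by (cases w)
          note V = elim[unfolded w]
          have "e t \<in> {e t..e2 s}" using Vb(3)[OF V] by simp
          then have "e t \<in> {m \<in> {p..q}. (s, t) \<in> rect (g m)}" unfolding arc[OF V] .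
          then show ?case using w by simp
        qed
      qed
      then show ?thesis by simp
    qed
    have "isCont (\<lambda>m. snd (g' m)) \<mu>"
      by (rule continuous_on_interior[OF continuous_on_snd[OF g(2)]]) (use \<mu> in auto)
    then have t5: "((\<lambda>w. inverse (snd (g' (e (snd w))))) \<longlongrightarrow> inverse (snd (g' \<mu>))) ?F"
      using pos[OF \<mu>'] by (intro tendsto_inverse isCont_tendsto_compose[OF _ le]) auto
    have "((\<lambda>w. snd (g' \<mu>) * \<psi>t w) \<longlongrightarrow> snd (g' \<mu>) * (0 - 0 + (0 - inverse (snd (g' \<mu>)) * KC \<mu> (g \<mu>)))) ?F"
      unfolding \<psi>t_def by (intro tendsto_intros t1 t2 t3 t4 t5)
    then show "((\<lambda>w. snd (g' \<mu>) * \<psi>t w) \<longlongrightarrow> - KC \<mu> (g \<mu>)) ?F"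
      using pos[OF \<mu>'] by (simp add: mult.assoc[symmetric])
  qed
qed

section \<open>Derivative along flat boundary arcs\<close>

text \<open>Treats a vertical arc traversed at unit speed. The points that dominate (s0, t) are
  those with parameters from \<open>e t\<close> to a fixed \<open>c\<close>, where the curve leaves
  the vertical line. Since \<open>c\<close> need not be close to \<mu>, the densities
  \<open>F\<close> are only integrable on this range, with continuity at \<mu>. The condition
  \<open>edge\<close> holds for all these points at once, so the derivatives of the kernels combine,
  in the integral and in the vertex sum alike, to a multiple of \<psi> itself.\<close>

lemma flat_local_derivative:
  fixes g :: "real \<Rightarrow> point" and F :: "'n::finite \<Rightarrow> real \<Rightarrow> real" and R R' :: "point \<Rightarrow> point \<Rightarrow> real^'n^'n"
    and B :: "real^'n^'n" and \<rho> :: "'r \<Rightarrow> real" and V :: "'n \<Rightarrow> 'r \<Rightarrow> real" and \<psi> :: "point \<Rightarrow> real^'n"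
  assumes d: "0 < d" "{\<mu> - d..\<mu> + d} \<subseteq> {p..q}"
    and cg: "continuous_on {p..q} g"
    and mono: "\<And>m n. p \<le> m \<Longrightarrow> m \<le> n \<Longrightarrow> n \<le> q \<Longrightarrow> fst (g n) \<le> fst (g m) \<and> snd (g m) \<le> snd (g n)"
    and nonneg: "\<And>m. m \<in> {p..q} \<Longrightarrow> 0 \<le> fst (g m) \<and> 0 \<le> snd (g m)"
    and flat: "\<And>m. m \<in> {\<mu> - d..\<mu> + d} \<Longrightarrow> g m = (fst (g \<mu>), snd (g \<mu>) + (m - \<mu>))"
    and F: "\<And>i. F i absolutely_integrable_on {p..q}" "\<And>i. isCont (F i) \<mu>"
    and R: "continuous_on {(m, w). m \<in> {p..q} \<and> w \<in> rect (g m)} (\<lambda>(m, w). R (g m) w)"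
    and R': "continuous_on {(m, w). m \<in> {p..q} \<and> w \<in> rect (g m)} (\<lambda>(m, w). R' (g m) w)"
    and der: "\<And>m s t. m \<in> {p..q} \<Longrightarrow> (s, t) \<in> rect (g m) \<Longrightarrow>
      ((\<lambda>t'. R (g m) (s, t')) has_vector_derivative R' (g m) (s, t)) (at t within {0..snd (g m)})"
    and diag: "R (g \<mu>) (g \<mu>) = mat 1"
    and edge: "\<And>m. m \<in> {p..q} \<Longrightarrow> fst (g m) = fst (g \<mu>) \<Longrightarrow> snd (g \<mu>) \<le> snd (g m) \<Longrightarrow>
      R' (g m) (g \<mu>) = - (R (g m) (g \<mu>) ** B)"
    and \<rho>: "finite I" "\<And>r. r \<in> I \<Longrightarrow> \<rho> r \<in> {p..q} - {\<mu> - d..\<mu> + d}"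
    and \<psi>: "\<And>j m. m \<in> {\<mu> - d<..<\<mu> + d} \<Longrightarrow> \<psi> (g m) $ j =
      integral {m' \<in> {p..q}. g m \<in> rect (g m')} (\<lambda>m'. \<Sum>i\<in>UNIV. F i m' * R (g m') (g m) $ i $ j)
      + (\<Sum>r\<in>I. (\<Sum>i\<in>UNIV. V i r * R (g (\<rho> r)) (g m) $ i $ j) * of_bool (g m \<in> rect (g (\<rho> r))))"
  shows "((\<lambda>m. \<psi> (g m) $ j) has_real_derivative - F j \<mu> - (\<Sum>k\<in>UNIV. \<psi> (g \<mu>) $ k * B $ k $ j)) (at \<mu>)"
proof -
  define s0 t0 where "s0 = fst (g \<mu>)" and "t0 = snd (g \<mu>)"
  have g\<mu>: "g \<mu> = (s0, t0)" by (simp add: s0_def t0_def)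
  have flat': "g m = (s0, t0 + (m - \<mu>))" if "m \<in> {\<mu> - d..\<mu> + d}" for m
    using flat[OF that] by (simp add: s0_def t0_def)
  have I\<mu>: "\<mu> \<in> {\<mu> - d..\<mu> + d}" "\<mu> - d \<in> {\<mu> - d..\<mu> + d}" "\<mu> + d \<in> {\<mu> - d..\<mu> + d}" using d(1) by auto
  have pq: "p \<le> \<mu> - d" "\<mu> + d \<le> q" using d by auto
  \<comment> \<open>The parameters of the points on the vertical line through
    \<open>g \<mu>\<close>. The set is compact, so it has a last element \<open>c\<close>; after
    \<open>c\<close> the abscissa is smaller and domination ends.\<close>
  define Z where "Z = {m \<in> {p..q}. fst (g m) = s0}"
  have "compact Z"
  proof -
    have "closed Z" unfolding Z_def
      by (rule continuous_closed_preimage_constant[OF continuous_on_fst[OF cg]]) auto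
    moreover have "bounded Z" by (rule bounded_subset[of "{p..q}"]) (auto simp: Z_def)
    ultimately show ?thesis by (simp add: compact_eq_bounded_closed)
  qed
  moreover have "\<mu> + d \<in> Z" using flat'[OF I\<mu>(3)] pq d(1) by (auto simp: Z_def)
  ultimately obtain c where c: "c \<in> Z" "\<And>m. m \<in> Z \<Longrightarrow> m \<le> c"
    using compact_attains_sup[of Z] by blast
  have cb: "\<mu> + d \<le> c" "c \<le> q" "fst (g c) = s0" using c \<open>\<mu> + d \<in> Z\<close> by (auto simp: Z_def)
  have t0: "0 \<le> t0 - d" "0 \<le> s0"
    using nonneg[of "\<mu> - d"] flat'[OF I\<mu>(2)] pq d(1) by auto
  define e where "e t = \<mu> + (t - t0)" for t
  have ge: "g (e t) = (s0, t)" if "t \<in> {t0 - d..t0 + d}" for t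
    using flat'[of "e t"] that by (auto simp: e_def)
  have e_iff: "t \<le> snd (g m) \<longleftrightarrow> e t \<le> m" if t: "t \<in> {t0 - d..t0 + d}" and m: "m \<in> {\<mu> - d..q}" for t m
  proof (cases "e t \<le> m")
    case True
    then show ?thesis using mono[of "e t" m] ge[OF t] m t pq by (auto simp: e_def)
  next
    case False
    then show ?thesis using flat'[of m] m t by (auto simp: e_def)
  qed
  have c_iff: "s0 \<le> fst (g m) \<longleftrightarrow> m \<le> c" if m: "m \<in> {p..q}" for m
  proof (cases "m \<le> c")
    case True
    then show ?thesis using mono[of m c] cb m by auto
  next
    case False
    then have "fst (g m) \<noteq> s0" using c(2)[of m] m by (auto simp: Z_def)
    moreover have "fst (g m) \<le> s0" using mono[of c m] cb m False pq d(1) by auto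
    ultimately show ?thesis using False by auto
  qed
  have arc: "(s0, t) \<in> rect (g m) \<longleftrightarrow> m \<in> {e t..c}" if t: "t \<in> {t0 - d<..<t0 + d}" and m: "m \<in> {p..q}" for t m
  proof (cases "\<mu> - d \<le> m")
    case True
    then show ?thesis using e_iff[of t m] c_iff[OF m] t m t0 by (auto simp: mem_rect)
  next
    case False
    then have "snd (g m) \<le> t0 - d" using mono[of m "\<mu> - d"] flat'[OF I\<mu>(2)] m pq d(1) by auto
    then show ?thesis using False t by (auto simp: mem_rect e_def)
  qed
  have Fc: "F i absolutely_integrable_on {\<mu> - d..c}" for i
    by (rule set_integrable_subset[OF F(1)]) (use pq cb in auto)
  define D where "D = {(m, w). m \<in> {p..q} \<and> w \<in> rect (g m)}"
  have cR: "continuous_on D (\<lambda>(m, w). R (g m) w $ i $ k)" "continuous_on D (\<lambda>(m, w). R' (g m) w $ i $ k)" for i k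
    using continuous_on_component[OF continuous_on_component[OF R[folded D_def]]]
      continuous_on_component[OF continuous_on_component[OF R'[folded D_def]]]
    by (simp_all add: case_prod_unfold)
  have derij: "((\<lambda>t'. R (g m) (s, t') $ i $ k) has_real_derivative R' (g m) (s, t) $ i $ k) (at t within {0..snd (g m)})"
    if "m \<in> {p..q}" "(s, t) \<in> rect (g m)" for m s t i k
    unfolding has_real_derivative_iff_has_vector_derivative
    by (intro bounded_linear.has_vector_derivative[OF bounded_linear_vec_nth] der that)
  have inD: "(m, (s0, \<tau>)) \<in> D" if "m \<in> {\<mu> - d..c}" "0 \<le> \<tau>" "\<tau> \<le> snd (g m)" for m \<tau>
    using that c_iff[of m] pq cb t0 by (auto simp: D_def mem_rect)
  \<comment> \<open>The bound for the kernel argument is the height of \<open>g m\<close> capped at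
    \<open>t0 + d\<close>: the curve may rise far above this height before \<open>c\<close>, but the
    equivalence between heights and parameters is available only for heights within \<open>d\<close>
    of \<open>t0\<close>.\<close>
  have dI: "((\<lambda>t. integral {e t..c} (\<lambda>m. F i m * R (g m) (s0, t) $ i $ k)) has_real_derivative
      integral {e t0..c} (\<lambda>m. F i m * R' (g m) (s0, t0) $ i $ k) - 1 * (F i (e t0) * R (g (e t0)) (s0, t0) $ i $ k)) (at t0)" for i k
  proof (rule leibniz_rule_moving_limit[where \<phi> = "\<lambda>m. min (snd (g m)) (t0 + d)" and d = "\<mu> - d"
        and l = "t0 - d" and u = "t0 + d"])
    show "F i absolutely_integrable_on {\<mu> - d..c}" by (rule Fc)
    show "isCont (F i) (e t0)" using F(2) by (simp add: e_def)
    show "continuous_on {\<mu> - d..c} (\<lambda>m. min (snd (g m)) (t0 + d))"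
      by (intro continuous_on_min continuous_on_const continuous_on_snd continuous_on_subset[OF cg]) (use pq cb in auto)
    show "(\<lambda>m. min (snd (g m)) (t0 + d)) ` {\<mu> - d..c} \<subseteq> {t0 - d..t0 + d}"
    proof (rule image_subsetI)
      fix m assume "m \<in> {\<mu> - d..c}"
      then have "t0 - d \<le> snd (g m)" using e_iff[of "t0 - d" m] d(1) cb by (auto simp: e_def)
      then show "min (snd (g m)) (t0 + d) \<in> {t0 - d..t0 + d}" using d(1) by auto
    qed
    show "e \<tau> \<in> {\<mu> - d..c}" if "\<tau> \<in> {t0 - d..t0 + d}" for \<tau> using that cb by (auto simp: e_def)
    show "(\<tau> \<le> min (snd (g m)) (t0 + d)) = (e \<tau> \<le> m)" if "\<tau> \<in> {t0 - d..t0 + d}" "m \<in> {\<mu> - d..c}" for \<tau> m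
      using e_iff[of \<tau> m] that cb by auto
    show "t0 \<in> {t0 - d<..<t0 + d}" "e t0 \<in> {\<mu> - d<..<c}" using d(1) cb by (auto simp: e_def)
    show "min (snd (g (e t0))) (t0 + d) = t0" using ge[of t0] d(1) by auto
    show "(e has_real_derivative 1) (at t0)" unfolding e_def by (auto intro!: derivative_eq_intros)
    have sub: "(m, (s0, \<tau>)) \<in> D" if "m \<in> {\<mu> - d..c}" "\<tau> \<in> {t0 - d..min (snd (g m)) (t0 + d)}" for m \<tau>
      using that t0 by (intro inD) auto
    show "continuous_on {(m, \<tau>). m \<in> {\<mu> - d..c} \<and> \<tau> \<in> {t0 - d..min (snd (g m)) (t0 + d)}} (\<lambda>(m, \<tau>). R (g m) (s0, \<tau>) $ i $ k)"
      unfolding case_prod_unfold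
      by (rule continuous_on_compose_case_prod[OF cR(1)]) (use sub in \<open>auto intro!: continuous_intros\<close>)
    show "continuous_on {(m, \<tau>). m \<in> {\<mu> - d..c} \<and> \<tau> \<in> {t0 - d..min (snd (g m)) (t0 + d)}} (\<lambda>(m, \<tau>). R' (g m) (s0, \<tau>) $ i $ k)"
      unfolding case_prod_unfold
      by (rule continuous_on_compose_case_prod[OF cR(2)]) (use sub in \<open>auto intro!: continuous_intros\<close>)
    fix m \<tau> assume *: "m \<in> {\<mu> - d..c}" "\<tau> \<in> {t0 - d..min (snd (g m)) (t0 + d)}"
    show "((\<lambda>t'. R (g m) (s0, t') $ i $ k) has_real_derivative R' (g m) (s0, \<tau>) $ i $ k)
        (at \<tau> within {t0 - d..min (snd (g m)) (t0 + d)})"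
      by (rule DERIV_subset[OF derij]) (use sub[OF *] t0 in \<open>auto simp: D_def\<close>)
  qed
  \<comment> \<open>Vertex \<open>r\<close> contributes if and only if \<open>\<rho> r\<close> lies
    between \<open>e t\<close> and \<open>c\<close>. As \<open>e t\<close> stays within
    \<open>d\<close> of \<mu>, where there is no vertex, this condition does not depend on
    \<open>t\<close>, and the indicator can be differentiated as a constant.\<close>
  define on :: "'r \<Rightarrow> real" where "on r = of_bool (\<rho> r \<in> {\<mu>..c})" for r
  have on: "of_bool ((s0, t) \<in> rect (g (\<rho> r))) = (on r :: real)" if "t \<in> {t0 - d<..<t0 + d}" "r \<in> I" for t r
    using arc[OF that(1), of "\<rho> r"] \<rho>(2)[OF that(2)] that(1) by (auto simp: on_def e_def)
  have dV: "((\<lambda>t. (\<Sum>i\<in>UNIV. V i r * R (g (\<rho> r)) (s0, t) $ i $ k) * on r) has_real_derivative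
      (\<Sum>i\<in>UNIV. V i r * R' (g (\<rho> r)) (s0, t0) $ i $ k) * on r) (at t0)" if r: "r \<in> I" for r k
  proof (cases "\<rho> r \<in> {\<mu>..c}")
    case True
    then have *: "\<rho> r \<in> {p..q}" "\<mu> + d < \<rho> r" using \<rho>(2)[OF r] by auto
    then have le: "t0 + d \<le> snd (g (\<rho> r))" using e_iff[of "t0 + d" "\<rho> r"] d(1) by (auto simp: e_def)
    then have "(s0, t0) \<in> rect (g (\<rho> r))" using arc[of t0 "\<rho> r"] * True d(1) by (auto simp: e_def)
    moreover have "at t0 within {0..snd (g (\<rho> r))} = at t0"
      using le t0 d(1) by (intro at_within_interior) auto
    ultimately have "((\<lambda>t. R (g (\<rho> r)) (s0, t) $ i $ k) has_real_derivative R' (g (\<rho> r)) (s0, t0) $ i $ k) (at t0)" for i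
      using derij[OF *(1), of s0 t0 i k] by simp
    then show ?thesis by (intro DERIV_cmult_right DERIV_sum DERIV_cmult)
  qed (auto simp: on_def)
  have et0: "e t0 = \<mu>" by (simp add: e_def)
  define \<Psi> where "\<Psi> k t = (\<Sum>i\<in>UNIV. integral {e t..c} (\<lambda>m. F i m * R (g m) (s0, t) $ i $ k))
    + (\<Sum>r\<in>I. (\<Sum>i\<in>UNIV. V i r * R (g (\<rho> r)) (s0, t) $ i $ k) * on r)" for k t
  have ints: "(\<lambda>m. F i m * R (g m) (s0, t) $ i $ k) integrable_on {e t..c}" if "t \<in> {t0 - d<..<t0 + d}" for i k t
  proof -
    have et: "\<mu> - d \<le> e t" "e t \<le> c" using that cb by (auto simp: e_def)
    have "(\<lambda>m. F i m * R (g m) (s0, t) $ i $ k) absolutely_integrable_on {e t..c}"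
    proof (rule absolutely_integrable_mult_continuous)
      show "F i absolutely_integrable_on {e t..c}" by (rule set_integrable_subset[OF Fc]) (use et in auto)
      show "continuous_on {e t..c} (\<lambda>m. R (g m) (s0, t) $ i $ k)"
      proof (rule continuous_on_compose_case_prod[OF cR(1) continuous_on_id continuous_on_const])
        fix m assume "m \<in> {e t..c}"
        then show "(m, s0, t) \<in> D" using that et e_iff[of t m] cb t0 by (intro inD) auto
      qed
    qed
    then show ?thesis by (rule set_lebesgue_integral_eq_integral(1))
  qed
  have \<psi>\<Psi>: "\<psi> (s0, t) $ k = \<Psi> k t" if t: "t \<in> {t0 - d<..<t0 + d}" for k t
  proof -
    have m: "e t \<in> {\<mu> - d<..<\<mu> + d}" "g (e t) = (s0, t)" using t ge[of t] by (auto simp: e_def)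
    have "{m' \<in> {p..q}. (s0, t) \<in> rect (g m')} = {e t..c}"
    proof (intro set_eqI iffI)
      fix x assume "x \<in> {e t..c}"
      then have "x \<in> {p..q}" using m pq cb by auto
      then show "x \<in> {m' \<in> {p..q}. (s0, t) \<in> rect (g m')}" using arc[OF t] \<open>x \<in> {e t..c}\<close> by blast
    qed (use arc[OF t] in blast)
    then have "\<psi> (s0, t) $ k = integral {e t..c} (\<lambda>m'. \<Sum>i\<in>UNIV. F i m' * R (g m') (s0, t) $ i $ k)
      + (\<Sum>r\<in>I. (\<Sum>i\<in>UNIV. V i r * R (g (\<rho> r)) (s0, t) $ i $ k) * on r)"
      using \<psi>[OF m(1), of k] on[OF t] by (simp add: m(2))
    then show ?thesis using ints[OF t] by (simp add: \<Psi>_def integral_sum)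
  qed
  \<comment> \<open>All points of the curve with parameters from \<mu> to \<open>c\<close> lie on
    the vertical line through \<open>g \<mu>\<close>, so the characteristic condition on the kernel
    applies to every one of them with the same matrix \<open>B\<close>.\<close>
  have R4B: "R' (g m) (s0, t0) $ i $ j = - (\<Sum>k\<in>UNIV. R (g m) (s0, t0) $ i $ k * B $ k $ j)" if "m \<in> {\<mu>..c}" for m i j
  proof -
    have "m \<in> {p..q}" "fst (g m) = fst (g \<mu>)" "snd (g \<mu>) \<le> snd (g m)"
      using that pq cb d(1) c_iff[of m] mono[of \<mu> m] g\<mu> by auto
    from edge[OF this] show ?thesis by (simp add: g\<mu> matrix_matrix_mult_def)
  qed
  let ?J = "\<lambda>i k. integral {\<mu>..c} (\<lambda>m. F i m * R (g m) (s0, t0) $ i $ k)"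
  let ?A = "\<lambda>r k. (\<Sum>i\<in>UNIV. V i r * R (g (\<rho> r)) (s0, t0) $ i $ k) * on r"
  have t0I: "t0 \<in> {t0 - d<..<t0 + d}" using d(1) by auto
  have J: "integral {\<mu>..c} (\<lambda>m. F i m * R' (g m) (s0, t0) $ i $ j) = - (\<Sum>k\<in>UNIV. ?J i k * B $ k $ j)" for i
  proof -
    have "integral {\<mu>..c} (\<lambda>m. F i m * R' (g m) (s0, t0) $ i $ j)
      = integral {\<mu>..c} (\<lambda>m. - (\<Sum>k\<in>UNIV. (F i m * R (g m) (s0, t0) $ i $ k) * B $ k $ j))"
      by (intro integral_cong) (simp add: R4B sum_distrib_left mult.assoc)
    also have "\<dots> = - (\<Sum>k\<in>UNIV. ?J i k * B $ k $ j)"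
      using ints[OF t0I, of i] unfolding et0 by (simp add: integral_sum integrable_on_mult_left)
    finally show ?thesis .
  qed
  have A: "(\<Sum>i\<in>UNIV. V i r * R' (g (\<rho> r)) (s0, t0) $ i $ j) * on r = - (\<Sum>k\<in>UNIV. ?A r k * B $ k $ j)" for r
  proof (cases "\<rho> r \<in> {\<mu>..c}")
    case True
    have "(\<Sum>i\<in>UNIV. V i r * (\<Sum>k\<in>UNIV. R (g (\<rho> r)) (s0, t0) $ i $ k * B $ k $ j))
      = (\<Sum>k\<in>UNIV. (\<Sum>i\<in>UNIV. V i r * R (g (\<rho> r)) (s0, t0) $ i $ k) * B $ k $ j)"
      by (simp add: sum_distrib_left sum_distrib_right mult.assoc) (rule sum.swap)
    then show ?thesis using True by (simp add: R4B on_def sum_negf)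
  qed (auto simp: on_def)
  have \<Psi>0: "\<Psi> k t0 = (\<Sum>i\<in>UNIV. ?J i k) + (\<Sum>r\<in>I. ?A r k)" for k by (simp add: \<Psi>_def et0)
  have diag': "(\<Sum>i\<in>UNIV. F i \<mu> * R (g \<mu>) (s0, t0) $ i $ j) = F j \<mu>"
    using diag by (simp add: g\<mu> mat_def if_distrib cong: if_cong)
  have "(\<Psi> j has_real_derivative
     (\<Sum>i\<in>UNIV. integral {e t0..c} (\<lambda>m. F i m * R' (g m) (s0, t0) $ i $ j) - 1 * (F i (e t0) * R (g (e t0)) (s0, t0) $ i $ j))
     + (\<Sum>r\<in>I. (\<Sum>i\<in>UNIV. V i r * R' (g (\<rho> r)) (s0, t0) $ i $ j) * on r)) (at t0)"
    unfolding \<Psi>_def by (intro DERIV_add DERIV_sum dI dV)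
  also have "(\<Sum>i\<in>UNIV. integral {e t0..c} (\<lambda>m. F i m * R' (g m) (s0, t0) $ i $ j) - 1 * (F i (e t0) * R (g (e t0)) (s0, t0) $ i $ j))
     + (\<Sum>r\<in>I. (\<Sum>i\<in>UNIV. V i r * R' (g (\<rho> r)) (s0, t0) $ i $ j) * on r)
    = - F j \<mu> - (\<Sum>i\<in>UNIV. \<Sum>k\<in>UNIV. ?J i k * B $ k $ j) - (\<Sum>r\<in>I. \<Sum>k\<in>UNIV. ?A r k * B $ k $ j)"
    unfolding et0 J A by (simp add: sum_subtractf diag' sum_negf)
  also have "\<dots> = - F j \<mu> - (\<Sum>k\<in>UNIV. \<Psi> k t0 * B $ k $ j)"
  proof -
    have "(\<Sum>i\<in>UNIV. \<Sum>k\<in>UNIV. ?J i k * B $ k $ j) = (\<Sum>k\<in>UNIV. (\<Sum>i\<in>UNIV. ?J i k) * B $ k $ j)"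
      unfolding sum_distrib_right by (rule sum.swap)
    moreover have "(\<Sum>r\<in>I. \<Sum>k\<in>UNIV. ?A r k * B $ k $ j) = (\<Sum>k\<in>UNIV. (\<Sum>r\<in>I. ?A r k) * B $ k $ j)"
      unfolding sum_distrib_right[of _ I] by (rule sum.swap)
    ultimately show ?thesis unfolding \<Psi>0 by (simp add: ring_distribs sum.distrib)
  qed
  finally have "(\<Psi> j has_real_derivative - F j \<mu> - (\<Sum>k\<in>UNIV. \<Psi> k t0 * B $ k $ j)) (at (t0 + (\<mu> - \<mu>)))" by simp
  then have "((\<lambda>m. \<Psi> j (t0 + (m - \<mu>))) has_real_derivative
      (- F j \<mu> - (\<Sum>k\<in>UNIV. \<Psi> k t0 * B $ k $ j)) * 1) (at \<mu>)"
    by (rule DERIV_chain2[where g = "\<lambda>m. t0 + (m - \<mu>)"]) (auto intro!: derivative_eq_intros)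
  then have "((\<lambda>m. \<psi> (g m) $ j) has_real_derivative
      (- F j \<mu> - (\<Sum>k\<in>UNIV. \<Psi> k t0 * B $ k $ j)) * 1) (at \<mu>)"
  proof (rule has_field_derivative_transform_within_open[of _ _ _ "{\<mu> - d<..<\<mu> + d}"])
    fix m assume "m \<in> {\<mu> - d<..<\<mu> + d}"
    then show "\<Psi> j (t0 + (m - \<mu>)) = \<psi> (g m) $ j"
      using flat'[of m] \<psi>\<Psi>[of "t0 + (m - \<mu>)" j] by auto
  qed (use d(1) in auto)
  then show ?thesis using \<psi>\<Psi>[OF t0I] by (simp add: g\<mu>)
qed

section \<open>Regularity of the coefficients\<close>

text \<open>Fixing all slots but one is composition with an affine injection. So
  \<open>partial\<close> and \<open>jacobian\<close>, which see a single slot, are values of one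
  joint derivative, whose continuity and differentiability along the state are known.\<close>

lemma slot_derivatives:
  fixes \<Phi> :: "'a::real_normed_vector \<Rightarrow> 'b::real_normed_vector \<Rightarrow> 'c::real_normed_vector \<Rightarrow>
    'd::real_normed_vector \<Rightarrow> 'e::real_normed_vector \<Rightarrow> 'f::real_normed_vector"
  assumes D: "((\<lambda>(z, y, p, q, v). \<Phi> z y p q v) has_derivative D) (at (z, y, p, q, v))"
  shows "((\<lambda>y. \<Phi> z y p q v) has_derivative (\<lambda>h. D (0, h, 0, 0, 0))) (at y)"
    and "((\<lambda>p. \<Phi> z y p q v) has_derivative (\<lambda>h. D (0, 0, h, 0, 0))) (at p)"
    and "((\<lambda>q. \<Phi> z y p q v) has_derivative (\<lambda>h. D (0, 0, 0, h, 0))) (at q)"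
proof -
  show "((\<lambda>y. \<Phi> z y p q v) has_derivative (\<lambda>h. D (0, h, 0, 0, 0))) (at y)"
    using has_derivative_compose[where f = "\<lambda>y. (z, y, p, q, v)" and s = UNIV, OF _ D, of "\<lambda>h. (0, h, 0, 0, 0)"]
    by (simp add: has_derivative_Pair has_derivative_ident)
  show "((\<lambda>p. \<Phi> z y p q v) has_derivative (\<lambda>h. D (0, 0, h, 0, 0))) (at p)"
    using has_derivative_compose[where f = "\<lambda>p. (z, y, p, q, v)" and s = UNIV, OF _ D, of "\<lambda>h. (0, 0, h, 0, 0)"]
    by (simp add: has_derivative_Pair has_derivative_ident)
  show "((\<lambda>q. \<Phi> z y p q v) has_derivative (\<lambda>h. D (0, 0, 0, h, 0))) (at q)"
    using has_derivative_compose[where f = "\<lambda>q. (z, y, p, q, v)" and s = UNIV, OF _ D, of "\<lambda>h. (0, 0, 0, h, 0)"]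
    by (simp add: has_derivative_Pair has_derivative_ident)
qed

lemma slot_derivatives3:
  fixes \<Phi> :: "'a::real_normed_vector \<Rightarrow> 'b::real_normed_vector \<Rightarrow> 'c::real_normed_vector \<Rightarrow> 'f::real_normed_vector"
  assumes D: "((\<lambda>(z, y, \<eta>). \<Phi> z y \<eta>) has_derivative D) (at (z, y, \<eta>))"
  shows "((\<lambda>y. \<Phi> z y \<eta>) has_derivative (\<lambda>h. D (0, h, 0))) (at y)"
    and "((\<lambda>\<eta>. \<Phi> z y \<eta>) has_derivative (\<lambda>h. D (0, 0, h))) (at \<eta>)"
proof -
  show "((\<lambda>y. \<Phi> z y \<eta>) has_derivative (\<lambda>h. D (0, h, 0))) (at y)"
    using has_derivative_compose[where f = "\<lambda>y. (z, y, \<eta>)" and s = UNIV, OF _ D, of "\<lambda>h. (0, h, 0)"]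
    by (simp add: has_derivative_Pair has_derivative_ident)
  show "((\<lambda>\<eta>. \<Phi> z y \<eta>) has_derivative (\<lambda>h. D (0, 0, h))) (at \<eta>)"
    using has_derivative_compose[where f = "\<lambda>\<eta>. (z, y, \<eta>)" and s = UNIV, OF _ D, of "\<lambda>h. (0, 0, h)"]
    by (simp add: has_derivative_Pair has_derivative_ident)
qed

lemma partial_eq: "(\<phi> has_derivative D) (at v) \<Longrightarrow> partial i \<phi> v = D (axis i 1)"
  unfolding partial_def by (simp add: frechet_derivative_at[symmetric])

lemma jacobian_eq: "(\<phi> has_derivative D) (at v) \<Longrightarrow> jacobian \<phi> (at v) $ k $ j = D (axis j 1) $ k"
  unfolding jacobian_def by (simp add: frechet_derivative_at[symmetric] matrix_def)

section \<open>Chain rules on the closed region and along curves in it\<close>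

lemma has_partials_continuous:
  "has_partials G \<phi> \<phi>s \<phi>t \<Longrightarrow> continuous_on G \<phi>"
  unfolding has_partials_def by (meson continuous_on_eq_continuous_within has_derivative_continuous)

lemma has_partials_id: "has_partials G (\<lambda>z. z) (\<lambda>_. (1, 0)) (\<lambda>_. (0, 1))"
  unfolding has_partials_def
  by (auto intro!: continuous_intros has_derivative_eq_rhs[OF has_derivative_ident])

lemma has_partials_Pair:
  assumes "has_partials G \<phi> \<phi>s \<phi>t" "has_partials G \<rho> \<rho>s \<rho>t"
  shows "has_partials G (\<lambda>z. (\<phi> z, \<rho> z)) (\<lambda>z. (\<phi>s z, \<rho>s z)) (\<lambda>z. (\<phi>t z, \<rho>t z))"
  using assms unfolding has_partials_def
  by (auto intro!: continuous_on_Pair has_derivative_eq_rhs[OF has_derivative_Pair])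

lemma has_partials_bounded_linear:
  assumes "bounded_linear l" "has_partials G \<phi> \<phi>s \<phi>t"
  shows "has_partials G (\<lambda>z. l (\<phi> z)) (\<lambda>z. l (\<phi>s z)) (\<lambda>z. l (\<phi>t z))"
  using assms(2) unfolding has_partials_def
  by (auto intro!: bounded_linear.continuous_on[OF assms(1)]
      has_derivative_eq_rhs[OF bounded_linear.has_derivative[OF assms(1)]]
      simp: linear_add[OF bounded_linear.linear[OF assms(1)]] linear_scale[OF bounded_linear.linear[OF assms(1)]])

lemma has_partials_compose:
  assumes h: "continuous_on \<Omega> h'" "\<And>v. v \<in> \<Omega> \<Longrightarrow> (h has_derivative blinfun_apply (h' v)) (at v)"
    and \<phi>: "has_partials G \<phi> \<phi>s \<phi>t" "\<phi> ` G \<subseteq> \<Omega>"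
  shows "has_partials G (\<lambda>z. h (\<phi> z)) (\<lambda>z. h' (\<phi> z) (\<phi>s z)) (\<lambda>z. h' (\<phi> z) (\<phi>t z))"
  unfolding has_partials_def
proof (intro conjI ballI)
  have "continuous_on G (\<lambda>z. h' (\<phi> z))"
    by (rule continuous_on_compose2[OF h(1) has_partials_continuous[OF \<phi>(1)] \<phi>(2)])
  then show "continuous_on G (\<lambda>z. h' (\<phi> z) (\<phi>s z))" "continuous_on G (\<lambda>z. h' (\<phi> z) (\<phi>t z))"
    using \<phi>(1) unfolding has_partials_def by (auto intro!: blinfun.continuous_on)
  fix z assume z: "z \<in> G"
  have "(\<phi> has_derivative (\<lambda>(a, b). a *\<^sub>R \<phi>s z + b *\<^sub>R \<phi>t z)) (at z within G)"
    using \<phi>(1) z unfolding has_partials_def by blast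
  from has_derivative_compose[OF this h(2)]
  show "((\<lambda>z. h (\<phi> z)) has_derivative (\<lambda>(a, b). a *\<^sub>R h' (\<phi> z) (\<phi>s z) + b *\<^sub>R h' (\<phi> z) (\<phi>t z))) (at z within G)"
    using \<phi>(2) z by (auto simp: case_prod_unfold blinfun.add_right blinfun.scaleR_right)
qed

text \<open>The derivative of \<phi> exists only within \<open>G\<close>. It can be restricted to
  the image of the curve because the curve stays in \<open>G\<close>, which also covers curves
  running in the boundary.\<close>

lemma has_partials_along:
  assumes \<phi>: "has_partials G \<phi> \<phi>s \<phi>t" and g: "(g has_vector_derivative g') (at m within I)" "g ` I \<subseteq> G" "m \<in> I"
  shows "((\<lambda>m. \<phi> (g m)) has_vector_derivative fst g' *\<^sub>R \<phi>s (g m) + snd g' *\<^sub>R \<phi>t (g m)) (at m within I)"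
proof -
  have "(\<phi> has_derivative (\<lambda>(a, b). a *\<^sub>R \<phi>s (g m) + b *\<^sub>R \<phi>t (g m))) (at (g m) within G)"
    using \<phi> g unfolding has_partials_def by blast
  then have "(\<phi> has_derivative (\<lambda>(a, b). a *\<^sub>R \<phi>s (g m) + b *\<^sub>R \<phi>t (g m))) (at (g m) within g ` I)"
    using g(2) by (rule has_derivative_subset)
  from has_derivative_in_compose[OF g(1)[unfolded has_vector_derivative_def] this]
  show ?thesis unfolding has_vector_derivative_def by (simp add: case_prod_unfold scaleR_add_right)
qed

lemma C1_curve_compose:
  assumes h: "continuous_on \<Omega> h'" "\<And>v. v \<in> \<Omega> \<Longrightarrow> (h has_derivative blinfun_apply (h' v)) (at v)"
    and Y: "continuous_on I Y'" "\<And>m. m \<in> I \<Longrightarrow> (Y has_vector_derivative Y' m) (at m within I)" "Y ` I \<subseteq> \<Omega>"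
  shows "continuous_on I (\<lambda>m. h' (Y m) (Y' m))"
    "\<And>m. m \<in> I \<Longrightarrow> ((\<lambda>m. h (Y m)) has_vector_derivative h' (Y m) (Y' m)) (at m within I)"
proof -
  have cY: "continuous_on I Y"
    using Y(2) by (meson continuous_on_eq_continuous_within has_vector_derivative_continuous)
  show "continuous_on I (\<lambda>m. h' (Y m) (Y' m))"
    by (intro blinfun.continuous_on continuous_on_compose2[OF h(1) cY Y(3)] Y(1))
  fix m assume m: "m \<in> I"
  show "((\<lambda>m. h (Y m)) has_vector_derivative h' (Y m) (Y' m)) (at m within I)"
    using has_derivative_compose[OF Y(2)[OF m, unfolded has_vector_derivative_def] h(2)] Y(3) m
    unfolding has_vector_derivative_def by (auto simp: blinfun.scaleR_right)
qed

lemma C2_nearE: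
  assumes "C2_near S h"
  obtains \<Omega> h' h'' where "S \<subseteq> \<Omega>" "continuous_on \<Omega> h'" "continuous_on \<Omega> h''"
    "\<And>v. v \<in> \<Omega> \<Longrightarrow> (h has_derivative blinfun_apply (h' v)) (at v)"
    "\<And>v. v \<in> \<Omega> \<Longrightarrow> (h' has_derivative blinfun_apply (h'' v)) (at v)"
proof -
  obtain \<Omega> h' h'' where 1: "S \<subseteq> \<Omega>" "continuous_on \<Omega> h''"
    "\<forall>v\<in>\<Omega>. (h has_derivative blinfun_apply (h' v)) (at v)"
    "\<forall>v\<in>\<Omega>. (h' has_derivative blinfun_apply (h'' v)) (at v)"
    using assms unfolding C2_near_def C2_on_def C1_on_def by blast
  have "continuous_on \<Omega> h'"
    using 1(4) by (meson continuous_at_imp_continuous_on has_derivative_continuous)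
  then show ?thesis using that 1 by blast
qed

text \<open>\<open>vector_derivative\<close> within a set is determined only at points that are not
  isolated in it. A left interval is enough, and the slices of \<open>G\<close> contain one: from
  the axis up to the point.\<close>

lemma at_within_right_end_nontrivial:
  fixes r :: real
  assumes "0 < r" "{0..r} \<subseteq> I"
  shows "at r within I \<noteq> bot"
proof -
  have "at r within {0..r} \<noteq> bot" using assms(1) by (simp add: trivial_limit_within islimpt_Icc)
  then show ?thesis using at_le[OF assms(2), of r] by (metis bot.extremum_uniqueI)
qed

lemma D_s_eq:
  fixes \<phi> :: "point \<Rightarrow> real"
  assumes \<phi>: "has_partials G \<phi> \<phi>s \<phi>t" and z: "z \<in> G" and slice: "0 < fst z" "rect z \<subseteq> G" "0 \<le> snd z"
  shows "D_s G \<phi> z = \<phi>s z"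
proof -
  let ?I = "{s. (s, snd z) \<in> G}"
  have sub: "{0..fst z} \<subseteq> ?I" using slice by (auto simp: mem_rect)
  have "((\<lambda>s. (s, snd z)) has_vector_derivative (1, 0)) (at (fst z) within ?I)"
    by (auto intro!: derivative_eq_intros)
  from has_partials_along[OF \<phi> this] z
  have "((\<lambda>s. \<phi> (s, snd z)) has_vector_derivative \<phi>s z) (at (fst z) within ?I)" by auto
  moreover have "at (fst z) within ?I \<noteq> bot"
    using slice(1) sub by (rule at_within_right_end_nontrivial)
  ultimately show ?thesis unfolding D_s_def by (rule vector_derivative_within[rotated])
qed

lemma D_t_eq:
  fixes \<phi> :: "point \<Rightarrow> real"
  assumes \<phi>: "has_partials G \<phi> \<phi>s \<phi>t" and z: "z \<in> G" and slice: "0 < snd z" "rect z \<subseteq> G" "0 \<le> fst z"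
  shows "D_t G \<phi> z = \<phi>t z"
proof -
  let ?I = "{t. (fst z, t) \<in> G}"
  have sub: "{0..snd z} \<subseteq> ?I" using slice by (auto simp: mem_rect)
  have "((\<lambda>t. (fst z, t)) has_vector_derivative (0, 1)) (at (snd z) within ?I)"
    by (auto intro!: derivative_eq_intros)
  from has_partials_along[OF \<phi> this] z
  have "((\<lambda>t. \<phi> (fst z, t)) has_vector_derivative \<phi>t z) (at (snd z) within ?I)" by auto
  moreover have "at (snd z) within ?I \<noteq> bot"
    using slice(1) sub by (rule at_within_right_end_nontrivial)
  ultimately show ?thesis unfolding D_t_def by (rule vector_derivative_within[rotated])
qed

text \<open>The axes are excluded because the slices through the two tips of \<open>G\<close> may be single points, where
  \<open>D_s\<close> and \<open>D_t\<close> have no meaningful value.\<close>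

lemma F_area_continuous_version:
  fixes \<Phi> :: "point \<Rightarrow> real^'n \<Rightarrow> real^'n \<Rightarrow> real^'n \<Rightarrow> real^'m \<Rightarrow> real"
  assumes \<Phi>: "C2_near (G \<times> UNIV \<times> UNIV \<times> UNIV \<times> U) (\<lambda>(z, y, p, q, v). \<Phi> z y p q v)"
    and u: "\<And>z. z \<in> G \<Longrightarrow> u z \<in> U" "has_partials G u us ut"
    and x: "has_partials G x xs xt" "has_partials G xs xss xst" "has_partials G xt xst xtt"
    and G: "\<And>z. z \<in> G \<Longrightarrow> 0 \<le> fst z \<and> 0 \<le> snd z \<and> rect z \<subseteq> G"
  obtains Fa where "\<And>i. continuous_on G (Fa i)"
    "\<And>i z. z \<in> G \<Longrightarrow> 0 < fst z \<Longrightarrow> 0 < snd z \<Longrightarrow> F_area G \<Phi> u x xs xt i z = Fa i z"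
proof -
  obtain \<Omega> h' h'' where h: "G \<times> UNIV \<times> UNIV \<times> UNIV \<times> U \<subseteq> \<Omega>" "continuous_on \<Omega> h'" "continuous_on \<Omega> h''"
    "\<And>v. v \<in> \<Omega> \<Longrightarrow> ((\<lambda>(z, y, p, q, v). \<Phi> z y p q v) has_derivative blinfun_apply (h' v)) (at v)"
    "\<And>v. v \<in> \<Omega> \<Longrightarrow> (h' has_derivative blinfun_apply (h'' v)) (at v)"
    using C2_nearE[OF \<Phi>] by metis
  define P where "P z = (z, x z, xs z, xt z, u z)" for z
  define Ps where "Ps z = ((1, 0) :: point, xs z, xss z, xst z, us z)" for z
  define Pt where "Pt z = ((0, 1) :: point, xt z, xst z, xtt z, ut z)" for z
  have P: "has_partials G P Ps Pt"
    unfolding P_def Ps_def Pt_def by (intro has_partials_Pair has_partials_id x u)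
  have P\<Omega>: "P ` G \<subseteq> \<Omega>" using h(1) u(1) by (auto simp: P_def)
  have hP: "has_partials G (\<lambda>z. h' (P z) e) (\<lambda>z. h'' (P z) (Ps z) e) (\<lambda>z. h'' (P z) (Pt z) e)" for e
    by (rule has_partials_bounded_linear[OF blinfun.bounded_linear_left has_partials_compose[OF h(3,5) P P\<Omega>]])
  have slots: "partial i (\<lambda>y. \<Phi> z y (xs z) (xt z) (u z)) (x z) = h' (P z) (0, axis i 1, 0, 0, 0)"
    "partial i (\<lambda>p. \<Phi> z (x z) p (xt z) (u z)) (xs z) = h' (P z) (0, 0, axis i 1, 0, 0)"
    "partial i (\<lambda>q. \<Phi> z (x z) (xs z) q (u z)) (xt z) = h' (P z) (0, 0, 0, axis i 1, 0)" if "z \<in> G" for i z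
    using P\<Omega> that slot_derivatives[OF h(4)[of "P z", unfolded P_def]] unfolding P_def
    by (auto intro!: partial_eq)
  \<comment> \<open>\<open>F_area\<close> with both total derivatives expanded by the chain rule.
    The expansion makes sense and is continuous on all of \<open>G\<close>, including the
    axes.\<close>
  define Fa where "Fa i z = h' (P z) (0, axis i 1, 0, 0, 0) - h'' (P z) (Ps z) (0, 0, axis i 1, 0, 0)
    - h'' (P z) (Pt z) (0, 0, 0, axis i 1, 0)" for i z
  show ?thesis
  proof (rule that[of Fa])
    fix i
    show "continuous_on G (Fa i)"
      using hP has_partials_continuous[OF hP]
      unfolding Fa_def has_partials_def by (intro continuous_on_diff) blast+
    fix z assume z: "z \<in> G" "0 < fst z" "0 < snd z"
    \<comment> \<open>The composite functions are known to agree on \<open>G\<close> only; that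
      suffices, because the derivative is taken within the slice of \<open>G\<close>.\<close>
    have D_s_cong: "D_s G \<phi> z = D_s G \<rho> z" if "\<And>z. z \<in> G \<Longrightarrow> \<phi> z = \<rho> z" for \<phi> \<rho>
      unfolding D_s_def vector_derivative_def
      by (intro arg_cong[of _ _ Eps] ext has_vector_derivative_cong_ev) (use z that in auto)
    have D_t_cong: "D_t G \<phi> z = D_t G \<rho> z" if "\<And>z. z \<in> G \<Longrightarrow> \<phi> z = \<rho> z" for \<phi> \<rho>
      unfolding D_t_def vector_derivative_def
      by (intro arg_cong[of _ _ Eps] ext has_vector_derivative_cong_ev) (use z that in auto)
    have "D_s G (\<lambda>w. partial i (\<lambda>p. \<Phi> w (x w) p (xt w) (u w)) (xs w)) z
        = D_s G (\<lambda>w. h' (P w) (0, 0, axis i 1, 0, 0)) z"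
      by (rule D_s_cong) (rule slots(2))
    moreover have "D_t G (\<lambda>w. partial i (\<lambda>q. \<Phi> w (x w) (xs w) q (u w)) (xt w)) z
        = D_t G (\<lambda>w. h' (P w) (0, 0, 0, axis i 1, 0)) z"
      by (rule D_t_cong) (rule slots(3))
    ultimately show "F_area G \<Phi> u x xs xt i z = Fa i z"
      unfolding F_area_def slots(1)[OF z(1)] Fa_def
      using D_s_eq[OF hP z(1,2)] D_t_eq[OF hP z(1,3)] G[OF z(1)] by simp
  qed
qed

text \<open>The term D/D\<mu> of the \<eta>-derivative of \<open>\<Phi>1\<close> differentiates
  x_\<mu>, hence the tangent, so it involves \<open>g''\<close> and the second partial derivatives
  of the state; all of them are continuous up to the ends of a smooth piece. The identification with
  \<open>F_curve\<close> is confined to the open piece, where the two-sided derivatives in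
  \<open>n1\<close>, \<open>n2\<close> and \<open>deriv\<close> agree with the one-sided
  ones.\<close>

lemma F_curve_piece:
  fixes \<Phi> :: "point \<Rightarrow> real^'n \<Rightarrow> real^'n \<Rightarrow> real^'n \<Rightarrow> real^'m \<Rightarrow> real"
    and \<Phi>1 :: "point \<Rightarrow> real^'n \<Rightarrow> real^'n \<Rightarrow> real" and g g' g'' :: "real \<Rightarrow> point"
  defines "I \<equiv> \<lambda>c d. {c..d::real}"
  assumes \<Phi>: "C2_near (G \<times> UNIV \<times> UNIV \<times> UNIV \<times> U) (\<lambda>(z, y, p, q, v). \<Phi> z y p q v)"
    and \<Phi>1: "C2_near (\<Gamma> \<times> UNIV \<times> UNIV) (\<lambda>(z, y, \<eta>). \<Phi>1 z y \<eta>)"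
    and u: "\<And>z. z \<in> G \<Longrightarrow> u z \<in> U" "has_partials G u us ut"
    and x: "has_partials G x xs xt" "has_partials G xs xss xst" "has_partials G xt xst xtt"
    and g: "\<And>m. m \<in> I c d \<Longrightarrow> (g has_vector_derivative g' m) (at m within I c d)"
      "\<And>m. m \<in> I c d \<Longrightarrow> (g' has_vector_derivative g'' m) (at m within I c d)"
      "continuous_on (I c d) g''" "g ` I c d \<subseteq> G" "g ` I c d \<subseteq> \<Gamma>"
  obtains Fc where "\<And>i. continuous_on (I c d) (Fc i)"
    "\<And>i m. m \<in> {c<..<d} \<Longrightarrow> F_curve g \<Phi> \<Phi>1 u x xs xt i m = Fc i m"
proof -
  let ?I = "I c d"
  obtain \<Omega> h' h'' where h: "G \<times> UNIV \<times> UNIV \<times> UNIV \<times> U \<subseteq> \<Omega>" "continuous_on \<Omega> h'" "continuous_on \<Omega> h''"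
    "\<And>v. v \<in> \<Omega> \<Longrightarrow> ((\<lambda>(z, y, p, q, v). \<Phi> z y p q v) has_derivative blinfun_apply (h' v)) (at v)"
    "\<And>v. v \<in> \<Omega> \<Longrightarrow> (h' has_derivative blinfun_apply (h'' v)) (at v)"
    using C2_nearE[OF \<Phi>] by metis
  obtain \<Omega>1 k' k'' where k: "\<Gamma> \<times> UNIV \<times> UNIV \<subseteq> \<Omega>1" "continuous_on \<Omega>1 k'" "continuous_on \<Omega>1 k''"
    "\<And>v. v \<in> \<Omega>1 \<Longrightarrow> ((\<lambda>(z, y, \<eta>). \<Phi>1 z y \<eta>) has_derivative blinfun_apply (k' v)) (at v)"
    "\<And>v. v \<in> \<Omega>1 \<Longrightarrow> (k' has_derivative blinfun_apply (k'' v)) (at v)"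
    using C2_nearE[OF \<Phi>1] by metis
  have cont: "continuous_on ?I q" if "\<And>m. m \<in> ?I \<Longrightarrow> (q has_vector_derivative q' m) (at m within ?I)"
    for q :: "real \<Rightarrow> 'z::real_normed_vector" and q'
    using that by (meson continuous_on_eq_continuous_within has_vector_derivative_continuous)
  have cg: "continuous_on ?I g" "continuous_on ?I g'" by (rule cont, rule g, assumption)+
  have cxs: "continuous_on ?I (\<lambda>m. \<phi> (g m))" if "continuous_on G \<phi>" for \<phi> :: "point \<Rightarrow> 'z::real_normed_vector"
    by (rule continuous_on_compose2[OF that cg(1) g(4)])
  have cx: "continuous_on G x" "continuous_on G xs" "continuous_on G xt" "continuous_on G u"
    "continuous_on G xss" "continuous_on G xst" "continuous_on G xtt"
    using x u(2) has_partials_continuous[OF x(1)] has_partials_continuous[OF u(2)]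
    unfolding has_partials_def by auto
  note al = has_partials_along[OF _ g(1) g(4)]
  define Y where "Y m = (g m, x (g m), fst (g' m) *\<^sub>R xs (g m) + snd (g' m) *\<^sub>R xt (g m))" for m
  \<comment> \<open>Derivative of the argument of \<open>\<Phi>1\<close>. The last component is the
    product rule for x_\<mu>; its terms with \<open>g''\<close> express the curvature.\<close>
  define Y' where "Y' m = (g' m, fst (g' m) *\<^sub>R xs (g m) + snd (g' m) *\<^sub>R xt (g m),
      (fst (g' m) *\<^sub>R (fst (g' m) *\<^sub>R xss (g m) + snd (g' m) *\<^sub>R xst (g m)) + fst (g'' m) *\<^sub>R xs (g m))
      + (snd (g' m) *\<^sub>R (fst (g' m) *\<^sub>R xst (g m) + snd (g' m) *\<^sub>R xtt (g m)) + snd (g'' m) *\<^sub>R xt (g m)))" for m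
  have dY: "(Y has_vector_derivative Y' m) (at m within ?I)" if m: "m \<in> ?I" for m
    unfolding Y_def Y'_def
    by (intro has_vector_derivative_Pair has_vector_derivative_add g m al x
        bounded_bilinear.has_vector_derivative[OF bounded_bilinear_scaleR]
        bounded_linear.has_vector_derivative[OF bounded_linear_fst]
        bounded_linear.has_vector_derivative[OF bounded_linear_snd])
  have cY': "continuous_on ?I Y'" unfolding Y'_def
    by (intro continuous_intros cg g(3) cxs cx)
  have Y\<Omega>: "Y ` ?I \<subseteq> \<Omega>1" using k(1) g(5) by (auto simp: Y_def)
  define Q where "Q i m = k' (Y m) (0, 0, axis i 1)" for i m
  define Q' where "Q' i m = k'' (Y m) (Y' m) (0, 0, axis i 1)" for i m
  have dQ: "(Q i has_vector_derivative Q' i m) (at m within ?I)" if "m \<in> ?I" for i m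
    unfolding Q_def Q'_def
    by (intro bounded_linear.has_vector_derivative[OF blinfun.bounded_linear_left]
        C1_curve_compose(2)[OF k(3,5) cY' dY Y\<Omega>] that)
  have cQ': "continuous_on ?I (Q' i)" for i
    unfolding Q'_def by (intro blinfun.continuous_on C1_curve_compose(1)[OF k(3,5) cY' dY Y\<Omega>] continuous_on_const)
  define P where "P m = (g m, x (g m), xs (g m), xt (g m), u (g m))" for m
  have cP: "continuous_on ?I P" unfolding P_def by (intro continuous_on_Pair cg cxs cx)
  have P\<Omega>: "P ` ?I \<subseteq> \<Omega>"
  proof (rule image_subsetI)
    fix m assume "m \<in> ?I"
    then have "g m \<in> G" using g(4) by blast
    then have "P m \<in> G \<times> UNIV \<times> UNIV \<times> UNIV \<times> U" using u(1) by (simp add: P_def)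
    then show "P m \<in> \<Omega>" by (rule subsetD[OF h(1)])
  qed
  define Fc where "Fc i m = snd (g' m) * h' (P m) (0, 0, axis i 1, 0, 0) + - fst (g' m) * h' (P m) (0, 0, 0, axis i 1, 0)
     + k' (Y m) (0, axis i 1, 0) - Q' i m" for i m
  show ?thesis
  proof (rule that[of Fc])
    fix i
    show "continuous_on ?I (Fc i)"
      unfolding Fc_def
      by (intro continuous_intros cg cQ' blinfun.continuous_on continuous_on_compose2[OF h(2) cP P\<Omega>]
          continuous_on_compose2[OF k(2) cont[OF dY] Y\<Omega>])
    fix m assume m: "m \<in> {c<..<d}"
    have int: "at m within ?I = at m" if "m \<in> {c<..<d}" for m
      using that unfolding I_def by (intro at_within_interior) auto
    have mI: "m \<in> ?I" if "m \<in> {c<..<d}" for m using that by (auto simp: I_def)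
    have n: "n1 g m = snd (g' m)" "n2 g m = - fst (g' m)" if "m \<in> {c<..<d}" for m
      using vector_derivative_at[of g "g' m" m] g(1)[OF mI[OF that]] int[OF that] by (auto simp: n1_def n2_def)
    have xmu: "x_mu g xs xt m = fst (g' m) *\<^sub>R xs (g m) + snd (g' m) *\<^sub>R xt (g m)" if "m \<in> {c<..<d}" for m
      using n[OF that] by (simp add: x_mu_def)
    have Ym: "Y m = (g m, x (g m), x_mu g xs xt m)" if "m \<in> {c<..<d}" for m
      using xmu[OF that] by (simp add: Y_def)
    have dk: "((\<lambda>(z, y, \<eta>). \<Phi>1 z y \<eta>) has_derivative k' (Y m)) (at (g m, x (g m), x_mu g xs xt m))" if "m \<in> {c<..<d}" for m
      using k(4)[of "Y m"] Y\<Omega> mI[OF that] Ym[OF that] by auto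
    have Pe: "Phi1_eta g \<Phi>1 x xs xt i m = Q i m" if "m \<in> {c<..<d}" for m
      unfolding Phi1_eta_def Q_def by (rule partial_eq[OF slot_derivatives3(2)[OF dk[OF that]]])
    have "(Q i has_real_derivative Q' i m) (at m)"
      using dQ[OF mI[OF m], of i] int[OF m] by (simp add: has_real_derivative_iff_has_vector_derivative)
    then have "(Phi1_eta g \<Phi>1 x xs xt i has_real_derivative Q' i m) (at m)"
      by (rule has_field_derivative_transform_within_open[of _ _ _ "{c<..<d}"]) (use m Pe in auto)
    then have dv: "deriv (Phi1_eta g \<Phi>1 x xs xt i) m = Q' i m" by (rule DERIV_imp_deriv)
    have "((\<lambda>(z, y, p, q, v). \<Phi> z y p q v) has_derivative h' (P m)) (at (g m, x (g m), xs (g m), xt (g m), u (g m)))"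
      using h(4)[of "P m"] P\<Omega> mI[OF m] by (auto simp: P_def)
    note sl = slot_derivatives[OF this]
    show "F_curve g \<Phi> \<Phi>1 u x xs xt i m = Fc i m"
      unfolding F_curve_def Let_def Fc_def dv n[OF m] Phi1_x_def
        partial_eq[OF sl(2)] partial_eq[OF sl(3)] partial_eq[OF slot_derivatives3(1)[OF dk[OF m]]] ..
  qed
qed

section \<open>Properties of the boundary curve and of the region below it\<close>

lemma boundary_curveD:
  assumes "boundary_curve a b L g N \<nu>"
  shows "0 < L" "continuous_on {0..L} g" "g 0 = (a, 0)" "g L = (0, b)"
    "\<And>m. m \<in> {0<..<L} \<Longrightarrow> 0 < fst (g m) \<and> 0 < snd (g m)"
    "\<And>m n. 0 \<le> m \<Longrightarrow> m \<le> n \<Longrightarrow> n \<le> L \<Longrightarrow> fst (g n) \<le> fst (g m) \<and> snd (g m) \<le> snd (g n)"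
    "\<And>m. m \<in> {0..L} \<Longrightarrow> 0 \<le> fst (g m) \<and> 0 \<le> snd (g m)"
    "\<nu> 0 = 0" "\<nu> (Suc N) = L" "\<And>r s. r < s \<Longrightarrow> s \<le> Suc N \<Longrightarrow> \<nu> r < \<nu> s"
proof -
  note d = assms[unfolded boundary_curve_def]
  show "0 < L" "continuous_on {0..L} g" "g 0 = (a, 0)" "g L = (0, b)" "\<nu> 0 = 0" "\<nu> (Suc N) = L"
    "\<And>m. m \<in> {0<..<L} \<Longrightarrow> 0 < fst (g m) \<and> 0 < snd (g m)"
    using d by auto
  show "fst (g n) \<le> fst (g m) \<and> snd (g m) \<le> snd (g n)" if "0 \<le> m" "m \<le> n" "n \<le> L" for m n
    using d that unfolding monotone_on_def by auto
  show "0 \<le> fst (g m) \<and> 0 \<le> snd (g m)" if "m \<in> {0..L}" for m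
    using d that by (cases "m = 0"; cases "m = L") (auto simp: less_le)
  show "\<nu> r < \<nu> s" if "r < s" "s \<le> Suc N" for r s
    using d that unfolding monotone_on_def by auto
qed

lemma boundary_curve_pieceE:
  assumes "boundary_curve a b L g N \<nu>" "r \<le> N"
  obtains g' g'' where "continuous_on {\<nu> r..\<nu> (Suc r)} g''"
    "\<And>m. m \<in> {\<nu> r..\<nu> (Suc r)} \<Longrightarrow> (g has_vector_derivative g' m) (at m within {\<nu> r..\<nu> (Suc r)})"
    "\<And>m. m \<in> {\<nu> r..\<nu> (Suc r)} \<Longrightarrow> (g' has_vector_derivative g'' m) (at m within {\<nu> r..\<nu> (Suc r)})"
    "\<And>m. m \<in> {\<nu> r..\<nu> (Suc r)} \<Longrightarrow> norm (g' m) = 1"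
  using assms unfolding boundary_curve_def Let_def by metis

lemma finite_partition_piece:
  fixes \<nu> :: "nat \<Rightarrow> real"
  assumes "\<nu> 0 < \<mu>" "\<mu> < \<nu> (Suc N)" "\<mu> \<notin> \<nu> ` {0..Suc N}"
  obtains r where "r \<le> N" "\<nu> r < \<mu>" "\<mu> < \<nu> (Suc r)"
proof -
  let ?P = "\<lambda>r. \<mu> < \<nu> r"
  define k where "k = (LEAST r. ?P r)"
  have k: "?P k" "k \<le> Suc N" unfolding k_def using assms(2) by (rule LeastI, rule Least_le)
  then obtain r where r: "k = Suc r" using assms(1) by (cases k) auto
  have "\<not> ?P r" using not_less_Least[of r ?P] r by (auto simp: k_def)
  moreover have "\<nu> r \<noteq> \<mu>" using assms(3) r k by auto
  ultimately show ?thesis using that[of r] r k by auto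
qed

lemma region_facts:
  assumes "continuous_on {0..L} g" "\<And>m. m \<in> {0..L} \<Longrightarrow> 0 \<le> fst (g m) \<and> 0 \<le> snd (g m)"
  shows "compact (region L g)" "g ` {0..L} \<subseteq> region L g"
    "\<And>z. z \<in> region L g \<Longrightarrow> 0 \<le> fst z \<and> 0 \<le> snd z \<and> rect z \<subseteq> region L g"
proof -
  show "compact (region L g)" unfolding region_def by (rule compact_rect_Union) (use assms in auto)
  show "g ` {0..L} \<subseteq> region L g" using assms(2) by (force simp: region_def mem_rect)
  show "0 \<le> fst z \<and> 0 \<le> snd z \<and> rect z \<subseteq> region L g" if "z \<in> region L g" for z
    using that unfolding region_def by (force simp: mem_rect)
qed

lemma absolutely_integrable_on_partition:
  fixes h :: "real \<Rightarrow> real" and \<nu> :: "nat \<Rightarrow> real"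
  assumes "\<And>r. r \<le> N \<Longrightarrow> \<nu> r \<le> \<nu> (Suc r)"
    and "\<And>r. r \<le> N \<Longrightarrow> h absolutely_integrable_on {\<nu> r..\<nu> (Suc r)}"
  shows "h absolutely_integrable_on {\<nu> 0..\<nu> (Suc N)}"
proof -
  have "\<nu> 0 \<le> \<nu> k \<and> h absolutely_integrable_on {\<nu> 0..\<nu> k}" if "k \<le> Suc N" for k
    using that
  proof (induction k)
    case 0
    have "h absolutely_integrable_on cbox (\<nu> 0) (\<nu> 0)"
      by (intro absolutely_integrable_on_null) auto
    then show ?case by simp
  next
    case (Suc k)
    then show ?case using assms[of k]
      by (auto intro: absolutely_integrable_on_combine[where c = "\<nu> k"])
  qed
  then show ?thesis by simp
qed

section \<open>Exchanging the coordinates\<close>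

lemma mem_rect_swap: "prod.swap w \<in> rect (prod.swap z) \<longleftrightarrow> w \<in> rect z"
  by (auto simp: mem_rect)

lemma bounded_linear_swap: "bounded_linear prod.swap"
  using bounded_linear_Pair[OF bounded_linear_snd bounded_linear_fst] by (simp add: prod.swap_def[abs_def])

text \<open>Exchanging the coordinates alone would turn the curve into one running from upper left
  to lower right. Reflecting the parameter restores the orientation and accounts for the minus
  sign.\<close>

lemma has_vector_derivative_swap_reflect:
  assumes "(g has_vector_derivative g') (at (- m))"
  shows "((\<lambda>m. prod.swap (g (- m))) has_vector_derivative - prod.swap g') (at m)"
proof -
  have "(uminus has_vector_derivative - 1) (at m)" by (auto intro!: derivative_eq_intros)
  then have "((\<lambda>m. g (- m)) has_vector_derivative - g') (at m)"
    using vector_diff_chain_at[of uminus "- 1" m g g'] assms by (simp add: o_def)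
  then have "((\<lambda>m. prod.swap (g (- m))) has_vector_derivative prod.swap (- g')) (at m)"
    by (rule bounded_linear.has_vector_derivative[OF bounded_linear_swap])
  then show ?thesis by (simp add: uminus_prod_def)
qed

lemma integral_reflect_Collect:
  fixes q :: "real \<Rightarrow> real"
  shows "integral {m \<in> {-b..-a}. P (- m)} (\<lambda>m. q (- m)) = integral {m \<in> {a..b}. P m} q"
proof -
  have restr: "integral {m \<in> A. P m} q = integral A (\<lambda>m. if P m then q m else 0)" for A P and q :: "real \<Rightarrow> real"
    using integral_restrict_Int[of A "{m. P m}" q] by (simp add: Int_def conj_commute)
  show ?thesis
    unfolding restr
    by (rule Henstock_Kurzweil_Integration.integral_reflect_real[where f = "\<lambda>m. if P m then q m else 0"])
qed

text \<open>The result for the derivative in t, applied to the exchanged and reversed curve. As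
  \<open>h'\<close> is the negative of the exchanged \<open>g'\<close>, the assumption
  \<open>fst (g' m) < 0\<close> becomes the positivity required of the second component, and strict
  increase of the height becomes strict decrease of the abscissa.\<close>

lemma oblique_local_derivative_s:
  fixes g g' :: "real \<Rightarrow> point" and KA KA' :: "point \<Rightarrow> point \<Rightarrow> real" and KC KC' :: "real \<Rightarrow> point \<Rightarrow> real"
    and p q \<mu> :: real and \<psi> :: "point \<Rightarrow> real"
  defines "\<Omega> \<equiv> (\<Union>m\<in>{p..q}. rect (g m))"
    and "V \<equiv> {w. fst (g q) < fst w \<and> snd (g p) < snd w \<and>
      (\<exists>m\<in>{p..q}. fst w < fst (g m) \<and> snd w < snd (g m))}"
  assumes \<mu>: "p < \<mu>" "\<mu> < q"
    and g: "\<And>m. m \<in> {p..q} \<Longrightarrow> (g has_vector_derivative g' m) (at m)" "continuous_on {p..q} g'"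
    and neg: "\<And>m. m \<in> {p..q} \<Longrightarrow> fst (g' m) < 0"
    and inc: "\<And>m n. p \<le> m \<Longrightarrow> m < n \<Longrightarrow> n \<le> q \<Longrightarrow> snd (g m) < snd (g n)"
    and nonneg: "0 \<le> fst (g q)" "0 \<le> snd (g p)"
    and KA: "continuous_on {(z, w). z \<in> \<Omega> \<and> w \<in> rect z} (\<lambda>(z, w). KA z w)"
    and KA': "continuous_on {(z, w). z \<in> \<Omega> \<and> w \<in> rect z} (\<lambda>(z, w). KA' z w)"
    and derA: "\<And>z s t. z \<in> \<Omega> \<Longrightarrow> (s, t) \<in> rect z \<Longrightarrow>
      ((\<lambda>s'. KA z (s', t)) has_real_derivative KA' z (s, t)) (at s within {0..fst z})"
    and KC: "continuous_on {(m, w). m \<in> {p..q} \<and> w \<in> rect (g m)} (\<lambda>(m, w). KC m w)"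
    and KC': "continuous_on {(m, w). m \<in> {p..q} \<and> w \<in> rect (g m)} (\<lambda>(m, w). KC' m w)"
    and derC: "\<And>m s t. m \<in> {p..q} \<Longrightarrow> (s, t) \<in> rect (g m) \<Longrightarrow>
      ((\<lambda>s'. KC m (s', t)) has_real_derivative KC' m (s, t)) (at s within {0..fst (g m)})"
    and \<psi>: "\<And>w. w \<in> V \<Longrightarrow> \<psi> w = integral {z \<in> \<Omega>. w \<in> rect z} (\<lambda>z. KA z w)
      + integral {m \<in> {p..q}. w \<in> rect (g m)} (\<lambda>m. KC m w)"
  obtains \<psi>s where
    "\<And>s t. (s, t) \<in> V \<Longrightarrow> ((\<lambda>s'. \<psi> (s', t)) has_real_derivative \<psi>s (s, t)) (at s)"
    "((\<lambda>w. - fst (g' \<mu>) * \<psi>s w) \<longlongrightarrow> - KC \<mu> (g \<mu>)) (at (g \<mu>) within V)"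
proof -
  let ?sw = "prod.swap :: point \<Rightarrow> point"
  define h where "h m = ?sw (g (- m))" for m
  define h' where "h' m = - ?sw (g' (- m))" for m
  define \<Omega>' where "\<Omega>' = (\<Union>m\<in>{-q..-p}. rect (h m))"
  \<comment> \<open>The parameter interval becomes {-q..-p}, so its ends trade places: the corner of
    \<open>V'\<close> has the coordinates \<open>snd (g p)\<close> and \<open>fst (g q)\<close>,
    those of the corner of \<open>V\<close> exchanged.\<close>
  define V' where "V' = {w. fst (h (- p)) < fst w \<and> snd (h (- q)) < snd w \<and>
      (\<exists>m\<in>{-q..-p}. fst w < fst (h m) \<and> snd w < snd (h m))}"
  have \<Omega>': "z \<in> \<Omega>' \<longleftrightarrow> ?sw z \<in> \<Omega>" for z
  proof
    assume "z \<in> \<Omega>'"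
    then obtain m where "m \<in> {-q..-p}" "z \<in> rect (h m)" by (auto simp: \<Omega>'_def)
    then show "?sw z \<in> \<Omega>" unfolding \<Omega>_def by (intro UN_I[of "- m"]) (auto simp: h_def mem_rect)
  next
    assume "?sw z \<in> \<Omega>"
    then obtain m where "m \<in> {p..q}" "?sw z \<in> rect (g m)" by (auto simp: \<Omega>_def)
    then show "z \<in> \<Omega>'" unfolding \<Omega>'_def by (intro UN_I[of "- m"]) (auto simp: h_def mem_rect)
  qed
  have V': "w \<in> V' \<longleftrightarrow> ?sw w \<in> V" for w
  proof
    assume w: "w \<in> V'"
    then obtain m where "m \<in> {-q..-p}" "fst w < fst (h m)" "snd w < snd (h m)" by (auto simp: V'_def)
    then show "?sw w \<in> V" using w unfolding V_def V'_def by (auto simp: h_def intro!: bexI[of _ "- m"])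
  next
    assume w: "?sw w \<in> V"
    then obtain m where "m \<in> {p..q}" "snd w < fst (g m)" "fst w < snd (g m)" by (auto simp: V_def)
    then show "w \<in> V'" using w unfolding V_def V'_def by (auto simp: h_def intro!: bexI[of _ "- m"])
  qed
  have dh: "(h has_vector_derivative h' m) (at m)" if "m \<in> {-q..-p}" for m
    unfolding h_def[abs_def] h'_def
    by (rule has_vector_derivative_swap_reflect) (use that in \<open>auto intro!: g\<close>)
  have ch': "continuous_on {-q..-p} h'"
    unfolding h'_def by (intro continuous_intros bounded_linear.continuous_on[OF bounded_linear_swap] continuous_on_compose2[OF g(2)]) auto
  have cg: "continuous_on {p..q} g"
    using g(1) by (meson continuous_at_imp_continuous_on has_vector_derivative_continuous)
  have cA: "continuous_on {(z, w). z \<in> \<Omega>' \<and> w \<in> rect z} (\<lambda>(z, w). K (?sw z) (?sw w))"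
    if "continuous_on {(z, w). z \<in> \<Omega> \<and> w \<in> rect z} (\<lambda>(z, w). K z w)" for K :: "point \<Rightarrow> point \<Rightarrow> real"
    unfolding case_prod_unfold
    by (rule continuous_on_compose_case_prod[OF that])
      (auto intro!: continuous_intros bounded_linear.continuous_on[OF bounded_linear_swap] simp: \<Omega>' mem_rect_swap)
  have cC: "continuous_on {(m, w). m \<in> {-q..-p} \<and> w \<in> rect (h m)} (\<lambda>(m, w). K (- m) (?sw w))"
    if "continuous_on {(m, w). m \<in> {p..q} \<and> w \<in> rect (g m)} (\<lambda>(m, w). K m w)" for K :: "real \<Rightarrow> point \<Rightarrow> real"
    unfolding case_prod_unfold
    by (rule continuous_on_compose_case_prod[OF that])
      (auto intro!: continuous_intros bounded_linear.continuous_on[OF bounded_linear_swap] simp: h_def mem_rect)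
  have "\<exists>\<psi>t. (\<forall>s t. (s, t) \<in> V' \<longrightarrow> ((\<lambda>t'. \<psi> (?sw (s, t'))) has_real_derivative \<psi>t (s, t)) (at t)) \<and>
    ((\<lambda>w. snd (h' (- \<mu>)) * \<psi>t w) \<longlongrightarrow> - KC (- (- \<mu>)) (?sw (h (- \<mu>)))) (at (h (- \<mu>)) within V')"
  proof (rule oblique_local_derivative[of "-q" "-\<mu>" "-p" h h' "\<lambda>z w. KA (?sw z) (?sw w)" "\<lambda>z w. KA' (?sw z) (?sw w)"
        "\<lambda>m w. KC (- m) (?sw w)" "\<lambda>m w. KC' (- m) (?sw w)" "\<lambda>w. \<psi> (?sw w)", folded \<Omega>'_def V'_def])
    fix w assume w: "w \<in> V'"
    then have wV: "?sw w \<in> V" by (simp add: V')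
    have cpt: "compact {z \<in> \<Omega>. ?sw w \<in> rect z}"
    proof -
      have "compact \<Omega>" unfolding \<Omega>_def by (rule compact_rect_Union[OF _ cg]) simp
      moreover have "closed {z. ?sw w \<in> rect z}"
        unfolding mem_rect by (intro closed_Collect_conj closed_Collect_le continuous_intros)
      ultimately have "compact (\<Omega> \<inter> {z. ?sw w \<in> rect z})" by (rule compact_Int_closed)
      then show ?thesis by (simp add: Int_def)
    qed
    have "continuous_on {z \<in> \<Omega>. ?sw w \<in> rect z} (\<lambda>z. KA z (?sw w))"
      by (rule continuous_on_compose_case_prod[OF KA continuous_on_id continuous_on_const]) auto
    from integral_prod_swap[OF cpt this]
    have "integral (?sw ` {z \<in> \<Omega>. ?sw w \<in> rect z}) (\<lambda>z. KA (?sw z) (?sw w)) = integral {z \<in> \<Omega>. ?sw w \<in> rect z} (\<lambda>z. KA z (?sw w))" .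
    moreover have "?sw ` {z \<in> \<Omega>. ?sw w \<in> rect z} = {z \<in> \<Omega>'. w \<in> rect z}"
      by (auto simp: \<Omega>' image_iff mem_rect)
    moreover have "integral {m \<in> {-q..-p}. w \<in> rect (h m)} (\<lambda>m. KC (- m) (?sw w))
      = integral {m \<in> {p..q}. ?sw w \<in> rect (g m)} (\<lambda>m. KC m (?sw w))"
      using integral_reflect_Collect[of q p "\<lambda>m. ?sw w \<in> rect (g m)" "\<lambda>m. KC m (?sw w)"]
      by (simp add: h_def mem_rect conj_ac)
    ultimately show "\<psi> (?sw w) = integral {z \<in> \<Omega>'. w \<in> rect z} (\<lambda>z. KA (?sw z) (?sw w))
      + integral {m \<in> {-q..-p}. w \<in> rect (h m)} (\<lambda>m. KC (- m) (?sw w))"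
      using \<psi>[OF wV] by simp
  next
    fix z s t assume "z \<in> \<Omega>'" "(s, t) \<in> rect z"
    then show "((\<lambda>t'. KA (?sw z) (?sw (s, t'))) has_real_derivative KA' (?sw z) (?sw (s, t))) (at t within {0..snd z})"
      using derA[of "?sw z" t s] by (simp add: \<Omega>' mem_rect)
  next
    fix m s t assume "m \<in> {-q..-p}" "(s, t) \<in> rect (h m)"
    then show "((\<lambda>t'. KC (- m) (?sw (s, t'))) has_real_derivative KC' (- m) (?sw (s, t))) (at t within {0..snd (h m)})"
      using derC[of "- m" t s] by (simp add: h_def mem_rect)
  next
    fix m n assume "-q \<le> m" "m < n" "n \<le> -p"
    then show "fst (h n) < fst (h m)" using inc[of "- n" "- m"] by (simp add: h_def)
  next
    fix m assume "m \<in> {-q..-p}"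
    then show "0 < snd (h' m)" using neg[of "- m"] by (simp add: h'_def)
  next
    show "0 \<le> fst (h (- p))" "0 \<le> snd (h (- q))" using nonneg by (simp_all add: h_def)
  next
    fix \<psi>t assume "\<And>s t. (s, t) \<in> V' \<Longrightarrow> ((\<lambda>t'. \<psi> (?sw (s, t'))) has_real_derivative \<psi>t (s, t)) (at t)"
      "((\<lambda>w. snd (h' (- \<mu>)) * \<psi>t w) \<longlongrightarrow> - KC (- (- \<mu>)) (?sw (h (- \<mu>)))) (at (h (- \<mu>)) within V')"
    then show ?thesis by blast
  qed (use \<mu> dh ch' cA[OF KA] cA[OF KA'] cC[OF KC] cC[OF KC'] in auto)
  then obtain \<psi>t where \<psi>t: "\<And>s t. (s, t) \<in> V' \<Longrightarrow> ((\<lambda>t'. \<psi> (?sw (s, t'))) has_real_derivative \<psi>t (s, t)) (at t)"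
    "((\<lambda>w. snd (h' (- \<mu>)) * \<psi>t w) \<longlongrightarrow> - KC (- (- \<mu>)) (?sw (h (- \<mu>)))) (at (h (- \<mu>)) within V')" by blast
  show ?thesis
  proof (rule that[of "\<lambda>w. \<psi>t (?sw w)"])
    fix s t assume "(s, t) \<in> V"
    then show "((\<lambda>s'. \<psi> (s', t)) has_real_derivative \<psi>t (?sw (s, t))) (at s)"
      using \<psi>t(1)[of t s] by (simp add: V')
  next
    have "filterlim ?sw (at (h (- \<mu>)) within V') (at (g \<mu>) within V)"
      unfolding filterlim_at
    proof
      show "\<forall>\<^sub>F w in at (g \<mu>) within V. ?sw w \<in> V' \<and> ?sw w \<noteq> h (- \<mu>)"
        unfolding eventually_at_filter by (rule always_eventually) (auto simp: V' h_def prod_eq_iff)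
      show "(?sw \<longlongrightarrow> h (- \<mu>)) (at (g \<mu>) within V)"
        unfolding h_def prod.swap_def by (auto intro!: tendsto_intros)
    qed
    from filterlim_compose[OF \<psi>t(2) this]
    show "((\<lambda>w. - fst (g' \<mu>) * \<psi>t (?sw w)) \<longlongrightarrow> - KC \<mu> (g \<mu>)) (at (g \<mu>) within V)"
      by (simp add: h_def h'_def)
  qed
qed

text \<open>A constant abscissa leaves only the second component of the velocity, unit speed makes
  it 1 or -1, and monotonicity selects 1. Hence the height minus the parameter is constant.\<close>

lemma unit_speed_flat:
  fixes g g' :: "real \<Rightarrow> point"
  assumes g: "\<And>m. m \<in> {c..d} \<Longrightarrow> (g has_vector_derivative g' m) (at m)" "\<And>m. m \<in> {c..d} \<Longrightarrow> norm (g' m) = 1"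
    and flat: "\<And>m. m \<in> {c..d} \<Longrightarrow> fst (g m) = s0"
    and mono: "\<And>m n. c \<le> m \<Longrightarrow> m \<le> n \<Longrightarrow> n \<le> d \<Longrightarrow> snd (g m) \<le> snd (g n)"
    and \<mu>: "\<mu> \<in> {c<..<d}"
  shows "g' \<mu> = (0, 1)" "\<And>m. m \<in> {c<..<d} \<Longrightarrow> g m = (s0, snd (g \<mu>) + (m - \<mu>))"
proof -
  have dg: "((\<lambda>m. fst (g m)) has_real_derivative fst (g' m)) (at m)"
    "((\<lambda>m. snd (g m)) has_real_derivative snd (g' m)) (at m)" if "m \<in> {c<..<d}" for m
    using g(1)[of m] that unfolding has_real_derivative_iff_has_vector_derivative
    by (auto intro: bounded_linear.has_vector_derivative bounded_linear_fst bounded_linear_snd)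
  have g': "g' m = (0, 1)" if m: "m \<in> {c<..<d}" for m
  proof -
    have "((\<lambda>_. s0) has_real_derivative fst (g' m)) (at m)"
      by (rule has_field_derivative_transform_within_open[OF dg(1)[OF m], of "{c<..<d}"]) (use flat m in auto)
    then have 1: "fst (g' m) = 0" using DERIV_const DERIV_unique by blast
    have "mono_on {c..d} (\<lambda>m. snd (g m))" using mono by (auto simp: monotone_on_def)
    from mono_on_imp_deriv_nonneg[OF this dg(2)[OF m]] have 2: "0 \<le> snd (g' m)" using m by auto
    have "norm (g' m) = 1" using g(2)[of m] m by auto
    then have "snd (g' m) = 1" using 1 2 by (simp add: norm_prod_def)
    with 1 show ?thesis by (simp add: prod_eq_iff)
  qed
  show "g' \<mu> = (0, 1)" using g'[OF \<mu>] .
  have "((\<lambda>m. snd (g m) - m) has_real_derivative 0) (at m within {c<..<d})" if "m \<in> {c<..<d}" for m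
    using has_field_derivative_at_within[OF DERIV_diff[OF dg(2)[OF that] DERIV_ident]] g'[OF that] by simp
  then obtain k where k: "\<And>m. m \<in> {c<..<d} \<Longrightarrow> snd (g m) - m = k"
    using has_field_derivative_zero_constant[of "{c<..<d}" "\<lambda>m. snd (g m) - m"] by auto
  show "g m = (s0, snd (g \<mu>) + (m - \<mu>))" if "m \<in> {c<..<d}" for m
    using k[OF that] k[OF \<mu>] flat[of m] that by (auto simp: prod_eq_iff)
qed

text \<open>The costate is a function of the second pair of arguments of \<open>R\<close>. Here the
  derivatives in this pair and their values on the characteristic lines are restated for points
  instead of coordinates.\<close>

lemma riemann_functionE:
  assumes "riemann_function G A B C R"
  obtains R3 R4 where
    "continuous_on {(z, w). z \<in> G \<and> w \<in> rect z} (\<lambda>(z, w). R z w)"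
    "continuous_on {(z, w). z \<in> G \<and> w \<in> rect z} (\<lambda>(z, w). R3 z w)"
    "continuous_on {(z, w). z \<in> G \<and> w \<in> rect z} (\<lambda>(z, w). R4 z w)"
    "\<And>z. z \<in> G \<Longrightarrow> R z z = mat 1"
    "\<And>z s t. z \<in> G \<Longrightarrow> (s, t) \<in> rect z \<Longrightarrow>
      ((\<lambda>s'. R z (s', t)) has_vector_derivative R3 z (s, t)) (at s within {0..fst z})"
    "\<And>z s t. z \<in> G \<Longrightarrow> (s, t) \<in> rect z \<Longrightarrow>
      ((\<lambda>t'. R z (s, t')) has_vector_derivative R4 z (s, t)) (at t within {0..snd z})"
    "\<And>z w. z \<in> G \<Longrightarrow> w \<in> rect z \<Longrightarrow> snd w = snd z \<Longrightarrow> R3 z w = - (R z w ** C w)"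
    "\<And>z w. z \<in> G \<Longrightarrow> w \<in> rect z \<Longrightarrow> fst w = fst z \<Longrightarrow> R4 z w = - (R z w ** B w)"
proof -
  show ?thesis
    using assms unfolding riemann_function_def
    apply (elim conjE exE)
    subgoal premises p for R1 R2 R3 R4
    proof (rule that[of R3 R4])
      note e = p(4)[THEN spec, THEN spec, THEN spec, THEN spec, THEN mp, OF conjI]
      \<comment> \<open>Of the conjuncts at a fixed quadruple, the third and fourth are the
        derivatives in \<sigma> and \<tau>, and the last two are the conditions on \<open>R4\<close>
        and \<open>R3\<close> along the characteristics.\<close>
      note e3 = e[THEN conjunct2, THEN conjunct2, THEN conjunct1]
      note e4 = e[THEN conjunct2, THEN conjunct2, THEN conjunct2, THEN conjunct1]
      note e9 = e[THEN conjunct2, THEN conjunct2, THEN conjunct2, THEN conjunct2, THEN conjunct2,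
          THEN conjunct2, THEN conjunct2, THEN conjunct2]
      fix z w :: point and s t
      obtain z1 z2 w1 w2 where z: "z = (z1, z2)" "w = (w1, w2)" by (cases z; cases w)
      show "((\<lambda>s'. R z (s', t)) has_vector_derivative R3 z (s, t)) (at s within {0..fst z})"
        if "z \<in> G" "(s, t) \<in> rect z"
        using that unfolding z fst_conv by (rule e3)
      show "((\<lambda>t'. R z (s, t')) has_vector_derivative R4 z (s, t)) (at t within {0..snd z})"
        if "z \<in> G" "(s, t) \<in> rect z"
        using that unfolding z snd_conv by (rule e4)
      show "R3 z w = - (R z w ** C w)" if "z \<in> G" "w \<in> rect z" "snd w = snd z"
      proof -
        have "w2 = z2" using that(3) z by simp
        show ?thesis using that(1,2) unfolding z \<open>w2 = z2\<close> by (rule e9[THEN conjunct2])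
      qed
      show "R4 z w = - (R z w ** B w)" if "z \<in> G" "w \<in> rect z" "fst w = fst z"
      proof -
        have "w1 = z1" using that(3) z by simp
        show ?thesis using that(1,2) unfolding z \<open>w1 = z1\<close> by (rule e9[THEN conjunct1])
      qed
    next
      show "R z z = mat 1" if "z \<in> G" for z using p(2) that by (rule bspec)
    qed (use p(3) in simp_all)
    done
qed

section \<open>The control problem\<close>

locale control_problem =
  fixes a b L :: real and g :: "real \<Rightarrow> point" and N :: nat and \<nu> :: "nat \<Rightarrow> real"
    and G :: "point set" and ulo uhi :: "real^'m"
    and f :: "point \<Rightarrow> real^'n \<Rightarrow> real^'n \<Rightarrow> real^'n \<Rightarrow> real^'m \<Rightarrow> real^'n"
    and \<Phi> :: "point \<Rightarrow> real^'n \<Rightarrow> real^'n \<Rightarrow> real^'n \<Rightarrow> real^'m \<Rightarrow> real"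
    and \<Phi>1 :: "point \<Rightarrow> real^'n \<Rightarrow> real^'n \<Rightarrow> real"
    and \<Phi>0 :: "point \<Rightarrow> real^'n \<Rightarrow> real"
    and x1 x2 :: "real \<Rightarrow> real^'n"
    and u :: "point \<Rightarrow> real^'m" and x xs xt :: "point \<Rightarrow> real^'n"
    and R :: "point \<Rightarrow> point \<Rightarrow> real^'n^'n"
  assumes curve: "boundary_curve a b L g N \<nu>"
    and G: "G = region L g"
    and data: "smooth_data G L g N \<nu> ulo uhi f \<Phi> \<Phi>1 \<Phi>0"
    and control: "admissible_control G ulo uhi u"
    and state: "is_state a b G f x1 x2 u x xs xt"
    and riemann: "linearized_riemann G f u x xs xt R"
begin

abbreviation "fp \<equiv> \<lambda>z. jacobian (\<lambda>p. f z (x z) p (xt z) (u z)) (at (xs z))"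
abbreviation "fq \<equiv> \<lambda>z. jacobian (\<lambda>q. f z (x z) (xs z) q (u z)) (at (xt z))"
abbreviation "Fc \<equiv> F_curve g \<Phi> \<Phi>1 u x xs xt"
abbreviation "\<psi> \<equiv> costate G L g N \<nu> \<Phi> \<Phi>1 \<Phi>0 u x xs xt R"
abbreviation "vertices \<equiv> \<nu> ` {0..Suc N}"

lemmas curve_facts = boundary_curveD[OF curve]
lemmas curve_cont = curve_facts(2)
  and curve_pos = curve_facts(5)
  and curve_mono = curve_facts(6)
  and curve_nonneg = curve_facts(7)

lemma region_compact: "compact G"
  and curve_in_region: "g ` {0..L} \<subseteq> G"
  and region_rect: "z \<in> G \<Longrightarrow> 0 \<le> fst z \<and> 0 \<le> snd z \<and> rect z \<subseteq> G"
  unfolding G by (rule region_facts[OF curve_cont]; use curve_nonneg in blast)+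

lemma in_region: "m \<in> {0..L} \<Longrightarrow> g m \<in> G"
  using curve_in_region by blast

lemma \<Phi>_smooth: "C2_near (G \<times> UNIV \<times> UNIV \<times> UNIV \<times> cbox ulo uhi) (\<lambda>(z, y, p, q, v). \<Phi> z y p q v)"
  and f_smooth: "C2_near (G \<times> UNIV \<times> UNIV \<times> UNIV \<times> cbox ulo uhi) (\<lambda>(z, y, p, q, v). f z y p q v)"
  and \<Phi>1_smooth: "C2_near (g ` {0..L} \<times> UNIV \<times> UNIV) (\<lambda>(z, y, \<eta>). \<Phi>1 z y \<eta>)"
  using data unfolding smooth_data_def by blast+

lemma control_in_box: "z \<in> G \<Longrightarrow> u z \<in> cbox ulo uhi"
  using control unfolding admissible_control_def by blast

lemma F_curve_pieceE:
  assumes "r \<le> N"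
  obtains g' h where
    "\<And>m. m \<in> {\<nu> r..\<nu> (Suc r)} \<Longrightarrow> (g has_vector_derivative g' m) (at m within {\<nu> r..\<nu> (Suc r)})"
    "continuous_on {\<nu> r..\<nu> (Suc r)} g'"
    "\<And>m. m \<in> {\<nu> r..\<nu> (Suc r)} \<Longrightarrow> norm (g' m) = 1"
    "\<And>i. continuous_on {\<nu> r..\<nu> (Suc r)} (h i)"
    "\<And>i m. m \<in> {\<nu> r<..<\<nu> (Suc r)} \<Longrightarrow> Fc i m = h i m"
proof -
  obtain g' g'' where g: "continuous_on {\<nu> r..\<nu> (Suc r)} g''"
    "\<And>m. m \<in> {\<nu> r..\<nu> (Suc r)} \<Longrightarrow> (g has_vector_derivative g' m) (at m within {\<nu> r..\<nu> (Suc r)})"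
    "\<And>m. m \<in> {\<nu> r..\<nu> (Suc r)} \<Longrightarrow> (g' has_vector_derivative g'' m) (at m within {\<nu> r..\<nu> (Suc r)})"
    "\<And>m. m \<in> {\<nu> r..\<nu> (Suc r)} \<Longrightarrow> norm (g' m) = 1"
    by (rule boundary_curve_pieceE[OF curve assms]) blast
  obtain us ut where u: "has_partials G u us ut"
    using control unfolding admissible_control_def by blast
  obtain xss xst xtt where x: "has_partials G x xs xt" "has_partials G xs xss xst" "has_partials G xt xst xtt"
    using state unfolding is_state_def by blast
  have "0 \<le> \<nu> r" using curve_facts(8) curve_facts(10)[of 0 r] assms by (cases r) auto
  moreover have "\<nu> (Suc r) \<le> L" using curve_facts(9) curve_facts(10)[of "Suc r" "Suc N"] assms by (cases "r = N") auto
  ultimately have sub: "{\<nu> r..\<nu> (Suc r)} \<subseteq> {0..L}" by auto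
  then have im: "g ` {\<nu> r..\<nu> (Suc r)} \<subseteq> G" "g ` {\<nu> r..\<nu> (Suc r)} \<subseteq> g ` {0..L}"
    using in_region by blast+
  have "\<exists>h. (\<forall>i. continuous_on {\<nu> r..\<nu> (Suc r)} (h i)) \<and> (\<forall>i m. m \<in> {\<nu> r<..<\<nu> (Suc r)} \<longrightarrow> Fc i m = h i m)"
  proof (rule F_curve_piece[OF \<Phi>_smooth \<Phi>1_smooth control_in_box u x g(2,3,1) im])
    fix h assume "\<And>i. continuous_on {\<nu> r..\<nu> (Suc r)} (h i)" "\<And>i m. m \<in> {\<nu> r<..<\<nu> (Suc r)} \<Longrightarrow> Fc i m = h i m"
    then show ?thesis by (intro exI[of _ h] conjI allI impI)
  qed
  then obtain h where h: "\<And>i. continuous_on {\<nu> r..\<nu> (Suc r)} (h i)"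
    "\<And>i m. m \<in> {\<nu> r<..<\<nu> (Suc r)} \<Longrightarrow> Fc i m = h i m" by auto
  have "continuous_on {\<nu> r..\<nu> (Suc r)} g'"
    using g(3) by (meson continuous_on_eq_continuous_within has_vector_derivative_continuous)
  then show ?thesis using that g h by blast
qed

text \<open>At a corner, \<open>vector_derivative\<close> and \<open>deriv\<close> may return
  arbitrary values. The vertices form a finite, hence negligible set, and between them
  \<open>F_curve\<close> agrees with functions continuous up to the ends of the pieces.\<close>

lemma F_curve_absolutely_integrable: "Fc i absolutely_integrable_on {0..L}"
proof -
  have "Fc i absolutely_integrable_on {\<nu> 0..\<nu> (Suc N)}"
  proof (rule absolutely_integrable_on_partition)
    fix r assume r: "r \<le> N"
    show "\<nu> r \<le> \<nu> (Suc r)" using curve_facts(10)[of r "Suc r"] r by auto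
    obtain g' h where h: "\<And>i. continuous_on {\<nu> r..\<nu> (Suc r)} (h i)"
      "\<And>i m. m \<in> {\<nu> r<..<\<nu> (Suc r)} \<Longrightarrow> Fc i m = h i m"
      by (rule F_curve_pieceE[OF r]) blast
    show "Fc i absolutely_integrable_on {\<nu> r..\<nu> (Suc r)}"
    proof (rule absolutely_integrable_spike)
      show "h i absolutely_integrable_on {\<nu> r..\<nu> (Suc r)}"
        by (rule absolutely_integrable_continuous_real) (rule h)
      show "negligible {\<nu> r, \<nu> (Suc r)}" by simp
    qed (use h(2) in auto)
  qed
  then show ?thesis using curve_facts(8,9) by simp
qed

text \<open>The common starting point of the flat and the oblique case: a closed parameter interval
  around \<mu> inside a single smooth piece, so free of vertices, on which \<open>g\<close> has a
  continuous two-sided derivative and \<open>F_curve\<close> is continuous.\<close>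

lemma regular_pointE:
  assumes "0 \<le> \<alpha>" "\<alpha> < \<mu>" "\<mu> < \<beta>" "\<beta> \<le> L" "\<mu> \<notin> vertices"
  obtains \<delta> g' where "0 < \<delta>" "{\<mu> - \<delta>..\<mu> + \<delta>} \<subseteq> {\<alpha><..<\<beta>}" "{\<mu> - \<delta>..\<mu> + \<delta>} \<inter> vertices = {}"
    "\<And>m. m \<in> {\<mu> - \<delta>..\<mu> + \<delta>} \<Longrightarrow> (g has_vector_derivative g' m) (at m)"
    "continuous_on {\<mu> - \<delta>..\<mu> + \<delta>} g'"
    "\<And>m. m \<in> {\<mu> - \<delta>..\<mu> + \<delta>} \<Longrightarrow> norm (g' m) = 1"
    "\<And>i. continuous_on {\<mu> - \<delta>..\<mu> + \<delta>} (Fc i)"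
proof -
  obtain r where r: "r \<le> N" "\<nu> r < \<mu>" "\<mu> < \<nu> (Suc r)"
    using finite_partition_piece[of \<nu> \<mu> N] assms curve_facts(8,9) by auto
  obtain g' h where gh:
    "\<And>m. m \<in> {\<nu> r..\<nu> (Suc r)} \<Longrightarrow> (g has_vector_derivative g' m) (at m within {\<nu> r..\<nu> (Suc r)})"
    "continuous_on {\<nu> r..\<nu> (Suc r)} g'"
    "\<And>m. m \<in> {\<nu> r..\<nu> (Suc r)} \<Longrightarrow> norm (g' m) = 1"
    "\<And>i. continuous_on {\<nu> r..\<nu> (Suc r)} (h i)"
    "\<And>i m. m \<in> {\<nu> r<..<\<nu> (Suc r)} \<Longrightarrow> Fc i m = h i m"
    by (rule F_curve_pieceE[OF r(1)]) blast
  \<comment> \<open>Half of the smallest of the four distances, so that the closed interval lies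
    strictly inside both the smooth piece and the given arc.\<close>
  define \<delta> where "\<delta> = min (min (\<mu> - \<nu> r) (\<nu> (Suc r) - \<mu>)) (min (\<mu> - \<alpha>) (\<beta> - \<mu>)) / 2"
  have "0 < \<delta>" using r assms by (simp add: \<delta>_def)
  then have \<delta>2: "\<delta> < \<mu> - \<nu> r" "\<delta> < \<nu> (Suc r) - \<mu>" "\<delta> < \<mu> - \<alpha>" "\<delta> < \<beta> - \<mu>"
    by (auto simp: \<delta>_def)
  have sub: "{\<mu> - \<delta>..\<mu> + \<delta>} \<subseteq> {\<nu> r<..<\<nu> (Suc r)}"
    and sub': "{\<mu> - \<delta>..\<mu> + \<delta>} \<subseteq> {\<nu> r..\<nu> (Suc r)}"
    and 2: "{\<mu> - \<delta>..\<mu> + \<delta>} \<subseteq> {\<alpha><..<\<beta>}" using \<delta>2 by auto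
  have "\<nu> k \<notin> {\<nu> r<..<\<nu> (Suc r)}" if "k \<le> Suc N" for k
  proof (cases "k \<le> r")
    case True
    then have "\<nu> k \<le> \<nu> r" using curve_facts(10)[of k r] r by (cases "k = r") auto
    then show ?thesis by auto
  next
    case False
    then have "\<nu> (Suc r) \<le> \<nu> k" using curve_facts(10)[of "Suc r" k] that by (cases "k = Suc r") auto
    then show ?thesis by auto
  qed
  then have 3: "{\<mu> - \<delta>..\<mu> + \<delta>} \<inter> vertices = {}" using sub by fastforce
  have 4: "(g has_vector_derivative g' m) (at m)" if "m \<in> {\<mu> - \<delta>..\<mu> + \<delta>}" for m
  proof -
    have "m \<in> interior {\<nu> r..\<nu> (Suc r)}" using that sub by auto
    then have "at m within {\<nu> r..\<nu> (Suc r)} = at m" by (rule at_within_interior)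
    then show ?thesis using gh(1)[of m] that sub' by auto
  qed
  have 7: "continuous_on {\<mu> - \<delta>..\<mu> + \<delta>} (Fc i)" for i
  proof -
    have "continuous_on {\<mu> - \<delta>..\<mu> + \<delta>} (h i)" by (rule continuous_on_subset[OF gh(4) sub'])
    then show ?thesis by (rule continuous_on_eq) (use gh(5) sub in auto)
  qed
  show ?thesis
    by (rule that[OF \<open>0 < \<delta>\<close> 2 3 4 continuous_on_subset[OF gh(2) sub'] _ 7]) (use gh(3) sub' in auto)
qed

lemma F_area_versionE:
  obtains Fa where "\<And>i. continuous_on G (Fa i)"
    "\<And>i z. z \<in> G \<Longrightarrow> 0 < fst z \<Longrightarrow> 0 < snd z \<Longrightarrow> F_area G \<Phi> u x xs xt i z = Fa i z"
proof -
  obtain us ut where u: "has_partials G u us ut"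
    using control unfolding admissible_control_def by blast
  obtain xss xst xtt where x: "has_partials G x xs xt" "has_partials G xs xss xst" "has_partials G xt xst xtt"
    using state unfolding is_state_def by blast
  show ?thesis
    by (rule F_area_continuous_version[OF \<Phi>_smooth control_in_box u x region_rect]) (use that in blast)+
qed

lemma costate_component:
  "\<psi> w $ j = integral {z \<in> G. w \<in> rect z} (\<lambda>z. \<Sum>i\<in>UNIV. F_area G \<Phi> u x xs xt i z * R z w $ i $ j)
     + integral {m \<in> {0..L}. w \<in> rect (g m)} (\<lambda>m. \<Sum>i\<in>UNIV. Fc i m * R (g m) w $ i $ j)
     + (\<Sum>r\<in>{1..N}. (\<Sum>i\<in>UNIV. F_vertex g \<nu> \<Phi>1 \<Phi>0 x xs xt i r * R (g (\<nu> r)) w $ i $ j)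
         * of_bool (w \<in> rect (g (\<nu> r))))"
proof -
  have "{m \<in> {0..L}. g m \<in> upper_part G w} = {m \<in> {0..L}. w \<in> rect (g m)}"
    using in_region by (auto simp: upper_part_def)
  then show ?thesis by (simp add: costate_def upper_part_def)
qed

lemma vertex_in_interval: "r \<in> {1..N} \<Longrightarrow> \<nu> r \<in> {0..L}"
  using curve_facts(8,9) curve_facts(10)[of 0 r] curve_facts(10)[of r "Suc N"] by auto

text \<open>The costate is an independent argument of the Hamiltonian and is held fixed here, so the
  sum over k of \<kappa>_k times the Jacobian entry is exactly the term left over by the
  differentiation along a flat arc.\<close>

lemma
  assumes "z \<in> G"
  shows hamiltonian_p: "partial j (\<lambda>p. hamiltonian f \<Phi> z (x z) p (xt z) \<kappa> (u z)) (xs z)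
      = partial j (\<lambda>p. \<Phi> z (x z) p (xt z) (u z)) (xs z) + (\<Sum>k\<in>UNIV. \<kappa> $ k * fp z $ k $ j)"
    and hamiltonian_q: "partial j (\<lambda>q. hamiltonian f \<Phi> z (x z) (xs z) q \<kappa> (u z)) (xt z)
      = partial j (\<lambda>q. \<Phi> z (x z) (xs z) q (u z)) (xt z) + (\<Sum>k\<in>UNIV. \<kappa> $ k * fq z $ k $ j)"
proof -
  let ?P = "(z, x z, xs z, xt z, u z)"
  have P: "?P \<in> G \<times> UNIV \<times> UNIV \<times> UNIV \<times> cbox ulo uhi" using assms control_in_box by simp
  obtain D where D: "((\<lambda>(z, y, p, q, v). \<Phi> z y p q v) has_derivative D) (at ?P)"
    using C2_nearE[OF \<Phi>_smooth] P by (metis (no_types, lifting) subsetD)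
  obtain E where E: "((\<lambda>(z, y, p, q, v). f z y p q v) has_derivative E) (at ?P)"
    using C2_nearE[OF f_smooth] P by (metis (no_types, lifting) subsetD)
  note d = slot_derivatives[OF D] and e = slot_derivatives[OF E]
  have sum: "((\<lambda>p. h p + (\<Sum>k\<in>UNIV. \<kappa> $ k * F p $ k)) has_derivative
      (\<lambda>v. D' v + (\<Sum>k\<in>UNIV. \<kappa> $ k * E' v $ k))) (at p)"
    if "(h has_derivative D') (at p)" "(F has_derivative E') (at p)" for h :: "real^'n \<Rightarrow> real" and F :: "real^'n \<Rightarrow> real^'n" and D' E' p
    by (intro has_derivative_add has_derivative_sum has_derivative_mult_right that
        bounded_linear.has_derivative[OF bounded_linear_vec_nth])
  show "partial j (\<lambda>p. hamiltonian f \<Phi> z (x z) p (xt z) \<kappa> (u z)) (xs z)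
      = partial j (\<lambda>p. \<Phi> z (x z) p (xt z) (u z)) (xs z) + (\<Sum>k\<in>UNIV. \<kappa> $ k * fp z $ k $ j)"
    unfolding hamiltonian_def partial_eq[OF sum[OF d(2) e(2)]] partial_eq[OF d(2)] jacobian_eq[OF e(2)] ..
  show "partial j (\<lambda>q. hamiltonian f \<Phi> z (x z) (xs z) q \<kappa> (u z)) (xt z)
      = partial j (\<lambda>q. \<Phi> z (x z) (xs z) q (u z)) (xt z) + (\<Sum>k\<in>UNIV. \<kappa> $ k * fq z $ k $ j)"
    unfolding hamiltonian_def partial_eq[OF sum[OF d(3) e(3)]] partial_eq[OF d(3)] jacobian_eq[OF e(3)] ..
qed

section \<open>The costate along flat arcs\<close>

lemma along_curve:
  fixes Q :: "point \<Rightarrow> point \<Rightarrow> 'z::topological_space"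
  assumes "continuous_on {(z, w). z \<in> G \<and> w \<in> rect z} (\<lambda>(z, w). Q z w)" "S \<subseteq> {0..L}"
  shows "continuous_on {(m, w). m \<in> S \<and> w \<in> rect (g m)} (\<lambda>(m, w). Q (g m) w)"
  unfolding case_prod_unfold
proof (rule continuous_on_compose_case_prod[OF assms(1)])
  show "continuous_on {p. fst p \<in> S \<and> snd p \<in> rect (g (fst p))} (\<lambda>p. g (fst p))"
    by (rule continuous_on_compose2[OF curve_cont]) (use assms(2) in \<open>auto intro!: continuous_intros\<close>)
qed (use assms(2) in_region in \<open>auto intro!: continuous_intros\<close>)

text \<open>On a vertical arc the normal is (1, 0) and \<mu> differs from t by a constant. What has
  to be checked is that no point of \<open>G\<close> to the right of the arc dominates one of its
  points, which makes the area term vanish.\<close>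

lemma flat_vertical:
  assumes \<mu>: "0 \<le> \<alpha>" "\<alpha> < \<mu>" "\<mu> < \<beta>" "\<beta> \<le> L" "\<mu> \<notin> vertices"
    and flat: "\<And>m. m \<in> {\<alpha>..\<beta>} \<Longrightarrow> fst (g m) = fst (g \<alpha>)"
  shows "n1 g \<mu> = 1" "n2 g \<mu> = 0"
    "((\<lambda>m. \<psi> (g m) $ j) has_real_derivative - Fc j \<mu> - (\<Sum>k\<in>UNIV. \<psi> (g \<mu>) $ k * fp (g \<mu>) $ k $ j)) (at \<mu>)"
proof -
  obtain d0 g' where reg: "0 < d0" "{\<mu> - d0..\<mu> + d0} \<subseteq> {\<alpha><..<\<beta>}" "{\<mu> - d0..\<mu> + d0} \<inter> vertices = {}"
    "\<And>m. m \<in> {\<mu> - d0..\<mu> + d0} \<Longrightarrow> (g has_vector_derivative g' m) (at m)"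
    "\<And>m. m \<in> {\<mu> - d0..\<mu> + d0} \<Longrightarrow> norm (g' m) = 1"
    "\<And>i. continuous_on {\<mu> - d0..\<mu> + d0} (Fc i)"
    by (rule regular_pointE[OF \<mu>]) auto
  \<comment> \<open>The affine form of the curve is obtained on an open interval of radius 2d, but
    is needed on the closed one of radius d.\<close>
  define d where "d = d0 / 2"
  have d0: "d0 = 2 * d" by (simp add: d_def)
  note reg = reg[unfolded d0]
  have d: "0 < d" "2 * d < \<mu> - \<alpha>" "2 * d < \<beta> - \<mu>"
    using reg(1) subsetD[OF reg(2), of "\<mu> - 2 * d"] subsetD[OF reg(2), of "\<mu> + 2 * d"] by auto
  obtain R3 R4 where R:
    "continuous_on {(z, w). z \<in> G \<and> w \<in> rect z} (\<lambda>(z, w). R z w)"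
    "continuous_on {(z, w). z \<in> G \<and> w \<in> rect z} (\<lambda>(z, w). R4 z w)"
    "\<And>z. z \<in> G \<Longrightarrow> R z z = mat 1"
    "\<And>z s t. z \<in> G \<Longrightarrow> (s, t) \<in> rect z \<Longrightarrow>
      ((\<lambda>t'. R z (s, t')) has_vector_derivative R4 z (s, t)) (at t within {0..snd z})"
    "\<And>z w. z \<in> G \<Longrightarrow> w \<in> rect z \<Longrightarrow> fst w = fst z \<Longrightarrow> R4 z w = - (R z w ** fp w)"
    by (rule riemann_functionE[OF riemann[unfolded linearized_riemann_def]]) blast
  have fst_const: "fst (g m) = fst (g \<mu>)" if "m \<in> {\<mu> - 2 * d..\<mu> + 2 * d}" for m
    using flat[of m] flat[of \<mu>] that d \<mu> by auto
  have snd_mono: "snd (g m) \<le> snd (g n)" if "\<mu> - 2 * d \<le> m" "m \<le> n" "n \<le> \<mu> + 2 * d" for m n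
    using curve_mono[of m n] that d \<mu> by auto
  have \<mu>I: "\<mu> \<in> {\<mu> - 2 * d<..<\<mu> + 2 * d}" using d(1) by auto
  note us = unit_speed_flat[of "\<mu> - 2 * d" "\<mu> + 2 * d" g g' "fst (g \<mu>)" \<mu>, OF reg(4,5) fst_const snd_mono \<mu>I]
  have g'\<mu>: "g' \<mu> = (0, 1)" by (rule us(1))
  have affine: "g m = (fst (g \<mu>), snd (g \<mu>) + (m - \<mu>))" if "m \<in> {\<mu> - 2 * d<..<\<mu> + 2 * d}" for m
    by (rule us(2)) (use that in auto)
  have "vector_derivative g (at \<mu>) = (0, 1)"
    using vector_derivative_at[OF reg(4)[of \<mu>]] reg(1) g'\<mu> by auto
  then show "n1 g \<mu> = 1" "n2 g \<mu> = 0" by (simp_all add: n1_def n2_def)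
  have mI: "m \<in> {0..L}" if "m \<in> {\<mu> - d..\<mu> + d}" for m
    using that d \<mu> by auto
  show "((\<lambda>m. \<psi> (g m) $ j) has_real_derivative - Fc j \<mu> - (\<Sum>k\<in>UNIV. \<psi> (g \<mu>) $ k * fp (g \<mu>) $ k $ j)) (at \<mu>)"
  proof (rule flat_local_derivative[where p = 0 and q = L and d = d and R = R and R' = R4 and \<rho> = \<nu> and I = "{1..N}"
        and V = "\<lambda>i r. F_vertex g \<nu> \<Phi>1 \<Phi>0 x xs xt i r"])
    show "{\<mu> - d..\<mu> + d} \<subseteq> {0..L}" using mI by blast
    show "g m = (fst (g \<mu>), snd (g \<mu>) + (m - \<mu>))" if "m \<in> {\<mu> - d..\<mu> + d}" for m
      by (rule affine) (use that d(1) in auto)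
    show "isCont (Fc i) \<mu>" for i by (rule continuous_on_interior[OF reg(6)]) (use reg(1) in auto)
    show "continuous_on {(m, w). m \<in> {0..L} \<and> w \<in> rect (g m)} (\<lambda>(m, w). R (g m) w)"
      by (rule along_curve[OF R(1) subset_refl])
    show "continuous_on {(m, w). m \<in> {0..L} \<and> w \<in> rect (g m)} (\<lambda>(m, w). R4 (g m) w)"
      by (rule along_curve[OF R(2) subset_refl])
    show "R4 (g m) (g \<mu>) = - (R (g m) (g \<mu>) ** fp (g \<mu>))"
      if "m \<in> {0..L}" "fst (g m) = fst (g \<mu>)" "snd (g \<mu>) \<le> snd (g m)" for m
      using that curve_nonneg[of \<mu>] \<mu> by (intro R(5) in_region) (auto simp: mem_rect)
    show "\<nu> r \<in> {0..L} - {\<mu> - d..\<mu> + d}" if "r \<in> {1..N}" for r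
    proof -
      have "\<nu> r \<in> vertices" using that by auto
      then have "\<nu> r \<notin> {\<mu> - 2 * d..\<mu> + 2 * d}" using reg(3) by blast
      then show ?thesis using vertex_in_interval[OF that] d by auto
    qed
    fix j m assume m: "m \<in> {\<mu> - d<..<\<mu> + d}"
    \<comment> \<open>A point of \<open>G\<close> lies below and to the left of some
      \<open>g n\<close>. If n < \<mu> - d, then \<open>g n\<close> is lower than \<open>g m\<close>
      and cannot dominate it. So n \<ge> \<mu> - d, and then \<open>g n\<close> is not to the right
      of the arc: all dominating points lie on one vertical line, a null set.\<close>
    have "{z \<in> G. g m \<in> rect z} \<subseteq> {z. z \<bullet> (1, 0) = fst (g \<mu>)}"
    proof clarify
      fix s t assume z: "(s, t) \<in> G" "g m \<in> rect (s, t)"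
      then obtain n where n: "n \<in> {0..L}" "(s, t) \<in> rect (g n)" unfolding G region_def by auto
      have gm: "g m = (fst (g \<mu>), snd (g \<mu>) + (m - \<mu>))" by (rule affine) (use m d(1) in auto)
      have "\<mu> - d \<le> n"
      proof (rule ccontr)
        assume "\<not> \<mu> - d \<le> n"
        then have "snd (g n) \<le> snd (g (\<mu> - d))" using curve_mono[of n "\<mu> - d"] n mI[of "\<mu> - d"] d(1) by auto
        also have "\<dots> = snd (g \<mu>) - d" using affine[of "\<mu> - d"] d(1) by auto
        finally show False using gm m z(2) n(2) by (auto simp: mem_rect)
      qed
      then have "fst (g n) \<le> fst (g (\<mu> - d))" using curve_mono[of "\<mu> - d" n] n mI[of "\<mu> - d"] d(1) by auto
      also have "\<dots> = fst (g \<mu>)" using affine[of "\<mu> - d"] d(1) by auto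
      finally show "(s, t) \<bullet> (1, 0) = fst (g \<mu>)" using gm z(2) n(2) by (auto simp: mem_rect)
    qed
    moreover have "negligible {z. z \<bullet> ((1, 0) :: point) = fst (g \<mu>)}"
      by (rule negligible_standard_hyperplane) (auto simp: Basis_prod_def)
    ultimately have "negligible {z \<in> G. g m \<in> rect z}" by (rule negligible_subset[rotated])
    then show "\<psi> (g m) $ j = integral {m' \<in> {0..L}. g m \<in> rect (g m')} (\<lambda>m'. \<Sum>i\<in>UNIV. Fc i m' * R (g m') (g m) $ i $ j)
      + (\<Sum>r\<in>{1..N}. (\<Sum>i\<in>UNIV. F_vertex g \<nu> \<Phi>1 \<Phi>0 x xs xt i r * R (g (\<nu> r)) (g m) $ i $ j) * of_bool (g m \<in> rect (g (\<nu> r))))"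
      unfolding costate_component[of "g m" j] using integral_negligible by simp
  qed (use d(1) curve_cont curve_mono curve_nonneg F_curve_absolutely_integrable R(3,4) in_region \<mu> in auto)
qed

text \<open>The exchanged and reversed curve has a vertical arc at -\<mu>. The exchange turns
  \<tau>-derivatives into \<sigma>-derivatives and \<open>f_p\<close> into \<open>f_q\<close>, and
  undoing the reversal of the parameter changes the sign of the derivative.\<close>

lemma flat_horizontal:
  assumes \<mu>: "0 \<le> \<alpha>" "\<alpha> < \<mu>" "\<mu> < \<beta>" "\<beta> \<le> L" "\<mu> \<notin> vertices"
    and flat: "\<And>m. m \<in> {\<alpha>..\<beta>} \<Longrightarrow> snd (g m) = snd (g \<alpha>)"
  shows "n1 g \<mu> = 0" "n2 g \<mu> = 1"
    "((\<lambda>m. \<psi> (g m) $ j) has_real_derivative Fc j \<mu> + (\<Sum>k\<in>UNIV. \<psi> (g \<mu>) $ k * fq (g \<mu>) $ k $ j)) (at \<mu>)"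
proof -
  let ?sw = "prod.swap :: point \<Rightarrow> point"
  obtain d0 g' where reg: "0 < d0" "{\<mu> - d0..\<mu> + d0} \<subseteq> {\<alpha><..<\<beta>}" "{\<mu> - d0..\<mu> + d0} \<inter> vertices = {}"
    "\<And>m. m \<in> {\<mu> - d0..\<mu> + d0} \<Longrightarrow> (g has_vector_derivative g' m) (at m)"
    "\<And>m. m \<in> {\<mu> - d0..\<mu> + d0} \<Longrightarrow> norm (g' m) = 1"
    "\<And>i. continuous_on {\<mu> - d0..\<mu> + d0} (Fc i)"
    by (rule regular_pointE[OF \<mu>]) auto
  define d where "d = d0 / 2"
  have d0: "d0 = 2 * d" by (simp add: d_def)
  note reg = reg[unfolded d0]
  have d: "0 < d" "2 * d < \<mu> - \<alpha>" "2 * d < \<beta> - \<mu>"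
    using reg(1) subsetD[OF reg(2), of "\<mu> - 2 * d"] subsetD[OF reg(2), of "\<mu> + 2 * d"] by auto
  obtain R3 R4 where R:
    "continuous_on {(z, w). z \<in> G \<and> w \<in> rect z} (\<lambda>(z, w). R z w)"
    "continuous_on {(z, w). z \<in> G \<and> w \<in> rect z} (\<lambda>(z, w). R3 z w)"
    "\<And>z. z \<in> G \<Longrightarrow> R z z = mat 1"
    "\<And>z s t. z \<in> G \<Longrightarrow> (s, t) \<in> rect z \<Longrightarrow>
      ((\<lambda>s'. R z (s', t)) has_vector_derivative R3 z (s, t)) (at s within {0..fst z})"
    "\<And>z w. z \<in> G \<Longrightarrow> w \<in> rect z \<Longrightarrow> snd w = snd z \<Longrightarrow> R3 z w = - (R z w ** fq w)"
    by (rule riemann_functionE[OF riemann[unfolded linearized_riemann_def]]) blast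
  define h where "h m = ?sw (g (- m))" for m
  have dh: "(h has_vector_derivative - ?sw (g' (- m))) (at m)" if "m \<in> {- \<mu> - 2 * d..- \<mu> + 2 * d}" for m
    unfolding h_def[abs_def] by (rule has_vector_derivative_swap_reflect) (use that in \<open>auto intro!: reg\<close>)
  have nh: "norm (- ?sw (g' (- m))) = 1" if "m \<in> {- \<mu> - 2 * d..- \<mu> + 2 * d}" for m
    using reg(5)[of "- m"] that by (auto simp: norm_prod_def add.commute)
  have fst_const: "fst (h m) = snd (g \<mu>)" if "m \<in> {- \<mu> - 2 * d..- \<mu> + 2 * d}" for m
    using flat[of "- m"] flat[of \<mu>] that d \<mu> by (auto simp: h_def)
  have snd_mono: "snd (h m) \<le> snd (h n)" if "- \<mu> - 2 * d \<le> m" "m \<le> n" "n \<le> - \<mu> + 2 * d" for m n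
    using curve_mono[of "- n" "- m"] that d \<mu> by (auto simp: h_def)
  have \<mu>I: "- \<mu> \<in> {- \<mu> - 2 * d<..<- \<mu> + 2 * d}" using d(1) by auto
  note us = unit_speed_flat[of "- \<mu> - 2 * d" "- \<mu> + 2 * d" h "\<lambda>m. - ?sw (g' (- m))", OF dh nh fst_const snd_mono \<mu>I]
  have "- ?sw (g' (- (- \<mu>))) = (0, 1)" by (rule us(1))
  then have g'\<mu>: "g' \<mu> = (-1, 0)" by (simp add: prod_eq_iff)
  have h\<mu>: "fst (h (- \<mu>)) = snd (g \<mu>)" "snd (h (- \<mu>)) = fst (g \<mu>)" by (simp_all add: h_def)
  have affine: "h m = (fst (h (- \<mu>)), snd (h (- \<mu>)) + (m - - \<mu>))" if "m \<in> {- \<mu> - 2 * d<..<- \<mu> + 2 * d}" for m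
    unfolding h\<mu>(1) by (rule us(2)) (use that in auto)
  have "vector_derivative g (at \<mu>) = (-1, 0)"
    using vector_derivative_at[OF reg(4)[of \<mu>]] reg(1) g'\<mu> by auto
  then show "n1 g \<mu> = 0" "n2 g \<mu> = 1" by (simp_all add: n1_def n2_def)
  have mI: "- m \<in> {0..L}" if "m \<in> {- \<mu> - d..- \<mu> + d}" for m
    using that d \<mu> by auto
  have ch: "continuous_on {- L..0} h"
    unfolding h_def[abs_def]
    by (intro bounded_linear.continuous_on[OF bounded_linear_swap] continuous_on_compose2[OF curve_cont]) (auto intro!: continuous_intros)
  have cR: "continuous_on {(m, w). m \<in> {- L..0} \<and> w \<in> rect (h m)} (\<lambda>(m, w). Q (?sw (h m)) (?sw w))"
    if "continuous_on {(z, w). z \<in> G \<and> w \<in> rect z} (\<lambda>(z, w). Q z w)" for Q :: "point \<Rightarrow> point \<Rightarrow> real^'n^'n"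
    unfolding case_prod_unfold
  proof (rule continuous_on_compose_case_prod[OF that])
    show "continuous_on {p. fst p \<in> {- L..0} \<and> snd p \<in> rect (h (fst p))} (\<lambda>p. ?sw (h (fst p)))"
      by (intro bounded_linear.continuous_on[OF bounded_linear_swap] continuous_on_compose2[OF ch])
        (auto intro!: continuous_intros)
    show "continuous_on {p. fst p \<in> {- L..0} \<and> snd p \<in> rect (h (fst p))} (\<lambda>p. ?sw (snd p))"
      by (intro bounded_linear.continuous_on[OF bounded_linear_swap] continuous_intros)
  qed (auto simp: h_def mem_rect intro!: in_region)
  have "((\<lambda>m. \<psi> (?sw (h m)) $ j) has_real_derivative
     - Fc j (- (- \<mu>)) - (\<Sum>k\<in>UNIV. \<psi> (?sw (h (- \<mu>))) $ k * fq (g \<mu>) $ k $ j)) (at (- \<mu>))"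
  proof (rule flat_local_derivative[where p = "- L" and q = 0 and d = d and g = h
        and F = "\<lambda>i m. Fc i (- m)" and \<psi> = "\<lambda>w. \<psi> (?sw w)"
        and R = "\<lambda>z w. R (?sw z) (?sw w)" and R' = "\<lambda>z w. R3 (?sw z) (?sw w)" and \<rho> = "\<lambda>r. - \<nu> r" and I = "{1..N}"
        and V = "\<lambda>i r. F_vertex g \<nu> \<Phi>1 \<Phi>0 x xs xt i r"])
    show "{- \<mu> - d..- \<mu> + d} \<subseteq> {- L..0}"
    proof
      fix m assume "m \<in> {- \<mu> - d..- \<mu> + d}"
      from mI[OF this] show "m \<in> {- L..0}" by simp
    qed
    show "h m = (fst (h (- \<mu>)), snd (h (- \<mu>)) + (m - - \<mu>))" if "m \<in> {- \<mu> - d..- \<mu> + d}" for m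
      by (rule affine) (use that d(1) in auto)
    show "(\<lambda>m. Fc i (- m)) absolutely_integrable_on {- L..0}" for i
      using F_curve_absolutely_integrable[of i] absolutely_integrable_reflect_real[where f = "Fc i" and b = L and a = 0] by simp
    show "isCont (\<lambda>m. Fc i (- m)) (- \<mu>)" for i
    proof -
      have "isCont (Fc i) (- (- \<mu>))" using continuous_on_interior[OF reg(6), of \<mu> i] reg(1) by auto
      then show ?thesis by (rule isCont_o2[rotated]) (intro continuous_intros)
    qed
    show "fst (h n) \<le> fst (h m) \<and> snd (h m) \<le> snd (h n)" if "- L \<le> m" "m \<le> n" "n \<le> 0" for m n
      using curve_mono[of "- n" "- m"] that by (simp add: h_def)
    show "0 \<le> fst (h m) \<and> 0 \<le> snd (h m)" if "m \<in> {- L..0}" for m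
      using curve_nonneg[of "- m"] that by (simp add: h_def)
    show "((\<lambda>t'. R (?sw (h m)) (?sw (s, t'))) has_vector_derivative R3 (?sw (h m)) (?sw (s, t))) (at t within {0..snd (h m)})"
      if "m \<in> {- L..0}" "(s, t) \<in> rect (h m)" for m s t
      using R(4)[of "g (- m)" t s] in_region[of "- m"] that by (simp add: h_def mem_rect)
    show "R (?sw (h (- \<mu>))) (?sw (h (- \<mu>))) = mat 1" using R(3)[of "g \<mu>"] in_region[of \<mu>] \<mu> by (simp add: h_def)
    show "R3 (?sw (h m)) (?sw (h (- \<mu>))) = - (R (?sw (h m)) (?sw (h (- \<mu>))) ** fq (g \<mu>))"
      if "m \<in> {- L..0}" "fst (h m) = fst (h (- \<mu>))" "snd (h (- \<mu>)) \<le> snd (h m)" for m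
    proof -
      have sw: "?sw (h m) = g (- m)" "?sw (h (- \<mu>)) = g \<mu>" by (simp_all add: h_def)
      have "g (- m) \<in> G" using that(1) by (intro in_region) auto
      moreover have "g \<mu> \<in> rect (g (- m))" "snd (g \<mu>) = snd (g (- m))"
        using that(2,3) curve_nonneg[of \<mu>] \<mu> by (simp_all add: h_def mem_rect)
      ultimately show ?thesis unfolding sw by (rule R(5))
    qed
    show "- \<nu> r \<in> {- L..0} - {- \<mu> - d..- \<mu> + d}" if "r \<in> {1..N}" for r
    proof -
      have "\<nu> r \<in> vertices" using that by auto
      then have "\<nu> r \<notin> {\<mu> - 2 * d..\<mu> + 2 * d}" using reg(3) by blast
      then show ?thesis using vertex_in_interval[OF that] d by auto
    qed
    fix j m assume m: "m \<in> {- \<mu> - d<..<- \<mu> + d}"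
    \<comment> \<open>As for vertical arcs, with the roles exchanged: a curve point beyond \<mu> + d
      lies too far to the left to dominate, and one before it is not above the arc.\<close>
    have "{z \<in> G. ?sw (h m) \<in> rect z} \<subseteq> {z. z \<bullet> (0, 1) = snd (g \<mu>)}"
    proof clarify
      fix s t assume z: "(s, t) \<in> G" "?sw (h m) \<in> rect (s, t)"
      then obtain n where n: "n \<in> {0..L}" "(s, t) \<in> rect (g n)" unfolding G region_def by auto
      have hm: "h m = (snd (g \<mu>), fst (g \<mu>) + (m + \<mu>))" using affine[of m] m d(1) by (auto simp: h\<mu>)
      have hd: "h (- \<mu> - d) = (snd (g \<mu>), fst (g \<mu>) - d)" using affine[of "- \<mu> - d"] d(1) by (auto simp: h\<mu>)
      then have gd: "g (\<mu> + d) = (fst (g \<mu>) - d, snd (g \<mu>))" by (auto simp: h_def prod_eq_iff add.commute)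
      have dI: "\<mu> + d \<in> {0..L}" using d \<mu> by auto
      have "n \<le> \<mu> + d"
      proof (rule ccontr)
        assume "\<not> n \<le> \<mu> + d"
        then have "fst (g n) \<le> fst (g \<mu>) - d" using curve_mono[of "\<mu> + d" n] n dI gd by auto
        then show False using hm m z(2) n(2) by (auto simp: mem_rect)
      qed
      then have "snd (g n) \<le> snd (g \<mu>)" using curve_mono[of n "\<mu> + d"] n dI gd by auto
      then show "(s, t) \<bullet> (0, 1) = snd (g \<mu>)" using hm z(2) n(2) by (auto simp: mem_rect)
    qed
    moreover have "negligible {z. z \<bullet> ((0, 1) :: point) = snd (g \<mu>)}"
      by (rule negligible_standard_hyperplane) (auto simp: Basis_prod_def)
    ultimately have "negligible {z \<in> G. ?sw (h m) \<in> rect z}" by (rule negligible_subset[rotated])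
    then have area: "integral {z \<in> G. ?sw (h m) \<in> rect z} q = 0" for q :: "point \<Rightarrow> real"
      by (rule integral_negligible)
    have arc: "integral {m' \<in> {0..L}. ?sw w \<in> rect (g m')} q = integral {m' \<in> {- L..0}. w \<in> rect (h m')} (\<lambda>m'. q (- m'))"
      for w and q :: "real \<Rightarrow> real"
      using integral_reflect_Collect[of L 0 "\<lambda>m. ?sw w \<in> rect (g m)" q]
      by (simp add: h_def mem_rect conj_ac)
    show "\<psi> (?sw (h m)) $ j =
      integral {m' \<in> {- L..0}. h m \<in> rect (h m')} (\<lambda>m'. \<Sum>i\<in>UNIV. Fc i (- m') * R (?sw (h m')) (?sw (h m)) $ i $ j)
      + (\<Sum>r\<in>{1..N}. (\<Sum>i\<in>UNIV. F_vertex g \<nu> \<Phi>1 \<Phi>0 x xs xt i r * R (?sw (h (- \<nu> r))) (?sw (h m)) $ i $ j)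
        * of_bool (h m \<in> rect (h (- \<nu> r))))"
      unfolding costate_component[of "?sw (h m)" j] area arc by (simp add: h_def mem_rect_swap)
  qed (use d(1) ch cR[OF R(1)] cR[OF R(2)] in auto)
  \<comment> \<open>The derivative of the reversed function at -\<mu> is the negative of the
    derivative at \<mu>.\<close>
  then have "((\<lambda>m. \<psi> (g (- m)) $ j) has_real_derivative
     - (Fc j \<mu> + (\<Sum>k\<in>UNIV. \<psi> (g \<mu>) $ k * fq (g \<mu>) $ k $ j))) (at (- \<mu>))"
    by (simp add: h_def)
  then show "((\<lambda>m. \<psi> (g m) $ j) has_real_derivative Fc j \<mu> + (\<Sum>k\<in>UNIV. \<psi> (g \<mu>) $ k * fq (g \<mu>) $ k $ j)) (at \<mu>)"
    by (subst (asm) DERIV_mirror[symmetric]) simp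
qed

text \<open>An oblique arc has no flat subarc, so both coordinates are strictly monotone along it.
  Hence in a small open quadrant around \<open>g \<mu>\<close> the costate depends only on the arc
  within \<open>d\<close> of \<mu>, without vertex terms, and the local results apply. The two
  derivatives are treated independently, each under the sign condition on its own component of the
  normal.\<close>

lemma oblique_limits:
  assumes \<mu>: "0 \<le> \<alpha>" "\<alpha> < \<mu>" "\<mu> < \<beta>" "\<beta> \<le> L" "\<mu> \<notin> vertices" and obl: "oblique_arc g \<alpha> \<beta>"
  defines "S \<equiv> interior (regular_part G g N \<nu>)"
  shows "((\<lambda>z. \<psi> z $ j) \<longlongrightarrow> 0) (at (g \<mu>) within S)"
    and "n2 g \<mu> \<noteq> 0 \<Longrightarrow> \<exists>\<psi>s.
      (\<forall>\<^sub>F (s, t) in at (g \<mu>) within S. ((\<lambda>s'. \<psi> (s', t) $ j) has_real_derivative \<psi>s (s, t)) (at s)) \<and>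
      ((\<lambda>z. n2 g \<mu> * \<psi>s z) \<longlongrightarrow> - Fc j \<mu>) (at (g \<mu>) within S)"
    and "n1 g \<mu> \<noteq> 0 \<Longrightarrow> \<exists>\<psi>t.
      (\<forall>\<^sub>F (s, t) in at (g \<mu>) within S. ((\<lambda>t'. \<psi> (s, t') $ j) has_real_derivative \<psi>t (s, t)) (at t)) \<and>
      ((\<lambda>z. n1 g \<mu> * \<psi>t z) \<longlongrightarrow> - Fc j \<mu>) (at (g \<mu>) within S)"
proof -
  obtain e g' where reg: "0 < e" "{\<mu> - e..\<mu> + e} \<subseteq> {\<alpha><..<\<beta>}" "{\<mu> - e..\<mu> + e} \<inter> vertices = {}"
    "\<And>m. m \<in> {\<mu> - e..\<mu> + e} \<Longrightarrow> (g has_vector_derivative g' m) (at m)"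
    "continuous_on {\<mu> - e..\<mu> + e} g'"
    "\<And>i. continuous_on {\<mu> - e..\<mu> + e} (Fc i)"
    by (rule regular_pointE[OF \<mu>]) auto
  obtain R3 R4 where R:
    "continuous_on {(z, w). z \<in> G \<and> w \<in> rect z} (\<lambda>(z, w). R z w)"
    "continuous_on {(z, w). z \<in> G \<and> w \<in> rect z} (\<lambda>(z, w). R3 z w)"
    "continuous_on {(z, w). z \<in> G \<and> w \<in> rect z} (\<lambda>(z, w). R4 z w)"
    "\<And>z. z \<in> G \<Longrightarrow> R z z = mat 1"
    "\<And>z s t. z \<in> G \<Longrightarrow> (s, t) \<in> rect z \<Longrightarrow>
      ((\<lambda>s'. R z (s', t)) has_vector_derivative R3 z (s, t)) (at s within {0..fst z})"
    "\<And>z s t. z \<in> G \<Longrightarrow> (s, t) \<in> rect z \<Longrightarrow>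
      ((\<lambda>t'. R z (s, t')) has_vector_derivative R4 z (s, t)) (at t within {0..snd z})"
    by (rule riemann_functionE[OF riemann[unfolded linearized_riemann_def]]) blast
  obtain Fa where Fa: "\<And>i. continuous_on G (Fa i)"
    "\<And>i z. z \<in> G \<Longrightarrow> 0 < fst z \<Longrightarrow> 0 < snd z \<Longrightarrow> F_area G \<Phi> u x xs xt i z = Fa i z"
    by (rule F_area_versionE) blast
  have e: "\<alpha> < \<mu> - e" "\<mu> + e < \<beta>"
    using subsetD[OF reg(2), of "\<mu> - e"] subsetD[OF reg(2), of "\<mu> + e"] reg(1) by auto
  then have eL: "0 < \<mu> - e" "\<mu> + e < L" using \<mu> by auto
  \<comment> \<open>If a coordinate took the same value at m < n, monotonicity would make it
    constant in between, and the arc from m to n would be flat.\<close>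
  have strict: "fst (g n) < fst (g m) \<and> snd (g m) < snd (g n)" if "\<mu> - e \<le> m" "m < n" "n \<le> \<mu> + e" for m n
  proof -
    have mn: "\<alpha> \<le> m" "n \<le> \<beta>" "0 \<le> m" "n \<le> L" using that e \<mu> by auto
    then have nf: "\<not> flat_arc g m n" using obl unfolding oblique_arc_def by blast
    have "fst (g n) \<noteq> fst (g m)"
    proof
      assume eq: "fst (g n) = fst (g m)"
      have "fst (g k) = fst (g m)" if "k \<in> {m..n}" for k
        using curve_mono[of m k] curve_mono[of k n] that mn eq by auto
      then have "flat_arc g m n" using \<open>m < n\<close> unfolding flat_arc_def by blast
      then show False using nf by blast
    qed
    moreover have "snd (g n) \<noteq> snd (g m)"
    proof
      assume eq: "snd (g n) = snd (g m)"
      have "snd (g k) = snd (g m)" if "k \<in> {m..n}" for k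
        using curve_mono[of m k] curve_mono[of k n] that mn eq by auto
      then have "flat_arc g m n" using \<open>m < n\<close> unfolding flat_arc_def by blast
      then show False using nf by blast
    qed
    ultimately show ?thesis using curve_mono[of m n] mn \<open>m < n\<close> by auto
  qed
  \<comment> \<open>An open quadrant containing \<open>g \<mu>\<close>: its points have a larger
    abscissa than \<open>g (\<mu> + d)\<close> and a larger height than
    \<open>g (\<mu> - d)\<close>, so curve points with parameters outside [\<mu> - d, \<mu> + d] do
    not dominate them.\<close>
  define W where "W d = {w. fst (g (\<mu> + d)) < fst w \<and> snd (g (\<mu> - d)) < snd w}" for d
  define \<Omega> where "\<Omega> d = (\<Union>m\<in>{\<mu> - d..\<mu> + d}. rect (g m))" for d
  define V where "V d = {w. fst (g (\<mu> + d)) < fst w \<and> snd (g (\<mu> - d)) < snd w \<and>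
      (\<exists>m\<in>{\<mu> - d..\<mu> + d}. fst w < fst (g m) \<and> snd w < snd (g m))}" for d
  define KA where "KA Q z w = (\<Sum>i\<in>UNIV. Fa i z * Q z w $ i $ j)" for Q :: "point \<Rightarrow> point \<Rightarrow> real^'n^'n" and z w
  define KC where "KC Q m w = (\<Sum>i\<in>UNIV. Fc i m * Q (g m) w $ i $ j)" for Q :: "point \<Rightarrow> point \<Rightarrow> real^'n^'n" and m w
  have \<Omega>G: "\<Omega> d \<subseteq> G" if "d \<le> e" for d
    unfolding \<Omega>_def
  proof (rule UN_least)
    fix m assume "m \<in> {\<mu> - d..\<mu> + d}"
    then have "m \<in> {\<mu> - e..\<mu> + e}" using that by auto
    then have "m \<in> {0..L}" using eL by auto
    then show "rect (g m) \<subseteq> G" using region_rect[OF in_region] by blast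
  qed
  have pos: "0 < fst (g m)" "0 < snd (g m)" if "m \<in> {\<mu> - e..\<mu> + e}" for m
    using curve_pos[of m] eL that by auto
  have W_open: "open (W d)" for d
    unfolding W_def by (intro open_Collect_conj open_Collect_less continuous_intros)
  have W_mem: "g \<mu> \<in> W d" if "0 < d" "d \<le> e" for d
    using strict[of \<mu> "\<mu> + d"] strict[of "\<mu> - d" \<mu>] that by (auto simp: W_def)
  have local: "m \<in> {\<mu> - d..\<mu> + d}" if "0 < d" "d \<le> e" "w \<in> W d" "m \<in> {0..L}" "w \<in> rect (g m)" for d w m
  proof -
    have I: "\<mu> - d \<in> {0..L}" "\<mu> + d \<in> {0..L}" using that(1,2) eL by auto
    have "\<not> \<mu> + d < m" using curve_mono[of "\<mu> + d" m] I that by (auto simp: W_def mem_rect)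
    moreover have "\<not> m < \<mu> - d" using curve_mono[of m "\<mu> - d"] I that by (auto simp: W_def mem_rect)
    ultimately show ?thesis by auto
  qed
  have formula: "\<psi> w $ j = integral {z \<in> \<Omega> d. w \<in> rect z} (\<lambda>z. KA R z w)
      + integral {m \<in> {\<mu> - d..\<mu> + d}. w \<in> rect (g m)} (\<lambda>m. KC R m w)"
    if d: "0 < d" "d \<le> e" and w: "w \<in> W d" for d w
  proof -
    have sub: "{\<mu> - d..\<mu> + d} \<subseteq> {0..L}" using d eL by auto
    have arc: "{m \<in> {0..L}. w \<in> rect (g m)} = {m \<in> {\<mu> - d..\<mu> + d}. w \<in> rect (g m)}"
      using local[OF d w] sub by blast
    have area: "{z \<in> G. w \<in> rect z} = {z \<in> \<Omega> d. w \<in> rect z}"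
    proof (intro set_eqI iffI)
      fix z assume "z \<in> {z \<in> G. w \<in> rect z}"
      then obtain m where m: "m \<in> {0..L}" "z \<in> rect (g m)" "w \<in> rect z" unfolding G region_def by auto
      then have "w \<in> rect (g m)" by (auto simp: mem_rect)
      from local[OF d w m(1) this] show "z \<in> {z \<in> \<Omega> d. w \<in> rect z}" using m by (auto simp: \<Omega>_def)
    qed (use \<Omega>G[OF d(2)] in auto)
    \<comment> \<open>The coordinates of \<open>g (\<mu> + d)\<close> and
      \<open>g (\<mu> - d)\<close> are positive, so everything that dominates \<open>w\<close> stays
      off the axes, where \<open>F_area\<close> equals its continuous version.\<close>
    have "0 < fst w" "0 < snd w" using w pos[of "\<mu> + d"] pos[of "\<mu> - d"] d by (auto simp: W_def)
    then have "integral {z \<in> G. w \<in> rect z} (\<lambda>z. \<Sum>i\<in>UNIV. F_area G \<Phi> u x xs xt i z * R z w $ i $ j)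
      = integral {z \<in> G. w \<in> rect z} (\<lambda>z. KA R z w)"
      by (intro integral_cong) (auto simp: KA_def mem_rect Fa(2))
    moreover have "of_bool (w \<in> rect (g (\<nu> r))) = (0 :: real)" if r: "r \<in> {1..N}" for r
    proof -
      have "\<nu> r \<in> vertices" using r by auto
      then have "\<nu> r \<notin> {\<mu> - e..\<mu> + e}" using reg(3) by blast
      then have "\<nu> r \<notin> {\<mu> - d..\<mu> + d}" using d(2) by auto
      then show ?thesis using local[OF d w vertex_in_interval[OF r]] by auto
    qed
    ultimately show ?thesis unfolding costate_component arc by (simp add: KC_def area)
  qed
  have comp: "continuous_on D (\<lambda>p. Q (h p) (k p) $ i $ l)"
    if "continuous_on {(z, w). z \<in> G \<and> w \<in> rect z} (\<lambda>(z, w). Q z w)" "continuous_on D h" "continuous_on D k"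
      "\<And>p. p \<in> D \<Longrightarrow> h p \<in> G \<and> k p \<in> rect (h p)"
    for Q :: "point \<Rightarrow> point \<Rightarrow> real^'n^'n" and D :: "'z::topological_space set" and h k i l
    by (intro continuous_on_component continuous_on_compose_case_prod[OF that(1-3)]) (use that(4) in auto)
  have cKA: "continuous_on {(z, w). z \<in> G \<and> w \<in> rect z} (\<lambda>(z, w). KA Q z w)"
    if "continuous_on {(z, w). z \<in> G \<and> w \<in> rect z} (\<lambda>(z, w). Q z w)" for Q
    unfolding KA_def case_prod_unfold
    by (intro continuous_on_sum continuous_on_mult comp[OF that] continuous_on_compose2[OF Fa(1)])
      (auto intro!: continuous_intros)
  have cg: "continuous_on {\<mu> - e..\<mu> + e} g" by (rule continuous_on_subset[OF curve_cont]) (use eL in auto)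
  have cFc: "continuous_on {\<mu> - e..\<mu> + e} (Fc i)" for i by (rule reg(6))
  have gG: "g m \<in> G" if "m \<in> {\<mu> - e..\<mu> + e}" for m using that eL by (intro in_region) auto
  have cKC: "continuous_on {(m, w). m \<in> {\<mu> - e..\<mu> + e} \<and> w \<in> rect (g m)} (\<lambda>(m, w). KC Q m w)"
    if "continuous_on {(z, w). z \<in> G \<and> w \<in> rect z} (\<lambda>(z, w). Q z w)" for Q
    unfolding KC_def case_prod_unfold
    by (intro continuous_on_sum continuous_on_mult comp[OF that] continuous_on_compose2[OF cFc] continuous_on_compose2[OF cg])
      (use gG in \<open>auto intro!: continuous_intros\<close>)
  have g\<mu>: "g \<mu> \<in> G" using gG[of \<mu>] reg(1) by auto
  have KC\<mu>: "KC R \<mu> (g \<mu>) = Fc j \<mu>"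
    unfolding KC_def R(4)[OF g\<mu>] by (simp add: mat_def if_distrib cong: if_cong)
  have dQ: "((\<lambda>v. \<Sum>i\<in>UNIV. c i * Q v $ i $ j) has_real_derivative (\<Sum>i\<in>UNIV. c i * Q' $ i $ j)) (at y within X)"
    if "(Q has_vector_derivative Q') (at y within X)" for Q :: "real \<Rightarrow> real^'n^'n" and Q' y X and c :: "'n \<Rightarrow> real"
  proof -
    have "((\<lambda>v. Q v $ i $ j) has_real_derivative Q' $ i $ j) (at y within X)" for i
      unfolding has_real_derivative_iff_has_vector_derivative
      by (intro bounded_linear.has_vector_derivative[OF bounded_linear_vec_nth] that)
    then show ?thesis by (intro DERIV_sum DERIV_cmult)
  qed
  have n: "n1 g \<mu> = snd (g' \<mu>)" "n2 g \<mu> = - fst (g' \<mu>)"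
    using vector_derivative_at[OF reg(4)[of \<mu>]] reg(1) by (simp_all add: n1_def n2_def)
  have isCont_g: "isCont g \<mu>" by (rule continuous_on_interior[OF cg]) (use reg(1) in auto)

  show "((\<lambda>z. \<psi> z $ j) \<longlongrightarrow> 0) (at (g \<mu>) within S)"
  proof (rule tendstoI)
    fix \<eta> :: real assume "0 < \<eta>"
    have "compact {(z, w). z \<in> G \<and> w \<in> rect z}"
      using compact_rect_pairs[OF region_compact continuous_on_id] by simp
    then obtain M where M: "0 \<le> M" "\<And>z w. (z, w) \<in> {(z, w). z \<in> G \<and> w \<in> rect z} \<Longrightarrow> \<bar>KA R z w\<bar> \<le> M"
      by (rule compact_bounded_abs[OF _ cKA[OF R(1)]]) blast
    have "compact {(m, w). m \<in> {\<mu> - e..\<mu> + e} \<and> w \<in> rect (g m)}"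
      by (rule compact_rect_pairs[OF compact_Icc cg])
    then obtain M' where M': "0 \<le> M'"
      "\<And>m w. (m, w) \<in> {(m, w). m \<in> {\<mu> - e..\<mu> + e} \<and> w \<in> rect (g m)} \<Longrightarrow> \<bar>KC R m w\<bar> \<le> M'"
      by (rule compact_bounded_abs[OF _ cKC[OF R(1)]]) blast
    \<comment> \<open>A bound for |\<psi>_j| on \<open>W d\<close>: the sup of the area kernel times
      the area of a box around the dominating set, plus the sup of the curve kernel times the length
      2d of the parameter interval. It tends to 0 with \<open>d\<close> by continuity of
      \<open>g\<close>.\<close>
    define q where "q d = M * ((fst (g (\<mu> - d)) - fst (g (\<mu> + d))) * (snd (g (\<mu> + d)) - snd (g (\<mu> - d)))) + M' * ((\<mu> + d) - (\<mu> - d))" for d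
    have t0: "((\<lambda>d. \<mu> + d) \<longlongrightarrow> \<mu>) (at_right 0)" "((\<lambda>d. \<mu> - d) \<longlongrightarrow> \<mu>) (at_right 0)"
      by (auto intro!: tendsto_eq_intros)
    note tg = isCont_tendsto_compose[OF isCont_g t0(1)] isCont_tendsto_compose[OF isCont_g t0(2)]
    have "(q \<longlongrightarrow> M * ((fst (g \<mu>) - fst (g \<mu>)) * (snd (g \<mu>) - snd (g \<mu>))) + M' * (\<mu> - \<mu>)) (at_right 0)"
      unfolding q_def by (intro tendsto_add tendsto_mult tendsto_const tendsto_diff tendsto_fst tendsto_snd tg t0)
    then have "(q \<longlongrightarrow> 0) (at_right 0)" by simp
    then have "\<forall>\<^sub>F d in at_right 0. q d < \<eta>" using \<open>0 < \<eta>\<close> by (rule order_tendstoD)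
    moreover have "\<forall>\<^sub>F d in at_right 0. d < e \<and> 0 < d"
      by (rule eventually_at_rightI[OF _ reg(1)]) auto
    ultimately have "\<forall>\<^sub>F d in at_right 0. q d < \<eta> \<and> d \<le> e \<and> 0 < d" by eventually_elim simp
    then obtain d where d: "q d < \<eta>" "d \<le> e" "0 < d" using eventually_happens'[OF trivial_limit_at_right_real] by blast
    have sub: "{\<mu> - d..\<mu> + d} \<subseteq> {\<mu> - e..\<mu> + e}" using d by auto
    have bound: "\<bar>\<psi> w $ j\<bar> < \<eta>" if w: "w \<in> W d" for w
    proof -
      let ?l = "(fst (g (\<mu> + d)), snd (g (\<mu> - d)))" and ?u = "(fst (g (\<mu> - d)), snd (g (\<mu> + d)))"
      have box: "{z \<in> \<Omega> d. w \<in> rect z} \<subseteq> cbox ?l ?u"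
      proof
        fix z assume "z \<in> {z \<in> \<Omega> d. w \<in> rect z}"
        then obtain m where m: "m \<in> {\<mu> - d..\<mu> + d}" "z \<in> rect (g m)" "w \<in> rect z" by (auto simp: \<Omega>_def)
        have "fst (g m) \<le> fst (g (\<mu> - d))" "snd (g m) \<le> snd (g (\<mu> + d))"
          using strict[of "\<mu> - d" m] strict[of m "\<mu> + d"] m d by (cases "m = \<mu> - d"; cases "m = \<mu> + d"; auto)+
        then show "z \<in> cbox ?l ?u" using m w by (cases z) (auto simp: mem_rect W_def)
      qed
      have "\<bar>integral {z \<in> \<Omega> d. w \<in> rect z} (\<lambda>z. KA R z w)\<bar> \<le> M * measure lborel (cbox ?l ?u)"
      proof (rule abs_integral_le_content[OF _ box M(1)])
        fix z assume "z \<in> {z \<in> \<Omega> d. w \<in> rect z}"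
        then show "\<bar>KA R z w\<bar> \<le> M" using M(2)[of z w] \<Omega>G[OF d(2)] by auto
      qed
      moreover have "measure lborel (cbox ?l ?u) = (fst (g (\<mu> - d)) - fst (g (\<mu> + d))) * (snd (g (\<mu> + d)) - snd (g (\<mu> - d)))"
        using strict[of "\<mu> - d" "\<mu> + d"] d by (simp add: content_Pair)
      moreover have "\<bar>integral {m \<in> {\<mu> - d..\<mu> + d}. w \<in> rect (g m)} (\<lambda>m. KC R m w)\<bar> \<le> M' * measure lborel (cbox (\<mu> - d) (\<mu> + d))"
      proof (rule abs_integral_le_content[OF _ _ M'(1)])
        fix m assume "m \<in> {m \<in> {\<mu> - d..\<mu> + d}. w \<in> rect (g m)}"
        then show "\<bar>KC R m w\<bar> \<le> M'" using M'(2)[of m w] d by auto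
      qed auto
      ultimately have "\<bar>\<psi> w $ j\<bar> \<le> q d" unfolding formula[OF d(3,2) w] q_def using d(3) by simp
      then show ?thesis using d(1) by simp
    qed
    have "\<forall>\<^sub>F w in at (g \<mu>) within S. w \<in> W d"
      using W_open W_mem[OF d(3,2)] unfolding eventually_at_topological by blast
    then show "\<forall>\<^sub>F w in at (g \<mu>) within S. dist (\<psi> w $ j) 0 < \<eta>"
      by eventually_elim (use bound in simp)
  qed

  have SV: "S \<inter> W d \<subseteq> V d" if d: "0 < d" "d \<le> e" for d
  proof
    fix w assume w: "w \<in> S \<inter> W d"
    obtain s t where st: "w = (s, t)" by (cases w)
    have "w \<in> interior G" using w interior_mono[of "regular_part G g N \<nu>" G]
      by (auto simp: S_def regular_part_def)
    then obtain c where c: "0 < c" "ball w c \<subseteq> G" by (auto simp: mem_interior)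
    \<comment> \<open>Membership in \<open>V d\<close> asks for a curve point strictly larger in
      both coordinates. A point of \<open>S\<close> is interior to \<open>G\<close>, so it can be
      shifted along the diagonal inside \<open>G\<close>; with c / 3 in each coordinate the shift is
      at most 2c / 3 < c.\<close>
    have "dist w (s + c / 3, t + c / 3) < c"
    proof -
      have "dist w (s + c / 3, t + c / 3) \<le> \<bar>c / 3\<bar> + \<bar>c / 3\<bar>"
        unfolding st dist_Pair_Pair by (rule order_trans[OF sqrt_sum_squares_le_sum_abs]) (simp add: dist_real_def)
      then show ?thesis using c(1) by simp
    qed
    then have "(s + c / 3, t + c / 3) \<in> G" using c(2) by auto
    then obtain m where m: "m \<in> {0..L}" "(s + c / 3, t + c / 3) \<in> rect (g m)" unfolding G region_def by auto
    have w0: "0 \<le> fst w" "0 \<le> snd w" using region_rect[of w] \<open>w \<in> interior G\<close> interior_subset by blast+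
    then have "w \<in> rect (g m)" using m c(1) st by (auto simp: mem_rect)
    from local[OF d _ m(1) this] w have "m \<in> {\<mu> - d..\<mu> + d}" by auto
    then show "w \<in> V d" using w m c(1) st by (auto simp: V_def W_def mem_rect intro!: bexI[of _ m])
  qed
  \<comment> \<open>The local results are limits within \<open>V d\<close>. They pass to limits
    within \<open>S\<close> because near \<open>g \<mu>\<close> the set \<open>S\<close> is
    contained in \<open>V d\<close>.\<close>
  have filter: "at (g \<mu>) within S \<le> at (g \<mu>) within V d" "\<forall>\<^sub>F w in at (g \<mu>) within S. w \<in> V d"
    if d: "0 < d" "d \<le> e" for d
  proof -
    have "at (g \<mu>) within S = at (g \<mu>) within (S \<inter> W d)"
      by (rule at_within_nhd[OF W_mem[OF d] W_open]) auto
    also have "\<dots> \<le> at (g \<mu>) within V d" by (rule at_le[OF SV[OF d]])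
    finally show le: "at (g \<mu>) within S \<le> at (g \<mu>) within V d" .
    have "\<forall>\<^sub>F w in at (g \<mu>) within V d. w \<in> V d" by (simp add: eventually_at_filter)
    then show "\<forall>\<^sub>F w in at (g \<mu>) within S. w \<in> V d" by (rule filter_leD[OF le])
  qed
  have VW: "V d \<subseteq> W d" for d by (auto simp: V_def W_def)
  have near: "\<exists>d. 0 < d \<and> d \<le> e \<and> (\<forall>m\<in>{\<mu> - d..\<mu> + d}. 0 < h (g' m))"
    if "0 < h (g' \<mu>)" "continuous_on {\<mu> - e..\<mu> + e} (\<lambda>m. h (g' m))" for h :: "point \<Rightarrow> real"
  proof -
    have "isCont (\<lambda>m. h (g' m)) \<mu>" by (rule continuous_on_interior[OF that(2)]) (use reg(1) in auto)
    then have "((\<lambda>m. h (g' m)) \<longlongrightarrow> h (g' \<mu>)) (nhds \<mu>)"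
      using tendsto_at_iff_tendsto_nhds[of "\<lambda>m. h (g' m)" \<mu>] by (simp add: isCont_def)
    then have "\<forall>\<^sub>F m in nhds \<mu>. 0 < h (g' m)" using that(1) by (rule order_tendstoD)
    then obtain c where c: "0 < c" "\<And>m. dist m \<mu> < c \<Longrightarrow> 0 < h (g' m)" unfolding eventually_nhds_metric by blast
    show ?thesis
      by (rule exI[of _ "min (c / 2) e"]) (use c reg(1) in \<open>auto simp: dist_real_def intro!: c(2)\<close>)
  qed
  have restrict: "continuous_on {(z, w). z \<in> \<Omega> d \<and> w \<in> rect z} (\<lambda>(z, w). KA Q z w)"
    "continuous_on {(m, w). m \<in> {\<mu> - d..\<mu> + d} \<and> w \<in> rect (g m)} (\<lambda>(m, w). KC Q m w)"
    if d: "d \<le> e" and Q: "continuous_on {(z, w). z \<in> G \<and> w \<in> rect z} (\<lambda>(z, w). Q z w)" for d Q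
    using \<Omega>G[OF d] d by (auto intro!: continuous_on_subset[OF cKA[OF Q]] continuous_on_subset[OF cKC[OF Q]])
  have dsub: "{\<mu> - d..\<mu> + d} \<subseteq> {\<mu> - e..\<mu> + e}" if "d \<le> e" for d using that by auto
  \<comment> \<open>Monotonicity of the two coordinates gives n1 \<ge> 0 and n2 \<ge> 0, so a
    nonzero component is positive, and by continuity of \<open>g'\<close> it stays positive near
    \<mu>.\<close>
  have sign: "0 \<le> snd (g' \<mu>)" "fst (g' \<mu>) \<le> 0"
  proof -
    have c: "((\<lambda>m. fst (g m)) has_real_derivative fst (g' \<mu>)) (at \<mu>)"
      "((\<lambda>m. snd (g m)) has_real_derivative snd (g' \<mu>)) (at \<mu>)"
      using reg(4)[of \<mu>] reg(1) unfolding has_real_derivative_iff_has_vector_derivative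
      by (auto intro: bounded_linear.has_vector_derivative bounded_linear_fst bounded_linear_snd)
    have "mono_on {0..L} (\<lambda>m. snd (g m))" "mono_on {0..L} (\<lambda>m. - fst (g m))"
      using curve_mono by (auto simp: monotone_on_def)
    from mono_on_imp_deriv_nonneg[OF this(1) c(2)] mono_on_imp_deriv_nonneg[OF this(2) DERIV_minus[OF c(1)]]
    show "0 \<le> snd (g' \<mu>)" "fst (g' \<mu>) \<le> 0" using \<mu> by auto
  qed

  have shared: "0 \<le> fst (g (\<mu> + d))" "0 \<le> snd (g (\<mu> - d))" "continuous_on {\<mu> - d..\<mu> + d} g'"
    "\<And>m. m \<in> {\<mu> - d..\<mu> + d} \<Longrightarrow> (g has_vector_derivative g' m) (at m)"
    "\<And>w. w \<in> V d \<Longrightarrow> \<psi> w $ j = integral {z \<in> \<Omega> d. w \<in> rect z} (\<lambda>z. KA R z w)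
      + integral {m \<in> {\<mu> - d..\<mu> + d}. w \<in> rect (g m)} (\<lambda>m. KC R m w)"
    "\<mu> - d < \<mu>" "\<mu> < \<mu> + d" if d: "0 < d" "d \<le> e" for d
  proof -
    show "0 \<le> fst (g (\<mu> + d))" "0 \<le> snd (g (\<mu> - d))" using pos[of "\<mu> + d"] pos[of "\<mu> - d"] d by auto
    show "continuous_on {\<mu> - d..\<mu> + d} g'" by (rule continuous_on_subset[OF reg(5) dsub[OF d(2)]])
  qed (use reg(4) dsub[OF d(2)] formula[OF d] VW[of d] d(1) in blast | use d(1) in simp)+

  show "\<exists>\<psi>t. (\<forall>\<^sub>F (s, t) in at (g \<mu>) within S. ((\<lambda>t'. \<psi> (s, t') $ j) has_real_derivative \<psi>t (s, t)) (at t)) \<and>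
      ((\<lambda>z. n1 g \<mu> * \<psi>t z) \<longlongrightarrow> - Fc j \<mu>) (at (g \<mu>) within S)" if "n1 g \<mu> \<noteq> 0"
  proof -
    have "0 < snd (g' \<mu>)" using that sign n by auto
    from near[of snd, OF this continuous_on_snd[OF reg(5)]]
    obtain d where d: "0 < d" "d \<le> e" "\<And>m. m \<in> {\<mu> - d..\<mu> + d} \<Longrightarrow> 0 < snd (g' m)"
      by blast
    show ?thesis
    proof (rule oblique_local_derivative[of "\<mu> - d" \<mu> "\<mu> + d" g g' "KA R" "KA R4" "KC R" "KC R4" "\<lambda>w. \<psi> w $ j",
          folded \<Omega>_def V_def])
      show "((\<lambda>t'. KA R z (s, t')) has_real_derivative KA R4 z (s, t)) (at t within {0..snd z})"
        if "z \<in> \<Omega> d" "(s, t) \<in> rect z" for z s t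
        unfolding KA_def using R(6)[of z s t] that \<Omega>G[OF d(2)] by (intro dQ) auto
      show "((\<lambda>t'. KC R m (s, t')) has_real_derivative KC R4 m (s, t)) (at t within {0..snd (g m)})"
        if "m \<in> {\<mu> - d..\<mu> + d}" "(s, t) \<in> rect (g m)" for m s t
        unfolding KC_def using R(6)[of "g m" s t] that gG[of m] d(2) by (intro dQ) auto
      show "fst (g n) < fst (g m)" if "\<mu> - d \<le> m" "m < n" "n \<le> \<mu> + d" for m n
        using strict[of m n] that d by auto
    next
      fix \<psi>t assume *: "\<And>s t. (s, t) \<in> V d \<Longrightarrow> ((\<lambda>t'. \<psi> (s, t') $ j) has_real_derivative \<psi>t (s, t)) (at t)"
        "((\<lambda>w. snd (g' \<mu>) * \<psi>t w) \<longlongrightarrow> - KC R \<mu> (g \<mu>)) (at (g \<mu>) within V d)"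
      have "\<forall>\<^sub>F (s, t) in at (g \<mu>) within S. ((\<lambda>t'. \<psi> (s, t') $ j) has_real_derivative \<psi>t (s, t)) (at t)"
        using filter(2)[OF d(1,2)] by eventually_elim (use *(1) in auto)
      then show ?thesis using tendsto_mono[OF filter(1)[OF d(1,2)] *(2)] n KC\<mu> by auto
    qed ((rule d(3) shared[OF d(1,2)] restrict[OF d(2) R(1)] restrict[OF d(2) R(3)]; assumption?)+)
  qed

  show "\<exists>\<psi>s. (\<forall>\<^sub>F (s, t) in at (g \<mu>) within S. ((\<lambda>s'. \<psi> (s', t) $ j) has_real_derivative \<psi>s (s, t)) (at s)) \<and>
      ((\<lambda>z. n2 g \<mu> * \<psi>s z) \<longlongrightarrow> - Fc j \<mu>) (at (g \<mu>) within S)" if "n2 g \<mu> \<noteq> 0"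
  proof -
    have "0 < - fst (g' \<mu>)" using that sign n by auto
    from near[of "\<lambda>z. - fst z", OF this continuous_on_minus[OF continuous_on_fst[OF reg(5)]]]
    obtain d where d: "0 < d" "d \<le> e" "\<And>m. m \<in> {\<mu> - d..\<mu> + d} \<Longrightarrow> fst (g' m) < 0"
      by auto
    show ?thesis
    proof (rule oblique_local_derivative_s[of "\<mu> - d" \<mu> "\<mu> + d" g g' "KA R" "KA R3" "KC R" "KC R3" "\<lambda>w. \<psi> w $ j",
          folded \<Omega>_def V_def])
      show "((\<lambda>s'. KA R z (s', t)) has_real_derivative KA R3 z (s, t)) (at s within {0..fst z})"
        if "z \<in> \<Omega> d" "(s, t) \<in> rect z" for z s t
        unfolding KA_def using R(5)[of z s t] that \<Omega>G[OF d(2)] by (intro dQ) auto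
      show "((\<lambda>s'. KC R m (s', t)) has_real_derivative KC R3 m (s, t)) (at s within {0..fst (g m)})"
        if "m \<in> {\<mu> - d..\<mu> + d}" "(s, t) \<in> rect (g m)" for m s t
        unfolding KC_def using R(5)[of "g m" s t] that gG[of m] d(2) by (intro dQ) auto
      show "snd (g m) < snd (g n)" if "\<mu> - d \<le> m" "m < n" "n \<le> \<mu> + d" for m n
        using strict[of m n] that d by auto
    next
      fix \<psi>s assume *: "\<And>s t. (s, t) \<in> V d \<Longrightarrow> ((\<lambda>s'. \<psi> (s', t) $ j) has_real_derivative \<psi>s (s, t)) (at s)"
        "((\<lambda>w. - fst (g' \<mu>) * \<psi>s w) \<longlongrightarrow> - KC R \<mu> (g \<mu>)) (at (g \<mu>) within V d)"
      have "\<forall>\<^sub>F (s, t) in at (g \<mu>) within S. ((\<lambda>s'. \<psi> (s', t) $ j) has_real_derivative \<psi>s (s, t)) (at s)"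
        using filter(2)[OF d(1,2)] by eventually_elim (use *(1) in auto)
      then show ?thesis using tendsto_mono[OF filter(1)[OF d(1,2)] *(2)] n KC\<mu> by auto
    qed ((rule d(3) shared[OF d(1,2)] restrict[OF d(2) R(1)] restrict[OF d(2) R(2)]; assumption?)+)
  qed
qed

text \<open>The factor n1^2 - n2^2 is 1 on vertical and -1 on horizontal arcs. It absorbs the
  difference in sign between the two formulas for the derivative of \<psi>, so that in both cases
  the remaining terms are those of \<open>F_curve\<close> and the Jacobian terms, which
  cancel.\<close>

lemma flat_equation:
  assumes fl: "flat_interior L g \<mu>" and v: "\<mu> \<notin> vertices"
  shows "\<exists>\<psi>\<mu>. ((\<lambda>\<mu>'. \<psi> (g \<mu>') $ j) has_real_derivative \<psi>\<mu>) (at \<mu>) \<and>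
    ((n1 g \<mu>)\<^sup>2 - (n2 g \<mu>)\<^sup>2) * \<psi>\<mu>
    + n1 g \<mu> * partial j (\<lambda>p. hamiltonian f \<Phi> (g \<mu>) (x (g \<mu>)) p (xt (g \<mu>)) (\<psi> (g \<mu>)) (u (g \<mu>))) (xs (g \<mu>))
    + n2 g \<mu> * partial j (\<lambda>q. hamiltonian f \<Phi> (g \<mu>) (x (g \<mu>)) (xs (g \<mu>)) q (\<psi> (g \<mu>)) (u (g \<mu>))) (xt (g \<mu>))
    + Phi1_x g \<Phi>1 x xs xt j \<mu> - deriv (Phi1_eta g \<Phi>1 x xs xt j) \<mu> = 0"
proof -
  obtain \<alpha> \<beta> where ab: "0 \<le> \<alpha>" "\<alpha> < \<mu>" "\<mu> < \<beta>" "\<beta> \<le> L" and arc: "flat_arc g \<alpha> \<beta>"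
    using fl unfolding flat_interior_def by blast
  have G\<mu>: "g \<mu> \<in> G" using ab by (intro in_region) auto
  consider (vertical) "\<And>m. m \<in> {\<alpha>..\<beta>} \<Longrightarrow> fst (g m) = fst (g \<alpha>)"
    | (horizontal) "\<And>m. m \<in> {\<alpha>..\<beta>} \<Longrightarrow> snd (g m) = snd (g \<alpha>)"
    using arc unfolding flat_arc_def by blast
  then show ?thesis
  proof cases
    case vertical
    have n: "n1 g \<mu> = 1" "n2 g \<mu> = 0" by (rule flat_vertical[OF ab v], erule vertical)+
    show ?thesis
      by (rule exI, rule conjI, rule flat_vertical(3)[OF ab v], erule vertical)
        (simp add: n hamiltonian_p[OF G\<mu>] F_curve_def Let_def)
  next
    case horizontal
    have n: "n1 g \<mu> = 0" "n2 g \<mu> = 1" by (rule flat_horizontal[OF ab v], erule horizontal)+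
    show ?thesis
      by (rule exI, rule conjI, rule flat_horizontal(3)[OF ab v], erule horizontal)
        (simp add: n hamiltonian_q[OF G\<mu>] F_curve_def Let_def)
  qed
qed

end

text \<open>The derivatives of \<psi> appear as witnesses, so their existence, at the point or near
  it within the interior of the regular part, is part of the claim. The limits involving a component
  of the normal are asserted where this component is nonzero: if n1 vanishes at the point, so does
  its product with any real-valued derivative, and the limit can be - F_1 only if F_1 vanishes
  there.\<close>

theorem theorem4p1:
  fixes a b L :: real and g :: "real \<Rightarrow> point" and N :: nat and \<nu> :: "nat \<Rightarrow> real"
    and G :: "point set" and ulo uhi :: "real^'m"
    and f :: "point \<Rightarrow> real^'n \<Rightarrow> real^'n \<Rightarrow> real^'n \<Rightarrow> real^'m \<Rightarrow> real^'n"
    and \<Phi> :: "point \<Rightarrow> real^'n \<Rightarrow> real^'n \<Rightarrow> real^'n \<Rightarrow> real^'m \<Rightarrow> real"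
    and \<Phi>1 :: "point \<Rightarrow> real^'n \<Rightarrow> real^'n \<Rightarrow> real"
    and \<Phi>0 :: "point \<Rightarrow> real^'n \<Rightarrow> real"
    and x1 x2 :: "real \<Rightarrow> real^'n"
    and u :: "point \<Rightarrow> real^'m" and x xs xt :: "point \<Rightarrow> real^'n"
    and R :: "point \<Rightarrow> point \<Rightarrow> real^'n^'n" and \<psi> :: "point \<Rightarrow> real^'n"
  assumes curve: "boundary_curve a b L g N \<nu>"
    and G: "G = region L g"
    and data: "smooth_data G L g N \<nu> ulo uhi f \<Phi> \<Phi>1 \<Phi>0"
    and control: "admissible_control G ulo uhi u"
    and state: "is_state a b G f x1 x2 u x xs xt"
    and riemann: "linearized_riemann G f u x xs xt R"
    and costate: "\<psi> = costate G L g N \<nu> \<Phi> \<Phi>1 \<Phi>0 u x xs xt R"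
  shows
    "(\<forall>\<mu>. flat_interior L g \<mu> \<and> \<mu> \<notin> \<nu> ` {0..Suc N} \<longrightarrow> (\<forall>j. \<exists>\<psi>\<mu>.
        ((\<lambda>\<mu>'. \<psi> (g \<mu>') $ j) has_real_derivative \<psi>\<mu>) (at \<mu>) \<and>
        ((n1 g \<mu>)\<^sup>2 - (n2 g \<mu>)\<^sup>2) * \<psi>\<mu>
        + n1 g \<mu> * partial j (\<lambda>p. hamiltonian f \<Phi> (g \<mu>) (x (g \<mu>)) p (xt (g \<mu>)) (\<psi> (g \<mu>)) (u (g \<mu>)))
            (xs (g \<mu>))
        + n2 g \<mu> * partial j (\<lambda>q. hamiltonian f \<Phi> (g \<mu>) (x (g \<mu>)) (xs (g \<mu>)) q (\<psi> (g \<mu>)) (u (g \<mu>)))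
            (xt (g \<mu>))
        + Phi1_x g \<Phi>1 x xs xt j \<mu> - deriv (Phi1_eta g \<Phi>1 x xs xt j) \<mu> = 0)) \<and>
     (\<forall>\<mu>. oblique_interior L g \<mu> \<and> \<mu> \<notin> \<nu> ` {0..Suc N} \<longrightarrow> (\<forall>j.
        ((\<lambda>z. \<psi> z $ j) \<longlongrightarrow> 0) (at (g \<mu>) within interior (regular_part G g N \<nu>)) \<and>
        (n2 g \<mu> \<noteq> 0 \<longrightarrow> (\<exists>\<psi>s.
          (\<forall>\<^sub>F (s, t) in at (g \<mu>) within interior (regular_part G g N \<nu>).
             ((\<lambda>s'. \<psi> (s', t) $ j) has_real_derivative \<psi>s (s, t)) (at s)) \<and>
          ((\<lambda>z. n2 g \<mu> * \<psi>s z) \<longlongrightarrow> - F_curve g \<Phi> \<Phi>1 u x xs xt j \<mu>)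
             (at (g \<mu>) within interior (regular_part G g N \<nu>)))) \<and>
        (n1 g \<mu> \<noteq> 0 \<longrightarrow> (\<exists>\<psi>t.
          (\<forall>\<^sub>F (s, t) in at (g \<mu>) within interior (regular_part G g N \<nu>).
             ((\<lambda>t'. \<psi> (s, t') $ j) has_real_derivative \<psi>t (s, t)) (at t)) \<and>
          ((\<lambda>z. n1 g \<mu> * \<psi>t z) \<longlongrightarrow> - F_curve g \<Phi> \<Phi>1 u x xs xt j \<mu>)
             (at (g \<mu>) within interior (regular_part G g N \<nu>))))))"
proof -
  interpret control_problem a b L g N \<nu> G ulo uhi f \<Phi> \<Phi>1 \<Phi>0 x1 x2 u x xs xt R
    by unfold_locales (fact assms)+
  show ?thesis
    unfolding costate
  proof (intro conjI allI impI, goal_cases)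
    case (1 \<mu> j)
    then show ?case by (intro flat_equation) auto
  next
    case (2 \<mu> j)
    then obtain \<alpha> \<beta> where "0 \<le> \<alpha>" "\<alpha> < \<mu>" "\<mu> < \<beta>" "\<beta> \<le> L" "\<mu> \<notin> vertices" "oblique_arc g \<alpha> \<beta>"
      unfolding oblique_interior_def by blast
    then show ?case by (rule oblique_limits(1))
  next
    case (3 \<mu> j)
    then obtain \<alpha> \<beta> where "0 \<le> \<alpha>" "\<alpha> < \<mu>" "\<mu> < \<beta>" "\<beta> \<le> L" "\<mu> \<notin> vertices" "oblique_arc g \<alpha> \<beta>"
      unfolding oblique_interior_def by blast
    then show ?case using 3(2) by (rule oblique_limits(2))
  next
    case (4 \<mu> j)
    then obtain \<alpha> \<beta> where "0 \<le> \<alpha>" "\<alpha> < \<mu>" "\<mu> < \<beta>" "\<beta> \<le> L" "\<mu> \<notin> vertices" "oblique_arc g \<alpha> \<beta>"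
      unfolding oblique_interior_def by blast
    then show ?case using 4(2) by (rule oblique_limits(3))
  qed
qed

end
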